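(* Let $(\theta_1,\theta_2)\in\Omega_{+,1}\cup\Omega_{-,4}$, $\theta=(\theta_1,\theta_2,0)$, $u=(u_1,u_2,0)=(\Lambda(\theta_1,\theta_2),0)$, $g_u=(e_1,\tfrac14u)\in N_{3,2}$, and, for $|x|>0$, $g=(|x|e_1,\tfrac14|x|^2u)\in N_{3,2}$. Then $$d(g_u)^2=\frac{\theta_1^2}{|\theta|^2}+\frac{\theta_2^2}{\sin^2|\theta|}=-\theta_2^2\,\psi(|\theta|)+u\cdot\theta+1=\varphi_1(|\theta|)\Big(u_1\frac{\theta_1}{|\theta|}+u_2\frac{\theta_2}{|\theta|}\Big)+1$$ $$=\varphi_2(|\theta|)\,u_1\frac{|\theta|}{\theta_1}+1=\varphi_3(|\theta|)\sqrt{u_1\Big(u_1+u_2\frac{\theta_2}{\theta_1}\Big)}+1.$$ In particular, $d(g_u)^2=\phi(g_u;\theta)$ and $d(g)^2=\phi(g;\theta)$.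
   Context: $N_{3,2}=\mathbb R^3\times\mathbb R^3$ with $(x,t)\cdot(x',t')=(x+x',\,t+t'-\tfrac12x\times x')$ ($\times$ = cross product). Left-invariant fields: $X_1=\partial_{x_1}-\tfrac12x_3\partial_{t_2}+\tfrac12x_2\partial_{t_3}$, $X_2=\partial_{x_2}+\tfrac12x_3\partial_{t_1}-\tfrac12x_1\partial_{t_3}$, $X_3=\partial_{x_3}-\tfrac12x_2\partial_{t_1}+\tfrac12x_1\partial_{t_2}$. $d(g)$ is the Carnot--Carathéodory distance from the identity to $g$ defined by $X_1,X_2,X_3$ (infimum of lengths of horizontal curves, $X_1,X_2,X_3$ orthonormal). $e_1=(1,0,0)$. $\psi(r)=\frac{1-r\cot r}{r^2}$ ($\psi(0)=\tfrac13$). $\vartheta_1$ is the unique solution of $\tan r=r$ in $(\pi,\tfrac32\pi)$. For $v=(v_1,v_2)$, $r=|v|$: $\mathrm K_3(v)=2\psi(r)+\frac{\psi'(r)}{r}v_2^2$; $\Omega_{+,1}=\{v:\,v_1,v_2>0,\ |v|<\pi\}$; $\Omega_{-,4}=\{v:\,v_2<0,\ \pi<v_1<|v|<\vartheta_1,\ \mathrm K_3(v)<0\}$; $\Lambda(v)=\big(\frac{\psi'(r)}{r}v_1v_2^2,\ v_2\big[\frac{\psi'(r)}{r}v_2^2+2\psi(r)\big]\big)$. For $r>0$: $\mathsf h(r)=r^2+r\sin r\cos r-2\sin^2r$ (which is positive), $\varphi_1(r)=\frac{r^2-\sin^2r}{r-\sin r\cos r}$, $\varphi_2(r)=\frac{r(r^2-\sin^2r)}{\mathsf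 h(r)}$, $\varphi_3=\sqrt{\varphi_1\varphi_2}$. Reference function: for $g=(|x|e_1,\tfrac14|x|^2u)$, $\phi(g;\tau)=|x|^2\big[1-\psi(|\tau|)(\tau_2^2+\tau_3^2)+u\cdot\tau\big]$, $\tau=(\tau_1,\tau_2,\tau_3)\in\mathbb R^3$. *)

theory Defs
  imports "HOL-Analysis.Analysis"
begin

section \<open>The group \<open>N\<^sub>3\<^sub>,\<^sub>2\<close> and its Carnot--Caratheodory distance\<close>

type_synonym n32 = "(real^3) \<times> (real^3)"

definition n32_mult :: "n32 \<Rightarrow> n32 \<Rightarrow> n32" where
  "n32_mult g h = (fst g + fst h, snd g + snd h - (1/2) *\<^sub>R cross3 (fst g) (fst h))"

abbreviation e\<^sub>1 :: "real^3" where "e\<^sub>1 \<equiv> axis 1 1"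
abbreviation e\<^sub>2 :: "real^3" where "e\<^sub>2 \<equiv> axis 2 1"
abbreviation e\<^sub>3 :: "real^3" where "e\<^sub>3 \<equiv> axis 3 1"

definition X\<^sub>1 :: "n32 \<Rightarrow> n32" where
  "X\<^sub>1 g = (let x = fst g in (e\<^sub>1, vector [0, - (1/2) * x$3, (1/2) * x$2]))"

definition X\<^sub>2 :: "n32 \<Rightarrow> n32" where
  "X\<^sub>2 g = (let x = fst g in (e\<^sub>2, vector [(1/2) * x$3, 0, - (1/2) * x$1]))"

definition X\<^sub>3 :: "n32 \<Rightarrow> n32" where
  "X\<^sub>3 g = (let x = fst g in (e\<^sub>3, vector [- (1/2) * x$2, (1/2) * x$1, 0]))"

lemma n32_mult_0: "n32_mult 0 g = g" "n32_mult g 0 = g"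
  by (simp_all add: n32_mult_def)

lemma n32_mult_assoc: "n32_mult (n32_mult f g) h = n32_mult f (n32_mult g h)"
  by (simp add: n32_mult_def cross_add_left cross_add_right algebra_simps)

text \<open>The fields are the left-invariant fields for this product that equal
  \<open>\<partial>/\<partial>x\<^sub>j\<close> at the identity.\<close>

lemma X_left_invariant:
  "((\<lambda>s. n32_mult g (s *\<^sub>R e\<^sub>1, 0)) has_vector_derivative X\<^sub>1 g) (at 0)"
  "((\<lambda>s. n32_mult g (s *\<^sub>R e\<^sub>2, 0)) has_vector_derivative X\<^sub>2 g) (at 0)"
  "((\<lambda>s. n32_mult g (s *\<^sub>R e\<^sub>3, 0)) has_vector_derivative X\<^sub>3 g) (at 0)"
proof -
  have *: "((\<lambda>s. n32_mult g (s *\<^sub>R w, 0)) has_vector_derivative (w, - (1/2) *\<^sub>R cross3 (fst g) w)) (at 0)"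
    for w
    by (auto simp: n32_mult_def cross_mult_right intro!: derivative_eq_intros)
  have "X\<^sub>1 g = (e\<^sub>1, - (1/2) *\<^sub>R cross3 (fst g) e\<^sub>1)"
    "X\<^sub>2 g = (e\<^sub>2, - (1/2) *\<^sub>R cross3 (fst g) e\<^sub>2)"
    "X\<^sub>3 g = (e\<^sub>3, - (1/2) *\<^sub>R cross3 (fst g) e\<^sub>3)"
    by (simp_all add: X\<^sub>1_def X\<^sub>2_def X\<^sub>3_def Let_def cross3_def axis_def vec_eq_iff forall_3)
  then show "((\<lambda>s. n32_mult g (s *\<^sub>R e\<^sub>1, 0)) has_vector_derivative X\<^sub>1 g) (at 0)"
    "((\<lambda>s. n32_mult g (s *\<^sub>R e\<^sub>2, 0)) has_vector_derivative X\<^sub>2 g) (at 0)"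
    "((\<lambda>s. n32_mult g (s *\<^sub>R e\<^sub>3, 0)) has_vector_derivative X\<^sub>3 g) (at 0)"
    using *[of e\<^sub>1] *[of e\<^sub>2] *[of e\<^sub>3] by simp_all
qed

text \<open>An absolutely continuous curve with \<open>\<gamma>' = a\<^sub>1 X\<^sub>1(\<gamma>) + a\<^sub>2 X\<^sub>2(\<gamma>) + a\<^sub>3 X\<^sub>3(\<gamma>)\<close> almost everywhere
  on \<open>[0,1]\<close>.  Absolute continuity is expressed by saying that \<open>\<gamma>\<close> is the indefinite integral of its
  (Lebesgue integrable) derivative.  The coefficients are determined almost everywhere by \<open>\<gamma>\<close>,
  since the \<open>X\<^sub>j\<close> are linearly independent at each point.\<close>

definition horizontal_curve :: "(real \<Rightarrow> n32) \<Rightarrow> (real \<Rightarrow> real^3) \<Rightarrow> bool" where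
  "horizontal_curve \<gamma> a \<longleftrightarrow>
     a absolutely_integrable_on {0..1} \<and>
     (\<forall>s\<in>{0..1}.
        ((\<lambda>\<sigma>. a \<sigma> $ 1 *\<^sub>R X\<^sub>1 (\<gamma> \<sigma>) + a \<sigma> $ 2 *\<^sub>R X\<^sub>2 (\<gamma> \<sigma>) + a \<sigma> $ 3 *\<^sub>R X\<^sub>3 (\<gamma> \<sigma>))
           has_integral (\<gamma> s - \<gamma> 0)) {0..s})"

text \<open>As \<open>X\<^sub>1, X\<^sub>2, X\<^sub>3\<close> are orthonormal, the speed of \<open>\<gamma>\<close> is the Euclidean norm of \<open>a\<close>.\<close>

definition horizontal_length :: "(real \<Rightarrow> real^3) \<Rightarrow> real" where
  "horizontal_length a = integral {0..1} (\<lambda>s. norm (a s))"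

definition cc_dist :: "n32 \<Rightarrow> real" where
  "cc_dist g = Inf {horizontal_length a | \<gamma> a. horizontal_curve \<gamma> a \<and> \<gamma> 0 = 0 \<and> \<gamma> 1 = g}"


section \<open>Auxiliary functions and domains\<close>

definition \<psi> :: "real \<Rightarrow> real" where
  "\<psi> r = (if r = 0 then 1/3 else (1 - r * cot r) / r^2)"

definition vartheta\<^sub>1 :: real where
  "vartheta\<^sub>1 = (THE r. pi < r \<and> r < 3/2 * pi \<and> tan r = r)"

definition K\<^sub>3 :: "real^2 \<Rightarrow> real" where
  "K\<^sub>3 v = (let r = norm v in 2 * \<psi> r + deriv \<psi> r / r * (v$2)^2)"

definition \<Omega>_plus_1 :: "(real^2) set" where
  "\<Omega>_plus_1 = {v. v$1 > 0 \<and> v$2 > 0 \<and> norm v < pi}"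

definition \<Omega>_minus_4 :: "(real^2) set" where
  "\<Omega>_minus_4 = {v. v$2 < 0 \<and> pi < v$1 \<and> v$1 < norm v \<and> norm v < vartheta\<^sub>1 \<and> K\<^sub>3 v < 0}"

definition \<Lambda> :: "real^2 \<Rightarrow> real^2" where
  "\<Lambda> v = (let r = norm v in
     vector [deriv \<psi> r / r * v$1 * (v$2)^2,
             v$2 * (deriv \<psi> r / r * (v$2)^2 + 2 * \<psi> r)])"

definition h_fun :: "real \<Rightarrow> real" where
  "h_fun r = r^2 + r * sin r * cos r - 2 * (sin r)^2"

definition \<phi>\<^sub>1 :: "real \<Rightarrow> real" where
  "\<phi>\<^sub>1 r = (r^2 - (sin r)^2) / (r - sin r * cos r)"

definition \<phi>\<^sub>2 :: "real \<Rightarrow> real" where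
  "\<phi>\<^sub>2 r = r * (r^2 - (sin r)^2) / h_fun r"

definition \<phi>\<^sub>3 :: "real \<Rightarrow> real" where
  "\<phi>\<^sub>3 r = sqrt (\<phi>\<^sub>1 r * \<phi>\<^sub>2 r)"

text \<open>The reference function is only meant for points \<open>g = (\<bar>x\<bar> e\<^sub>1, \<bar>x\<bar>\<^sup>2/4 u)\<close> with \<open>\<bar>x\<bar> > 0\<close>;
  \<open>\<bar>x\<bar>\<close> and \<open>u\<close> are recovered from the components of \<open>g\<close>.\<close>

definition \<phi> :: "n32 \<Rightarrow> real^3 \<Rightarrow> real" where
  "\<phi> g \<tau> = (let \<rho> = norm (fst g); u = (4 / \<rho>^2) *\<^sub>R snd g in
     \<rho>^2 * (1 - \<psi> (norm \<tau>) * ((\<tau>$2)^2 + (\<tau>$3)^2) + u \<bullet> \<tau>))"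

lemma \<phi>_eq:
  assumes "\<rho> > 0"
  shows "\<phi> (\<rho> *\<^sub>R e\<^sub>1, (\<rho>^2 / 4) *\<^sub>R u) \<tau>
         = \<rho>^2 * (1 - \<psi> (norm \<tau>) * ((\<tau>$2)^2 + (\<tau>$3)^2) + u \<bullet> \<tau>)"
  using assms by (simp add: \<phi>_def)

end

theory Submission
  imports Defs "HOL-Real_Asymp.Real_Asymp"
begin

text \<open>For all covectors considered the geodesic is an arc of a helix which, for half rotation angle
  \<open>R \<in> (\<pi>, \<vartheta>\<^sub>1)\<close>, reaches a point \<open>(x, t)\<close> with \<open>t\<close> parallel to \<open>x\<close>.  Since a sub-arc of a minimiser is a minimiser, it is
  enough to prove minimality up to that time.

  For such an endpoint, recentre the projection of a competitor to the plane \<open>x\<^sup>\<bottom>\<close> at its mean, rotate it so that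
  the mean lies on a coordinate axis, at distance \<open>p\<close>, and split all coordinates into even and odd parts about the
  midpoint.  The Lagrangian of the constrained energy then decouples into one-dimensional problems, each of which is a sum of
  squares plus the derivative of an explicit quadratic value function (a Riccati solution).  The result is
  \<open>L\<^sup>2 \<ge> \<rho>\<^sup>2 + 4 \<kappa> p \<rho> + 4 \<lambda> \<tau> + 4 p\<^sup>2 / \<psi>(r)\<close> for \<open>\<rho> = |x|\<close>, \<open>\<tau> = |t|\<close> and all multipliers \<open>\<kappa>\<^sup>2 + \<lambda>\<^sup>2 = r\<^sup>2\<close> with
  \<open>r\<^sup>2 \<le> \<lambda>\<^sup>2 (1 - 3 \<psi>(r))\<close>.  Beyond \<open>r = \<pi>\<close> the squared distance is no longer a supremum over multipliers that are
  independent of the competitor, but choosing \<open>\<kappa>, \<lambda>\<close> in terms of \<open>p\<close> makes the bound sharp; this reduces to the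
  monotonicity of a function of one variable.\<close>

section \<open>Trigonometric inequalities and the choice of multipliers\<close>

text \<open>The obstacle: the functional "integral of g'^2 - g^2" behind both one-dimensional
  problems is bounded below only up to half angle pi/2 for even g (value at the end given) and up to
  pi for odd g. Prescribed moments carry it further. Recentring makes the integral of the even part
  zero, and with this moment as an extra state the determinant of the even problem is T cos T - sin
  T, whose first positive zero solves tan T = T. This is how \<open>vartheta\<^sub>1\<close> enters
  the lower bound.

  For the odd part the moment "integral of T g" stays unknown. Its negative contribution is balanced
  by a multiplier for the zero mean of the second transversal coordinate, and the balance has the
  right sign exactly if r^2 \<le> \<lambda>^2 (1 - 3 \<psi>(r)): this is the origin of the side
  condition.

  The recentred curve starts and ends at transversal coordinate p; 4 p^2 / \<psi>(r) is the boundary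
  value of the even problem. It is negative, since \<psi> < 0 on (\<pi>,
  \<open>vartheta\<^sub>1\<close>), and competes with the term linear in p.\<close>

lemma pi_less_imp_pos: "pi < r \<Longrightarrow> 0 < r"
  using pi_gt_zero by linarith

lemma DERIV_xcos_minus_sin:
  "((\<lambda>r. r * cos r - sin r) has_real_derivative - (r * sin r)) (at r)"
  by (auto intro!: derivative_eq_intros)

lemma xcos_minus_sin_strict_mono:
  assumes "pi \<le> a" "a < b" "b \<le> 3/2 * pi"
  shows "a * cos a - sin a < b * cos b - sin b"
proof (rule DERIV_pos_imp_increasing_open[OF assms(2)])
  fix x assume x: "a < x" "x < b"
  then have "sin x < 0" using assms by (intro sin_lt_zero) auto
  then have "- (x * sin x) > 0" using x assms pi_gt_zero by (simp add: mult_pos_neg)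
  then show "\<exists>y. DERIV (\<lambda>r. r * cos r - sin r) x :> y \<and> y > 0"
    using DERIV_xcos_minus_sin by blast
qed (intro continuous_intros)

lemma cos_neg_third_quadrant:
  assumes "pi < r" "r < 3/2 * pi"
  shows "cos r < 0"
proof -
  have "cos (r - pi) > 0" using assms by (intro cos_gt_zero_pi) auto
  then show ?thesis by (simp add: cos_diff)
qed

text \<open>Clearing the denominator of tan r = r leaves r cos r - sin r, which has no pole and
  increases on [\<pi>, 3\<pi>/2] from -\<pi> to 1.\<close>

lemma vartheta1_properties:
  shows vartheta1_gt_pi: "pi < vartheta\<^sub>1" and vartheta1_less: "vartheta\<^sub>1 < 3/2 * pi"
    and vartheta1_root: "vartheta\<^sub>1 * cos vartheta\<^sub>1 - sin vartheta\<^sub>1 = 0"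
proof -
  let ?d = "\<lambda>r::real. r * cos r - sin r"
  have s: "sin (3/2 * pi) = -1" using sin_3over2_pi by (simp add: field_simps)
  have c: "cos (3/2 * pi) = 0" using cos_3over2_pi by (simp add: field_simps)
  have "\<exists>x\<ge>pi. x \<le> 3/2 * pi \<and> ?d x = 0"
    by (rule IVT') (use pi_gt_zero s c in \<open>auto intro!: continuous_intros\<close>)
  then obtain x where x: "pi \<le> x" "x \<le> 3/2 * pi" "?d x = 0" by blast
  have "x \<noteq> pi" using x(3) by auto
  moreover have "x \<noteq> 3/2 * pi" using x(3) s c by (metis diff_0 mult_zero_right neg_equal_0_iff_equal zero_neq_one minus_minus)
  ultimately have x': "pi < x" "x < 3/2 * pi" using x by auto
  have iff: "tan r = r \<longleftrightarrow> ?d r = 0" if "pi < r" "r < 3/2 * pi" for r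
    using cos_neg_third_quadrant[OF that] by (auto simp: tan_def field_simps)
  have "vartheta\<^sub>1 = x"
    unfolding vartheta\<^sub>1_def
  proof (rule the_equality)
    show "pi < x \<and> x < 3/2 * pi \<and> tan x = x" using x x' iff by auto
  next
    fix r assume r: "pi < r \<and> r < 3/2 * pi \<and> tan r = r"
    then have "?d r = 0" using iff by auto
    then show "r = x"
      using xcos_minus_sin_strict_mono[of r x] xcos_minus_sin_strict_mono[of x r] r x x'
      by (cases r x rule: linorder_cases) auto
  qed
  then show "pi < vartheta\<^sub>1" "vartheta\<^sub>1 < 3/2 * pi" "vartheta\<^sub>1 * cos vartheta\<^sub>1 - sin vartheta\<^sub>1 = 0"
    using x x' by auto
qed

text \<open>The derivative -r sin r makes the function fall from 0 on (0, \<pi>] and then rise until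
  it returns to 0 at \<open>vartheta\<^sub>1\<close>.\<close>

lemma xcos_less_sin:
  assumes "0 < r" "r < vartheta\<^sub>1"
  shows "r * cos r - sin r < 0"
proof (cases "r \<le> pi")
  case True
  have "r * cos r - sin r < 0 * cos 0 - sin 0"
  proof (rule DERIV_neg_imp_decreasing_open[OF assms(1)])
    fix x assume x: "0 < x" "x < r"
    then have "sin x > 0" using True by (intro sin_gt_zero) auto
    then have "- (x * sin x) < 0" using x by simp
    then show "\<exists>y. DERIV (\<lambda>r. r * cos r - sin r) x :> y \<and> y < 0"
      using DERIV_xcos_minus_sin by blast
  qed (intro continuous_intros)
  then show ?thesis by simp
next
  case False
  then show ?thesis
    using xcos_minus_sin_strict_mono[of r "vartheta\<^sub>1"] assms vartheta1_less vartheta1_root by auto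
qed

lemma sin_neg_below_vartheta1:
  assumes "pi < r" "r \<le> vartheta\<^sub>1"
  shows "sin r < 0"
  using assms vartheta1_less by (intro sin_lt_zero) auto

text \<open>The analysis on \<open>(\<pi>, \<vartheta>\<^sub>1)\<close> is rational in \<open>r\<close> and \<open>y = r cot r - 1\<close>; note \<open>\<psi> r = - y / r\<^sup>2\<close>.\<close>

definition ycot :: "real \<Rightarrow> real" where "ycot r = r * cot r - 1"

lemma ycot_eq: "sin r \<noteq> 0 \<Longrightarrow> ycot r = (r * cos r - sin r) / sin r"
  by (simp add: ycot_def cot_def field_simps)

text \<open>One formula in the coefficient a of y, obtained from sin r * y = r cos r - sin r, taken
  at a = 1, 2, 3. It turns the trigonometric numerators and denominators of
  \<open>\<phi>\<^sub>1\<close> and \<open>\<phi>\<^sub>2\<close> into polynomials in r and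
  y.\<close>

lemma sin_ycot_identities:
  assumes "sin r \<noteq> 0"
  shows "(sin r)\<^sup>2 * (r\<^sup>2 + ycot r + (ycot r)\<^sup>2) = r * (r - sin r * cos r)"
    and "(sin r)\<^sup>2 * (r\<^sup>2 + 2 * ycot r + (ycot r)\<^sup>2) = r\<^sup>2 - (sin r)\<^sup>2"
    and "(sin r)\<^sup>2 * (r\<^sup>2 + 3 * ycot r + (ycot r)\<^sup>2) = h_fun r"
proof -
  define y S K where "y = ycot r" and "S = sin r" and "K = cos r"
  have Sy: "S * y = r * K - S" using assms by (simp add: y_def ycot_eq S_def K_def)
  have SK: "S\<^sup>2 + K\<^sup>2 = 1" by (simp add: S_def K_def)
  have "S\<^sup>2 * (r\<^sup>2 + a * y + y\<^sup>2) = r\<^sup>2 + (a - 2) * r * S * K + (1 - a) * S\<^sup>2" for a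
  proof -
    have "S\<^sup>2 * (r\<^sup>2 + a * y + y\<^sup>2) = S\<^sup>2 * r\<^sup>2 + a * S * (S * y) + (S * y)\<^sup>2" by (simp add: algebra_simps power2_eq_square)
    also have "\<dots> = r\<^sup>2 * (S\<^sup>2 + K\<^sup>2) + (a - 2) * r * S * K + (1 - a) * S\<^sup>2"
      unfolding Sy by (simp add: algebra_simps power2_eq_square)
    finally show ?thesis unfolding SK by simp
  qed
  from this[of 1] this[of 2] this[of 3]
  show "(sin r)\<^sup>2 * (r\<^sup>2 + ycot r + (ycot r)\<^sup>2) = r * (r - sin r * cos r)"
    "(sin r)\<^sup>2 * (r\<^sup>2 + 2 * ycot r + (ycot r)\<^sup>2) = r\<^sup>2 - (sin r)\<^sup>2"
    "(sin r)\<^sup>2 * (r\<^sup>2 + 3 * ycot r + (ycot r)\<^sup>2) = h_fun r"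
    by (simp_all add: y_def S_def K_def h_fun_def algebra_simps power2_eq_square)
qed

lemma ycot_pos: "pi < r \<Longrightarrow> r < vartheta\<^sub>1 \<Longrightarrow> ycot r > 0"
  using xcos_less_sin[of r] sin_neg_below_vartheta1[of r] pi_gt_zero
  by (simp add: ycot_eq divide_neg_neg)

lemma ycot_vartheta1: "ycot vartheta\<^sub>1 = 0"
  using sin_neg_below_vartheta1[of "vartheta\<^sub>1"] vartheta1_gt_pi
  by (simp add: ycot_eq vartheta1_root)

text \<open>A Riccati equation for y; because of it, derivatives of rational expressions in r and y
  are again rational in r and y.\<close>

lemma DERIV_ycot:
  assumes "r \<noteq> 0" "sin r \<noteq> 0"
  shows "(ycot has_real_derivative - (r\<^sup>2 + ycot r + (ycot r)\<^sup>2) / r) (at r)"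
proof -
  have i: "inverse ((sin r)\<^sup>2) = 1 + (cot r)\<^sup>2"
    using assms by (simp add: cot_def field_simps)
  have "((\<lambda>r. r * cot r - 1) has_real_derivative cot r - r * (1 + (cot r)\<^sup>2)) (at r)"
    using DERIV_cot[OF assms(2)] i by (auto intro!: derivative_eq_intros simp: algebra_simps)
  moreover have "cot r - r * (1 + (cot r)\<^sup>2) = - (r\<^sup>2 + ycot r + (ycot r)\<^sup>2) / r"
    using assms by (simp add: ycot_def field_simps power2_eq_square)
  ultimately show ?thesis
    unfolding ycot_def[abs_def] by simp
qed

lemma continuous_on_ycot:
  assumes "pi < a" "b \<le> vartheta\<^sub>1"
  shows "continuous_on {a..b} ycot"
proof -
  have sn: "sin r \<noteq> 0" if "r \<in> {a..b}" for r
    using sin_neg_below_vartheta1[of r] assms that by auto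
  have "continuous_on {a..b} (\<lambda>r. (r * cos r - sin r) / sin r)"
    using sn by (intro continuous_intros) auto
  moreover have "\<And>r. r \<in> {a..b} \<Longrightarrow> (r * cos r - sin r) / sin r = ycot r"
    using sn by (simp add: ycot_eq)
  ultimately show ?thesis by (rule continuous_on_eq)
qed

lemma ycot_antimono:
  assumes "pi < a" "a \<le> b" "b < vartheta\<^sub>1"
  shows "ycot b \<le> ycot a"
proof (rule DERIV_nonpos_imp_nonincreasing[OF assms(2)])
  fix x assume x: "a \<le> x" "x \<le> b"
  then have "pi < x" "x < vartheta\<^sub>1" using assms by auto
  then have "0 < x" "sin x \<noteq> 0" "ycot x > 0"
    using pi_gt_zero sin_neg_below_vartheta1[of x] ycot_pos[of x] by linarith+
  moreover from this have "0 \<le> x\<^sup>2 + ycot x + (ycot x)\<^sup>2"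
    by (intro add_nonneg_nonneg) auto
  then have "- (x\<^sup>2 + ycot x + (ycot x)\<^sup>2) / x \<le> 0"
    using \<open>0 < x\<close> by (intro divide_nonpos_pos) auto
  ultimately show "\<exists>y. DERIV ycot x :> y \<and> y \<le> 0"
    using DERIV_ycot[of x] by blast
qed

text \<open>Squared first component of the covector at which the geodesic of parameter \<open>r\<close> reaches the cut locus.\<close>

definition lamsq :: "real \<Rightarrow> real" where
  "lamsq r = r\<^sup>2 * (r\<^sup>2 + ycot r + (ycot r)\<^sup>2) / (r\<^sup>2 + 3 * ycot r + (ycot r)\<^sup>2)"

text \<open>The square of 2|t| / |x|^2 at the point (x, t) where the geodesic of parameter r meets
  the cut locus.\<close>

definition qfun :: "real \<Rightarrow> real" where
  "qfun r = (ycot r / r\<^sup>2)\<^sup>2 * lamsq r"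

section \<open>Monotonicity along the family of cut points\<close>

lemma frac_le_cross:
  fixes a b c d :: real
  assumes "0 < b" "0 < d" "a * d \<le> c * b"
  shows "a / b \<le> c / d"
  using assms by (simp add: divide_simps)

text \<open>This is \<open>qfun\<close> with r^2 and y as independent variables. It increases in y
  and decreases in r^2, so the comparison passes through the mixed point (Q, y); in each half the
  cross-multiplied difference factors with nonnegative coefficients.\<close>

lemma rational_q_mono:
  fixes R Q y z :: real
  assumes "0 < R" "R \<le> Q" "0 < z" "z \<le> y"
  shows "z\<^sup>2 * (Q + z + z\<^sup>2) / (Q * (Q + 3 * z + z\<^sup>2)) \<le> y\<^sup>2 * (R + y + y\<^sup>2) / (R * (R + 3 * y + y\<^sup>2))"
proof -
  have "z\<^sup>2 * (Q + z + z\<^sup>2) / (Q * (Q + 3 * z + z\<^sup>2)) \<le> y\<^sup>2 * (Q + y + y\<^sup>2) / (Q * (Q + 3 * y + y\<^sup>2))"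
  proof -
    have Q: "0 < Q" using assms by simp
    have pos: "0 < Q + 3 * z + z\<^sup>2" "0 < Q + 3 * y + y\<^sup>2" using Q assms by (auto intro!: add_pos_pos)
    have "y\<^sup>2 * (Q + y + y\<^sup>2) * (Q + 3 * z + z\<^sup>2) - z\<^sup>2 * (Q + z + z\<^sup>2) * (Q + 3 * y + y\<^sup>2)
        = (y - z) * (Q\<^sup>2 * (y + z) + 3 * Q * y * z + Q * (y\<^sup>2 + y * z + z\<^sup>2) + 3 * y * z * (y + z) + y\<^sup>2 * z\<^sup>2
            + Q * (y + z) * (y\<^sup>2 + z\<^sup>2) + 3 * y * z * (y\<^sup>2 + y * z + z\<^sup>2) + y\<^sup>2 * z\<^sup>2 * (y + z))"
      by (simp add: algebra_simps power2_eq_square)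
    also have "\<dots> \<ge> 0"
      using assms Q by (intro mult_nonneg_nonneg add_nonneg_nonneg) auto
    finally have "z\<^sup>2 * (Q + z + z\<^sup>2) * (Q + 3 * y + y\<^sup>2) \<le> y\<^sup>2 * (Q + y + y\<^sup>2) * (Q + 3 * z + z\<^sup>2)"
      by simp
    then have "Q * (z\<^sup>2 * (Q + z + z\<^sup>2) * (Q + 3 * y + y\<^sup>2)) \<le> Q * (y\<^sup>2 * (Q + y + y\<^sup>2) * (Q + 3 * z + z\<^sup>2))"
      using Q by (intro mult_left_mono) auto
    then show ?thesis using pos Q by (intro frac_le_cross) (auto simp: mult_ac)
  qed
  also have "\<dots> \<le> y\<^sup>2 * (R + y + y\<^sup>2) / (R * (R + 3 * y + y\<^sup>2))"
  proof -
    have y: "0 < y" and Q: "0 < Q" using assms by auto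
    have pos: "0 < R + 3 * y + y\<^sup>2" "0 < Q + 3 * y + y\<^sup>2" using y Q assms by (auto intro!: add_pos_pos)
    have "(R + y + y\<^sup>2) * (Q * (Q + 3 * y + y\<^sup>2)) - (Q + y + y\<^sup>2) * (R * (R + 3 * y + y\<^sup>2))
        = (Q - R) * (Q * R + (y + y\<^sup>2) * (Q + R) + (y + y\<^sup>2) * (3 * y + y\<^sup>2))"
      by (simp add: algebra_simps power2_eq_square)
    also have "\<dots> \<ge> 0"
      using assms Q y by (intro mult_nonneg_nonneg add_nonneg_nonneg) auto
    finally have "(Q + y + y\<^sup>2) / (Q * (Q + 3 * y + y\<^sup>2)) \<le> (R + y + y\<^sup>2) / (R * (R + 3 * y + y\<^sup>2))"
      using pos Q assms(1) by (intro frac_le_cross) auto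
    then show ?thesis
      by (metis mult_left_mono times_divide_eq_right zero_le_power2)
  qed
  finally show ?thesis .
qed

text \<open>The last inequality is the side condition on the multipliers for the covectors of the
  geodesic family. After clearing denominators the right side exceeds the left by r^2 y + 3 y^2 + 3
  y^3.\<close>

lemma rational_facts:
  fixes r y :: real
  assumes "0 < r" "0 < y"
  defines "B \<equiv> r\<^sup>2 + 3 * y + y\<^sup>2"
  shows "0 < B"
    and "r\<^sup>2 * (r\<^sup>2 + y + y\<^sup>2) / B = r\<^sup>2 - 2 * y * r\<^sup>2 / B"
    and "r\<^sup>2 \<le> r\<^sup>2 * (r\<^sup>2 + y + y\<^sup>2) / B * (1 + 3 * (y / r\<^sup>2))"
proof -
  show B: "0 < B" using assms by (auto simp: B_def intro!: add_pos_pos)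
  then show "r\<^sup>2 * (r\<^sup>2 + y + y\<^sup>2) / B = r\<^sup>2 - 2 * y * r\<^sup>2 / B"
    by (simp add: field_simps) (simp add: B_def algebra_simps)
  have "r\<^sup>2 * B \<le> (r\<^sup>2 + y + y\<^sup>2) * (r\<^sup>2 + 3 * y)"
    using assms by (simp add: B_def algebra_simps power2_eq_square)
  then have "r\<^sup>2 \<le> (r\<^sup>2 + y + y\<^sup>2) * (r\<^sup>2 + 3 * y) / B"
    using B by (simp add: pos_le_divide_eq)
  also have "\<dots> = r\<^sup>2 * (r\<^sup>2 + y + y\<^sup>2) / B * (1 + 3 * (y / r\<^sup>2))"
    using assms(1) B by (simp add: divide_simps)
  finally show "r\<^sup>2 \<le> r\<^sup>2 * (r\<^sup>2 + y + y\<^sup>2) / B * (1 + 3 * (y / r\<^sup>2))" .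
qed

lemma lamsq_facts:
  assumes "pi < r" "r < vartheta\<^sub>1"
  shows "0 < lamsq r" "lamsq r < r\<^sup>2" "r\<^sup>2 \<le> lamsq r * (1 + 3 * (ycot r / r\<^sup>2))"
proof -
  have r: "0 < r" "0 < ycot r" using assms ycot_pos pi_less_imp_pos by auto
  note f = rational_facts[OF r]
  show "0 < lamsq r" unfolding lamsq_def
    using r f(1) by (intro divide_pos_pos mult_pos_pos add_pos_pos) auto
  show "lamsq r < r\<^sup>2" unfolding lamsq_def f(2) using r f(1) by simp
  show "r\<^sup>2 \<le> lamsq r * (1 + 3 * (ycot r / r\<^sup>2))" unfolding lamsq_def by (rule f(3))
qed

lemma qfun_eq: "r \<noteq> 0 \<Longrightarrow> qfun r = (ycot r)\<^sup>2 * (r\<^sup>2 + ycot r + (ycot r)\<^sup>2) / (r\<^sup>2 * (r\<^sup>2 + 3 * ycot r + (ycot r)\<^sup>2))"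
  by (simp add: qfun_def lamsq_def power2_eq_square)

lemma qfun_antimono:
  assumes "pi < a" "a \<le> b" "b < vartheta\<^sub>1"
  shows "qfun b \<le> qfun a"
proof -
  have "0 < a" using assms pi_gt_zero by linarith
  moreover have "a\<^sup>2 \<le> b\<^sup>2" using \<open>0 < a\<close> assms by (intro power_mono) auto
  ultimately show ?thesis
    using rational_q_mono[of "a\<^sup>2" "b\<^sup>2" "ycot b" "ycot a"] ycot_pos[of b] ycot_antimono[of a b] assms
    by (simp add: qfun_eq)
qed

text \<open>The expression is the bound for p below its critical value, \<open>m\<close> being the
  square of 2|t| / |x|^2. By the Riccati equation its derivative is a positive factor times
  \<open>m - qfun r\<close>, and \<open>qfun\<close> decreases.\<close>

lemma small_p_value_mono:
  assumes "pi < R" "R \<le> r" "r < vartheta\<^sub>1" "m = qfun R"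
  shows "ycot R + m * R\<^sup>2 / ycot R \<le> ycot r + m * r\<^sup>2 / ycot r"
proof (rule DERIV_nonneg_imp_nondecreasing[OF assms(2)])
  fix x assume x: "R \<le> x" "x \<le> r"
  then have x': "pi < x" "x < vartheta\<^sub>1" using assms by auto
  have x0: "0 < x" "0 < ycot x" "sin x \<noteq> 0"
    using x' ycot_pos pi_less_imp_pos sin_neg_below_vartheta1[of x] by auto
  define y where "y = ycot x"
  define B where "B = x\<^sup>2 + 3 * y + y\<^sup>2"
  define y' where "y' = - (x\<^sup>2 + y + y\<^sup>2) / x"
  have B: "0 < B" "0 < y" using rational_facts(1)[OF x0(1,2)] x0 by (auto simp: B_def y_def)
  have d: "((\<lambda>x. ycot x + m * x\<^sup>2 / ycot x) has_real_derivative y' + (m * (2 * x) * y - m * x\<^sup>2 * y') / (y * y)) (at x)"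
    using x0 DERIV_ycot[of x] unfolding y_def y'_def
    by (auto intro!: derivative_eq_intros)
  have "y' + (m * (2 * x) * y - m * x\<^sup>2 * y') / (y * y) = x * B / y\<^sup>2 * (m - y\<^sup>2 * (x\<^sup>2 + y + y\<^sup>2) / (x\<^sup>2 * B))"
    using B x0(1) unfolding y'_def
    by (simp add: field_simps) (simp add: B_def algebra_simps power2_eq_square power4_eq_xxxx)
  also have "y\<^sup>2 * (x\<^sup>2 + y + y\<^sup>2) / (x\<^sup>2 * B) = qfun x"
    using x0 by (simp add: qfun_eq y_def B_def)
  also have "x * B / y\<^sup>2 * (m - qfun x) \<ge> 0"
    using qfun_antimono[of R x] x assms x0 B by simp
  finally show "\<exists>d. ((\<lambda>x. ycot x + m * x\<^sup>2 / ycot x) has_real_derivative d) (at x) \<and> 0 \<le> d"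
    using d by blast
qed

text \<open>Value of \<open>4 \<kappa> p - 4 p\<^sup>2 / n\<close>, \<open>n = y / r\<^sup>2\<close>, along the geodesic family.\<close>

definition Pfun :: "real \<Rightarrow> real" where
  "Pfun r = 2 * (ycot r)\<^sup>2 / (r\<^sup>2 + 3 * ycot r + (ycot r)\<^sup>2)"

lemma Pfun_lamsq:
  assumes "pi < r" "r < vartheta\<^sub>1"
  shows "lamsq r = r\<^sup>2 - Pfun r * r\<^sup>2 / ycot r"
  using rational_facts(2)[of r "ycot r"] ycot_pos[OF assms] pi_less_imp_pos assms
  by (simp add: lamsq_def Pfun_def power2_eq_square)

text \<open>The counterpart for p above its critical value. The derivative is P' times a positive
  multiple of sqrt(\<open>qfun r\<close>) - m, where P' \<le> 0 is the derivative of
  \<open>Pfun\<close>; the second factor is nonnegative to the left of R.\<close>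

lemma large_p_value_mono:
  assumes "pi < r" "r \<le> R" "R < vartheta\<^sub>1" "0 \<le> m" "m\<^sup>2 = qfun R"
  shows "Pfun R + 2 * m * sqrt (lamsq R) \<le> Pfun r + 2 * m * sqrt (lamsq r)"
proof (rule DERIV_nonpos_imp_nonincreasing[OF assms(2)])
  fix x assume x: "r \<le> x" "x \<le> R"
  then have x': "pi < x" "x < vartheta\<^sub>1" using assms by auto
  have x0: "0 < x" "0 < ycot x" "sin x \<noteq> 0"
    using x' ycot_pos pi_less_imp_pos sin_neg_below_vartheta1[of x] by auto
  define y where "y = ycot x"
  define B where "B = x\<^sup>2 + 3 * y + y\<^sup>2"
  define y' where "y' = - (x\<^sup>2 + y + y\<^sup>2) / x"
  define P' where "P' = 2 * y * (y' * (2 * x\<^sup>2 + 3 * y) - 2 * x * y) / B\<^sup>2"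
  have B: "0 < B" "0 < y" using rational_facts(1)[OF x0(1,2)] x0 by (auto simp: B_def y_def)
  have y: "(ycot has_real_derivative y') (at x)"
    using DERIV_ycot[of x] x0 by (simp add: y'_def y_def)
  have P: "(Pfun has_real_derivative P') (at x)"
  proof -
    have "((\<lambda>r. 2 * (ycot r)\<^sup>2 / (r\<^sup>2 + 3 * ycot r + (ycot r)\<^sup>2)) has_real_derivative
        (2 * (2 * y * y') * B - 2 * y\<^sup>2 * (2 * x + 3 * y' + 2 * y * y')) / (B * B)) (at x)"
      using y B by (auto intro!: derivative_eq_intros simp: B_def y_def)
    also have "(2 * (2 * y * y') * B - 2 * y\<^sup>2 * (2 * x + 3 * y' + 2 * y * y')) / (B * B) = P'"
      unfolding P'_def by (simp add: B_def algebra_simps power2_eq_square)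
    finally show ?thesis by (simp add: Pfun_def[abs_def])
  qed
  \<comment> \<open>In the derivative of r^2 - \<open>Pfun r\<close> r^2 / y the terms without P'
    cancel, because 2 x y - x^2 y' = x B and \<open>Pfun x\<close> = 2 y^2 / B. Both summands of the
    monotone function therefore share the factor P'.\<close>
  have L: "(lamsq has_real_derivative - P' * x\<^sup>2 / y) (at x)"
  proof (rule has_field_derivative_transform_within_open[where S="{pi<..<vartheta\<^sub>1}"])
    have "((\<lambda>r. r\<^sup>2 - Pfun r * r\<^sup>2 / ycot r) has_real_derivative
        2 * x - ((P' * x\<^sup>2 + Pfun x * (2 * x)) * y - Pfun x * x\<^sup>2 * y') / (y * y)) (at x)"
      using y P B by (auto intro!: derivative_eq_intros simp: y_def)
    also have "2 * x - ((P' * x\<^sup>2 + Pfun x * (2 * x)) * y - Pfun x * x\<^sup>2 * y') / (y * y) = - P' * x\<^sup>2 / y"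
    proof -
      have "Pfun x * (2 * x * y - x\<^sup>2 * y') = 2 * x * y\<^sup>2"
      proof -
        have "2 * x * y - x\<^sup>2 * y' = x * B"
        proof -
          have "x * y' = - (x\<^sup>2 + y + y\<^sup>2)" using x0(1) by (simp add: y'_def)
          then have "x\<^sup>2 * y' = x * - (x\<^sup>2 + y + y\<^sup>2)" by (simp add: power2_eq_square)
          then show ?thesis by (simp add: B_def algebra_simps)
        qed
        then show ?thesis using B by (simp add: Pfun_def flip: y_def B_def)
      qed
      then show ?thesis using B by (simp add: field_simps power2_eq_square)
    qed
    finally show "((\<lambda>r. r\<^sup>2 - Pfun r * r\<^sup>2 / ycot r) has_real_derivative - P' * x\<^sup>2 / y) (at x)" .
  qed (use x' Pfun_lamsq in auto)
  define l where "l = sqrt (lamsq x)"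
  have l: "0 < l" "l\<^sup>2 = lamsq x" using lamsq_facts[OF x'] by (auto simp: l_def)
  have "((\<lambda>r. Pfun r + 2 * m * sqrt (lamsq r)) has_real_derivative
      P' + 2 * m * (- P' * x\<^sup>2 / y * (inverse l / 2))) (at x)"
    using P L lamsq_facts(1)[OF x'] unfolding l_def
    by (auto intro!: derivative_eq_intros)
  moreover have "P' + 2 * m * (- P' * x\<^sup>2 / y * (inverse l / 2)) = P' * (x\<^sup>2 / (y * l)) * (y / x\<^sup>2 * l - m)"
    using l B x0 by (simp add: field_simps power2_eq_square)
  moreover have "P' * (x\<^sup>2 / (y * l)) * (y / x\<^sup>2 * l - m) \<le> 0"
  proof (rule mult_nonpos_nonneg)
    have "0 \<le> x\<^sup>2 + y + y\<^sup>2" using B by (intro add_nonneg_nonneg) auto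
    then have "y' \<le> 0" using x0 by (simp add: y'_def divide_nonpos_pos)
    then have "y' * (2 * x\<^sup>2 + 3 * y) \<le> 0" using B by (intro mult_nonpos_nonneg) auto
    moreover have "0 \<le> 2 * x * y" using B x0 by simp
    ultimately have "y' * (2 * x\<^sup>2 + 3 * y) - 2 * x * y \<le> 0" by linarith
    then have "P' \<le> 0" unfolding P'_def
      using B by (intro divide_nonpos_pos mult_nonneg_nonpos) auto
    then show "P' * (x\<^sup>2 / (y * l)) \<le> 0" using B l x0 by (intro mult_nonpos_nonneg) auto
    have "m\<^sup>2 \<le> qfun x" using qfun_antimono[of x R] x x' assms by simp
    also have "\<dots> = (y / x\<^sup>2 * l)\<^sup>2" by (simp add: qfun_def y_def power_mult_distrib power_divide l(2))
    finally show "0 \<le> y / x\<^sup>2 * l - m"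
      using power2_le_imp_le[of m "y / x\<^sup>2 * l"] B l x0 by simp
  qed
  ultimately show "\<exists>d. ((\<lambda>r. Pfun r + 2 * m * sqrt (lamsq r)) has_real_derivative d) (at x) \<and> d \<le> 0"
    by (metis (no_types, lifting))
qed


text \<open>For \<open>p\<close> below its critical value the covector keeps \<open>r\<^sup>2 = \<kappa>\<^sup>2 + \<lambda>\<^sup>2\<close> with \<open>\<lambda> / \<kappa> = \<mu> / (2 p)\<close>, which
  maximises the bound for given \<open>r\<close>; above it the side condition forces the covectors of the geodesic family.\<close>

lemma optimal_multipliers:
  assumes R: "pi < R" "R < vartheta\<^sub>1" and p: "0 \<le> p"
  defines "n \<equiv> \<lambda>r. ycot r / r\<^sup>2"
  shows "\<exists>r \<kappa> l. pi < r \<and> r < vartheta\<^sub>1 \<and> \<kappa>\<^sup>2 + l\<^sup>2 = r\<^sup>2 \<and> r\<^sup>2 \<le> l\<^sup>2 * (1 + 3 * n r) \<and>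
     n R * (R\<^sup>2 + lamsq R) \<le> 2 * (n R * sqrt (lamsq R)) * l + 4 * \<kappa> * p - 4 * p\<^sup>2 / n r"
proof -
  define m where "m = n R * sqrt (lamsq R)"
  have R0: "0 < R" "0 < ycot R" using R ycot_pos pi_less_imp_pos by auto
  have lR: "0 < lamsq R" "lamsq R < R\<^sup>2" using lamsq_facts[OF R] by auto
  have nR: "0 < n R" using R0 by (simp add: n_def)
  have m: "0 < m" "m\<^sup>2 = qfun R"
  proof -
    show "0 < m" using nR lR unfolding m_def by (intro mult_pos_pos) auto
    show "m\<^sup>2 = qfun R" unfolding m_def power_mult_distrib using lR by (simp add: qfun_def n_def)
  qed
  show ?thesis
  proof (cases "m\<^sup>2 + 4 * p\<^sup>2 \<le> (R * n R)\<^sup>2")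
    case True
    \<comment> \<open>For fixed r, Cauchy-Schwarz gives 2 m l + 4 \<kappa> p \<le> 2 r w, attained
      when (\<kappa>, l) is proportional to (2p, m).\<close>
    define w where "w = sqrt (m\<^sup>2 + 4 * p\<^sup>2)"
    have w: "0 < w" "w\<^sup>2 = m\<^sup>2 + 4 * p\<^sup>2" using m(1) by (auto simp: w_def add_pos_nonneg)
    have "w \<le> R * n R"
    proof (rule power2_le_imp_le)
      show "w\<^sup>2 \<le> (R * n R)\<^sup>2" unfolding w(2) by (rule True)
      show "0 \<le> R * n R" using R0(1) nR by simp
    qed
    also have "R * n R = ycot R / R" using R0(1) unfolding n_def by (simp add: power2_eq_square)
    finally have wR: "w \<le> ycot R / R" .
    \<comment> \<open>The equation y / r = w amounts to \<kappa> = 2 p / \<open>n r\<close>, at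
      which 4 \<kappa> p - 4 p^2 / \<open>n r\<close> is stationary in p. The quotient is at least w
      at R by the case assumption and vanishes at \<open>vartheta\<^sub>1\<close>.\<close>
    have "\<exists>r\<ge>R. r \<le> vartheta\<^sub>1 \<and> ycot r / r = w"
    proof (rule IVT2')
      show "continuous_on {R..vartheta\<^sub>1} (\<lambda>r. ycot r / r)"
        using R R0 by (intro continuous_intros continuous_on_ycot) auto
      show "w \<le> ycot R / R" by (rule wR)
      show "ycot vartheta\<^sub>1 / vartheta\<^sub>1 \<le> w" using w(1) by (simp add: ycot_vartheta1)
      show "R \<le> vartheta\<^sub>1" using R by simp
    qed
    then obtain r where r: "R \<le> r" "r \<le> vartheta\<^sub>1" "ycot r / r = w" by blast
    have "r \<noteq> vartheta\<^sub>1" using r(3) w(1) ycot_vartheta1 by auto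
    then have r1: "pi < r" "r < vartheta\<^sub>1" using R r by auto
    then have r0: "0 < r" "0 < ycot r" using ycot_pos pi_less_imp_pos by auto
    have y: "ycot r = r * w" using r(3) r0 by (simp add: field_simps)
    have nr: "n r = w / r" using r0 by (simp add: n_def y power2_eq_square)
    define l where "l = m * r / w"
    define k where "k = 2 * p * r / w"
    have "k\<^sup>2 + l\<^sup>2 = (m\<^sup>2 + 4 * p\<^sup>2) * r\<^sup>2 / w\<^sup>2"
      by (simp add: l_def k_def power2_eq_square field_simps add_divide_distrib)
    then have "k\<^sup>2 + l\<^sup>2 = r\<^sup>2" using w(1) by (simp flip: w(2))
    \<comment> \<open>With l = m r / w and w = r \<open>n r\<close> this reads w^2 \<le> m^2 (1 + 3
      \<open>n r\<close>). The geodesic covector of parameter r satisfies it with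
      \<open>qfun r\<close> in place of m^2, and \<open>qfun r\<close> \<le> \<open>qfun R\<close> =
      m^2.\<close>
    moreover have "r\<^sup>2 \<le> l\<^sup>2 * (1 + 3 * n r)"
    proof -
      have "(n r)\<^sup>2 * r\<^sup>2 \<le> (n r)\<^sup>2 * (lamsq r * (1 + 3 * n r))"
        using lamsq_facts(3)[OF r1] by (intro mult_left_mono) (auto simp: n_def)
      also have "\<dots> = qfun r * (1 + 3 * n r)" by (simp add: qfun_def n_def)
      also have "\<dots> \<le> m\<^sup>2 * (1 + 3 * n r)"
        using qfun_antimono[of R r] r r1 R m r0 by (intro mult_right_mono) (auto simp: n_def)
      finally have "w\<^sup>2 \<le> m\<^sup>2 * (1 + 3 * n r)" using r0 by (simp add: nr field_simps)
      then have "w\<^sup>2 * (r\<^sup>2 / w\<^sup>2) \<le> m\<^sup>2 * (1 + 3 * n r) * (r\<^sup>2 / w\<^sup>2)"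
        by (intro mult_right_mono) auto
      then show ?thesis using w(1) by (simp add: l_def power_divide power_mult_distrib mult_ac)
    qed
    moreover have "n R * (R\<^sup>2 + lamsq R) \<le> 2 * m * l + 4 * k * p - 4 * p\<^sup>2 / n r"
    proof -
      have "n R * (R\<^sup>2 + lamsq R) = ycot R + m\<^sup>2 * R\<^sup>2 / ycot R"
        unfolding m(2) qfun_def n_def using R0 by (simp add: field_simps power2_eq_square)
      also have "\<dots> \<le> ycot r + m\<^sup>2 * r\<^sup>2 / ycot r"
        using small_p_value_mono[of R r "m\<^sup>2"] R r r1 m by auto
      also have "\<dots> = r * w + m\<^sup>2 * r / w" using r0 by (simp add: y power2_eq_square)
      also have "\<dots> = 2 * m * l + 4 * k * p - 4 * p\<^sup>2 / n r"
      proof -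
        have "2 * m * l + 4 * k * p - 4 * p\<^sup>2 / n r = (2 * m\<^sup>2 + 4 * p\<^sup>2) * r / w"
          using w(1) r0(1) by (simp add: l_def k_def nr power2_eq_square field_simps)
        also have "2 * m\<^sup>2 + 4 * p\<^sup>2 = m\<^sup>2 + w\<^sup>2" using w by simp
        also have "(m\<^sup>2 + w\<^sup>2) * r / w = r * w + m\<^sup>2 * r / w"
          using w(1) by (simp add: field_simps power2_eq_square)
        finally show ?thesis by simp
      qed
      finally show ?thesis .
    qed
    ultimately show ?thesis using r1 unfolding m_def by blast
  next
    case False
    \<comment> \<open>With \<kappa> = 2 p / \<open>n r\<close> and l^2 = \<open>lamsq r\<close>, the
      constraint \<kappa>^2 + l^2 = r^2 becomes \<open>Pfun r * n r\<close> = 4 p^2. At R the left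
      side is too small, so r is sought between \<pi> and R.\<close>
    have Pn: "(n r)\<^sup>2 * (r\<^sup>2 - lamsq r) = Pfun r * n r" if "pi < r" "r < vartheta\<^sub>1" for r
    proof -
      have "r\<^sup>2 - lamsq r = Pfun r * r\<^sup>2 / ycot r" using Pfun_lamsq[OF that] by simp
      then show ?thesis
        using ycot_pos[OF that] pi_less_imp_pos[OF that(1)]
        by (simp only: n_def) (simp add: power2_eq_square)
    qed
    have "m\<^sup>2 = (n R)\<^sup>2 * lamsq R" unfolding m(2) by (simp add: qfun_def n_def)
    with False have "Pfun R * n R < 4 * p\<^sup>2" using Pn[OF R] by (simp add: algebra_simps power_mult_distrib)
    moreover have "Pfun r * n r = 2 * (ycot r) ^ 3 / (r\<^sup>2 * (r\<^sup>2 + 3 * ycot r + (ycot r)\<^sup>2))" for r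
      by (simp add: Pfun_def n_def power2_eq_square power3_eq_cube mult_ac)
    ultimately have "(ycot R) ^ 3 < 2 * p\<^sup>2 * (R\<^sup>2 * (R\<^sup>2 + 3 * ycot R + (ycot R)\<^sup>2))"
      using rational_facts(1)[OF R0] R0 by (simp add: divide_less_eq mult_ac)
    \<comment> \<open>The equation for r multiplied by powers of r and sin r: y has a pole at \<pi>,
      whereas F is continuous there with F(\<pi>) = \<pi>^3.\<close>
    define F where "F = (\<lambda>r::real. 2 * p\<^sup>2 * r\<^sup>2 * (r\<^sup>2 * (sin r) ^ 3 + 3 * (r * cos r - sin r) * (sin r)\<^sup>2
        + (r * cos r - sin r)\<^sup>2 * sin r) - (r * cos r - sin r) ^ 3)"
    have F: "F r = (sin r) ^ 3 * (2 * p\<^sup>2 * (r\<^sup>2 * (r\<^sup>2 + 3 * ycot r + (ycot r)\<^sup>2)) - (ycot r) ^ 3)"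
      if "pi < r" "r < vartheta\<^sub>1" for r
    proof -
      have e: "r * cos r - sin r = sin r * ycot r"
        using sin_neg_below_vartheta1[of r] that by (simp add: ycot_eq)
      show ?thesis
        unfolding F_def e by (simp add: algebra_simps power2_eq_square power3_eq_cube)
    qed
    have "F R \<le> 0"
      using \<open>(ycot R) ^ 3 < _\<close> sin_neg_below_vartheta1[of R] R
      by (simp add: F mult_nonpos_nonneg)
    moreover have "0 < F pi" by (simp add: F_def)
    ultimately have "\<exists>r\<ge>pi. r \<le> R \<and> F r = 0"
      using R by (intro IVT2') (auto simp: F_def intro!: continuous_intros)
    then obtain r where r: "pi \<le> r" "r \<le> R" "F r = 0" by blast
    have r1: "pi < r" "r < vartheta\<^sub>1" using r R \<open>0 < F pi\<close> by (auto simp: less_le)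
    have r0: "0 < r" "0 < ycot r" using r1 ycot_pos pi_less_imp_pos by auto
    have nr: "0 < n r" using r0 by (simp add: n_def)
    have "(ycot r) ^ 3 = 2 * p\<^sup>2 * (r\<^sup>2 * (r\<^sup>2 + 3 * ycot r + (ycot r)\<^sup>2))"
      using r(3) F[OF r1] sin_neg_below_vartheta1[of r] r1 by simp
    with \<open>\<And>r. Pfun r * n r = _\<close> have p2: "Pfun r * n r = 4 * p\<^sup>2"
      using rational_facts(1)[OF r0] r0 by simp
    define l where "l = sqrt (lamsq r)"
    define k where "k = 2 * p / n r"
    have l: "l\<^sup>2 = lamsq r" using lamsq_facts[OF r1] by (simp add: l_def)
    have "k\<^sup>2 = 4 * p\<^sup>2 / (n r)\<^sup>2" by (simp add: k_def power2_eq_square)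
    also have "\<dots> = r\<^sup>2 - lamsq r" using Pn[OF r1] p2 nr by (simp add: field_simps)
    finally have "k\<^sup>2 + l\<^sup>2 = r\<^sup>2" using l by simp
    moreover have "r\<^sup>2 \<le> l\<^sup>2 * (1 + 3 * n r)"
      using lamsq_facts(3)[OF r1] by (simp add: l n_def)
    moreover have "n R * (R\<^sup>2 + lamsq R) \<le> 2 * m * l + 4 * k * p - 4 * p\<^sup>2 / n r"
    proof -
      have "Pfun R = n R * (R\<^sup>2 - lamsq R)" using Pn[OF R] nR by (simp add: power2_eq_square)
      then have "n R * (R\<^sup>2 + lamsq R) = Pfun R + 2 * m * sqrt (lamsq R)"
        using real_sqrt_mult_self[of "lamsq R"] lR(1)
        by (simp add: m_def right_diff_distrib distrib_left mult.assoc)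
      also have "\<dots> \<le> Pfun r + 2 * m * sqrt (lamsq r)"
        using large_p_value_mono[of r R m] r r1 R m by auto
      also have "\<dots> = 2 * m * l + 4 * k * p - 4 * p\<^sup>2 / n r"
        using p2 nr by (simp add: l_def k_def field_simps power2_eq_square)
      finally show ?thesis .
    qed
    ultimately show ?thesis using r1 unfolding m_def by blast
  qed
qed

section \<open>Value functions of the folded problem\<close>

text \<open>Competitors will be piecewise smooth, so functions evaluated along them are continuous
  but differentiable only off the finitely many break points.\<close>

lemma mono_finite_exceptions:
  fixes f :: "real \<Rightarrow> real"
  assumes "a \<le> b" "finite S" "continuous_on {a..b} f"
    and d: "\<And>x. x \<in> {a<..<b} - S \<Longrightarrow> \<exists>d\<ge>0. (f has_real_derivative d) (at x)"
  shows "f a \<le> f b"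
proof -
  obtain f' where f': "\<And>x. x \<in> {a<..<b} - S \<Longrightarrow> 0 \<le> f' x \<and> (f has_real_derivative f' x) (at x)"
    using d by metis
  define h where "h x = (if x \<in> {a<..<b} - S then f' x else 0)" for x
  have "(h has_integral (f b - f a)) {a..b}"
  proof (rule fundamental_theorem_of_calculus_interior_strong[OF assms(2,1)])
    show "(f has_vector_derivative h x) (at x)" if "x \<in> {a<..<b} - S" for x
      using f'[OF that] that by (simp add: h_def has_real_derivative_iff_has_vector_derivative)
  qed (rule assms)
  then have "0 \<le> f b - f a"
    by (rule has_integral_nonneg) (use f' in \<open>auto simp: h_def\<close>)
  then show ?thesis by simp
qed

lemma increment_bound_finite_exceptions:
  fixes f h :: "real \<Rightarrow> real"
  assumes "a \<le> b" "finite S" "continuous_on {a..b} f" "continuous_on {a..b} h"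
    and d: "\<And>x. x \<in> {a<..<b} - S \<Longrightarrow>
      \<exists>d e. (f has_real_derivative d) (at x) \<and> (h has_real_derivative e) (at x) \<and> \<bar>d\<bar> \<le> e"
  shows "\<bar>f b - f a\<bar> \<le> h b - h a"
proof -
  have "h a - f a \<le> h b - f b"
  proof (rule mono_finite_exceptions[OF assms(1,2)])
    fix x assume "x \<in> {a<..<b} - S"
    from d[OF this] obtain d e where "(f has_real_derivative d) (at x)" "(h has_real_derivative e) (at x)" "\<bar>d\<bar> \<le> e"
      by blast
    then show "\<exists>d\<ge>0. ((\<lambda>x. h x - f x) has_real_derivative d) (at x)"
      by (intro exI[of _ "e - d"]) (auto intro!: derivative_intros)
  qed (intro continuous_intros assms)
  moreover have "h a + f a \<le> h b + f b"
  proof (rule mono_finite_exceptions[OF assms(1,2)])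
    fix x assume "x \<in> {a<..<b} - S"
    from d[OF this] obtain d e where "(f has_real_derivative d) (at x)" "(h has_real_derivative e) (at x)" "\<bar>d\<bar> \<le> e"
      by blast
    then show "\<exists>d\<ge>0. ((\<lambda>x. h x + f x) has_real_derivative d) (at x)"
      by (intro exI[of _ "e + d"]) (auto intro!: derivative_intros)
  qed (intro continuous_intros assms)
  ultimately show ?thesis by simp
qed

section \<open>The two value functions and their Riccati identities\<close>

definition D\<^sub>1 :: "real \<Rightarrow> real" where "D\<^sub>1 T = T * cos T - sin T"

text \<open>Determinant of the system that fits \<alpha> sin T + \<beta> T to a given end value and
  a given integral of T g.\<close>

definition D\<^sub>2 :: "real \<Rightarrow> real" where "D\<^sub>2 T = T ^ 3 * sin T / 3 - T * sin T + T\<^sup>2 * cos T"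

text \<open>Minimal value of \<open>\<integral>\<^sub>0\<^sup>T (g'\<^sup>2 - g\<^sup>2)\<close> for given \<open>g T\<close> and \<open>G = \<integral>\<^sub>0\<^sup>T g\<close>; an extremal is
  \<open>\<alpha> cos T + \<beta>\<close>, and \<open>D\<^sub>1\<close> is the determinant of the linear system for \<open>\<alpha>, \<beta>\<close>.\<close>

definition S\<^sub>1 :: "real \<Rightarrow> real \<Rightarrow> real \<Rightarrow> real" where
  "S\<^sub>1 T g G = (- T * sin T * g\<^sup>2 + 2 * sin T * g * G - cos T * G\<^sup>2) / D\<^sub>1 T"

text \<open>The same for \<open>g 0 = 0\<close> and given \<open>M = \<integral>\<^sub>0\<^sup>T \<tau> g(\<tau>) d\<tau>\<close>, with extremals \<open>\<alpha> sin T + \<beta> T\<close>.\<close>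

definition S\<^sub>2 :: "real \<Rightarrow> real \<Rightarrow> real \<Rightarrow> real" where
  "S\<^sub>2 T g M = ((cos T * T ^ 3 / 3 + D\<^sub>1 T) * g\<^sup>2 - 2 * D\<^sub>1 T * g * M - sin T * M\<^sup>2) / D\<^sub>2 T"

text \<open>The common shape of both verifications: a is the Lagrangian, x the actual slope, w / d
  the optimal slope in feedback form.\<close>

lemma quotient_minus_square:
  fixes a d :: real
  assumes "d \<noteq> 0" "n = a * d\<^sup>2 - (x * d - w)\<^sup>2"
  shows "n / (d * d) = a - (x - w / d)\<^sup>2"
proof -
  have "x - w / d = (x * d - w) / d" using assms(1) by (simp add: field_simps)
  then have "(x - w / d)\<^sup>2 = (x * d - w)\<^sup>2 / (d * d)" by (simp add: power_divide power2_eq_square)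
  then show ?thesis using assms by (simp add: diff_divide_distrib power2_eq_square)
qed

text \<open>The Hamilton-Jacobi identity with states g and G: along any curve the value function
  grows by the Lagrangian minus the squared deviation from the optimal slope. Hence it never grows
  faster than the functional itself.\<close>

lemma DERIV_S1:
  assumes g: "(g has_real_derivative g') (at T)" and G: "(G has_real_derivative g T) (at T)" and D: "D\<^sub>1 T \<noteq> 0"
  shows "((\<lambda>T. S\<^sub>1 T (g T) (G T)) has_real_derivative
    g'\<^sup>2 - (g T)\<^sup>2 - (g' + sin T * (g T * T - G T) / D\<^sub>1 T)\<^sup>2) (at T)"
proof -
  define N where "N = - T * sin T * (g T)\<^sup>2 + 2 * sin T * g T * G T - cos T * (G T)\<^sup>2"
  define N' where "N' = (sin T - T * cos T) * (g T)\<^sup>2 - 2 * T * sin T * g T * g' + 2 * sin T * g' * G T + sin T * (G T)\<^sup>2"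
  have "((\<lambda>T. D\<^sub>1 T) has_real_derivative - T * sin T) (at T)"
    unfolding D\<^sub>1_def by (auto intro!: derivative_eq_intros)
  moreover have "((\<lambda>T. - T * sin T * (g T)\<^sup>2 + 2 * sin T * g T * G T - cos T * (G T)\<^sup>2) has_real_derivative N') (at T)"
    using g G unfolding N'_def
    by (auto intro!: derivative_eq_intros simp: algebra_simps power2_eq_square)
  ultimately have "((\<lambda>T. S\<^sub>1 T (g T) (G T)) has_real_derivative
      (N' * D\<^sub>1 T - N * (- T * sin T)) / (D\<^sub>1 T * D\<^sub>1 T)) (at T)"
    unfolding S\<^sub>1_def N_def using D by (intro DERIV_divide)
  moreover have e: "N' * D\<^sub>1 T - N * (- T * sin T)
        = (g'\<^sup>2 - (g T)\<^sup>2) * (D\<^sub>1 T)\<^sup>2 - (g' * D\<^sub>1 T - (- (sin T * (g T * T - G T))))\<^sup>2"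
    unfolding N_def N'_def D\<^sub>1_def by (simp add: algebra_simps power2_eq_square)
  ultimately show ?thesis unfolding quotient_minus_square[OF D e] by simp
qed

lemma DERIV_S2:
  assumes g: "(g has_real_derivative g') (at T)" and M: "(M has_real_derivative T * g T) (at T)" and D: "D\<^sub>2 T \<noteq> 0"
  shows "((\<lambda>T. S\<^sub>2 T (g T) (M T)) has_real_derivative
    g'\<^sup>2 - (g T)\<^sup>2 - (g' - ((cos T * T ^ 3 / 3 + D\<^sub>1 T) * g T - D\<^sub>1 T * M T) / D\<^sub>2 T)\<^sup>2) (at T)"
proof -
  define N where "N = (cos T * T ^ 3 / 3 + D\<^sub>1 T) * (g T)\<^sup>2 - 2 * D\<^sub>1 T * g T * M T - sin T * (M T)\<^sup>2"
  define e where "e = cos T * T ^ 3 / 3 + D\<^sub>1 T"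
  define w where "w = e * g T - D\<^sub>1 T * M T"
  define N' where "N' = - D\<^sub>2 T * (g T)\<^sup>2 + 2 * g' * w - cos T * (M T)\<^sup>2"
  have d1: "(D\<^sub>1 has_real_derivative - T * sin T) (at T)"
    unfolding D\<^sub>1_def[abs_def] by (auto intro!: derivative_eq_intros)
  have de: "((\<lambda>T. cos T * T ^ 3 / 3 + D\<^sub>1 T) has_real_derivative 2 * T * D\<^sub>1 T - D\<^sub>2 T) (at T)"
    using d1 by (auto intro!: derivative_eq_intros
      simp: D\<^sub>1_def D\<^sub>2_def field_simps power2_eq_square power3_eq_cube)
  have d2: "(D\<^sub>2 has_real_derivative e) (at T)"
    unfolding D\<^sub>2_def[abs_def] e_def
    by (auto intro!: derivative_eq_intros simp: D\<^sub>1_def field_simps power2_eq_square power3_eq_cube)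
  have "((\<lambda>T. (cos T * T ^ 3 / 3 + D\<^sub>1 T) * (g T)\<^sup>2 - 2 * D\<^sub>1 T * g T * M T - sin T * (M T)\<^sup>2) has_real_derivative N') (at T)"
    by (rule derivative_eq_intros g M d1 de refl)+
      (simp add: N'_def w_def e_def algebra_simps power2_eq_square)
  with d2 have "((\<lambda>T. S\<^sub>2 T (g T) (M T)) has_real_derivative
      (N' * D\<^sub>2 T - N * e) / (D\<^sub>2 T * D\<^sub>2 T)) (at T)"
    unfolding S\<^sub>2_def N_def using D by (intro DERIV_divide)
  moreover have e: "N' * D\<^sub>2 T - N * e = (g'\<^sup>2 - (g T)\<^sup>2) * (D\<^sub>2 T)\<^sup>2 - (g' * D\<^sub>2 T - w)\<^sup>2"
  proof -
    \<comment> \<open>This determinant identity makes the coefficient of (M T)^2 a perfect square;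
      the remaining coefficients agree identically.\<close>
    have "cos T * D\<^sub>2 T - sin T * e = (D\<^sub>1 T)\<^sup>2"
      by (simp add: e_def D\<^sub>1_def D\<^sub>2_def algebra_simps power2_eq_square)
    then have "(M T)\<^sup>2 * (cos T * D\<^sub>2 T - sin T * e) = (M T)\<^sup>2 * (D\<^sub>1 T)\<^sup>2" by simp
    then show ?thesis
      unfolding N_def N'_def e_def[symmetric] w_def by (simp add: algebra_simps power2_eq_square)
  qed
  ultimately show ?thesis unfolding quotient_minus_square[OF D e] by (simp add: w_def e_def)
qed

text \<open>\<open>D\<^sub>1\<close> and \<open>D\<^sub>2\<close> vanish at 0 to orders 3 and 6, so
  the value functions are singular there. The extra powers of T come from the rates T g - G = O(T^2)
  for even g, and g = O(T), M = O(T^3) for odd g.\<close>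

lemma folded_limits:
  "((\<lambda>T::real. T ^ 3 * sin T / D\<^sub>1 T) \<longlongrightarrow> 0) (at_right 0)"
  "((\<lambda>T::real. T\<^sup>2 * (cos T * T ^ 3 / 3 + D\<^sub>1 T) / D\<^sub>2 T) \<longlongrightarrow> 0) (at_right 0)"
  "((\<lambda>T::real. T ^ 4 * D\<^sub>1 T / D\<^sub>2 T) \<longlongrightarrow> 0) (at_right 0)"
  "((\<lambda>T::real. T ^ 6 * sin T / D\<^sub>2 T) \<longlongrightarrow> 0) (at_right 0)"
proof -
  have 1: "((\<lambda>T::real. T ^ 3 * sin T / (T * cos T - sin T)) \<longlongrightarrow> 0) (at_right 0)" by real_asymp
  have 2: "((\<lambda>T::real. T\<^sup>2 * (cos T * T ^ 3 / 3 + (T * cos T - sin T)) / (T ^ 3 * sin T / 3 - T * sin T + T\<^sup>2 * cos T)) \<longlongrightarrow> 0) (at_right 0)" by real_asymp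
  have 3: "((\<lambda>T::real. T ^ 4 * (T * cos T - sin T) / (T ^ 3 * sin T / 3 - T * sin T + T\<^sup>2 * cos T)) \<longlongrightarrow> 0) (at_right 0)" by real_asymp
  have 4: "((\<lambda>T::real. T ^ 6 * sin T / (T ^ 3 * sin T / 3 - T * sin T + T\<^sup>2 * cos T)) \<longlongrightarrow> 0) (at_right 0)" by real_asymp
  show "((\<lambda>T::real. T ^ 3 * sin T / D\<^sub>1 T) \<longlongrightarrow> 0) (at_right 0)"
  "((\<lambda>T::real. T\<^sup>2 * (cos T * T ^ 3 / 3 + D\<^sub>1 T) / D\<^sub>2 T) \<longlongrightarrow> 0) (at_right 0)"
  "((\<lambda>T::real. T ^ 4 * D\<^sub>1 T / D\<^sub>2 T) \<longlongrightarrow> 0) (at_right 0)"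
  "((\<lambda>T::real. T ^ 6 * sin T / D\<^sub>2 T) \<longlongrightarrow> 0) (at_right 0)"
    unfolding D\<^sub>1_def D\<^sub>2_def by (fact 1 2 3 4)+
qed

text \<open>\<open>D\<^sub>2 T / T\<close> tends to 0 at 0 and has derivative
  \<open>T * D\<^sub>1 T / 3\<close>, so it inherits the sign of \<open>D\<^sub>1\<close>.\<close>

lemma D2_neg:
  assumes "0 < T" "T < vartheta\<^sub>1"
  shows "D\<^sub>2 T < 0"
proof -
  have "T\<^sup>2 * sin T / 3 + (T * cos T - sin T) < 0\<^sup>2 * sin 0 / 3 + (0 * cos 0 - sin 0)"
  proof (rule DERIV_neg_imp_decreasing_open[OF assms(1)])
    fix x assume x: "0 < x" "x < T"
    have "((\<lambda>T. T\<^sup>2 * sin T / 3 + (T * cos T - sin T)) has_real_derivative x * (x * cos x - sin x) / 3) (at x)"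
      by (auto intro!: derivative_eq_intros simp: field_simps power2_eq_square)
    moreover have "x * (x * cos x - sin x) / 3 < 0"
      using xcos_less_sin[of x] x assms by (simp add: mult_pos_neg)
    ultimately show "\<exists>d. ((\<lambda>T. T\<^sup>2 * sin T / 3 + (T * cos T - sin T)) has_real_derivative d) (at x) \<and> d < 0"
      by blast
  qed (auto intro!: continuous_intros)
  then have "T * (T\<^sup>2 * sin T / 3 + (T * cos T - sin T)) < 0"
    using assms by (simp add: mult_pos_neg)
  also have "T * (T\<^sup>2 * sin T / 3 + (T * cos T - sin T)) = D\<^sub>2 T"
    by (simp add: D\<^sub>2_def field_simps power2_eq_square power3_eq_cube)
  finally show ?thesis .
qed

lemma D1_neg: "0 < T \<Longrightarrow> T < vartheta\<^sub>1 \<Longrightarrow> D\<^sub>1 T < 0"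
  using xcos_less_sin by (simp add: D\<^sub>1_def)

text \<open>If g does not vanish at 0, the three terms of \<open>S\<^sub>1\<close> each blow up like
  1/T. Separating the deviation T g - G from the mean exhibits their cancellation.\<close>

lemma S1_decomposition:
  assumes "T \<noteq> 0" "D\<^sub>1 T \<noteq> 0"
  shows "S\<^sub>1 T g G = - (sin T / T) * (T * g - G)\<^sup>2 / D\<^sub>1 T - G\<^sup>2 / T"
proof -
  have "T * (- T * sin T * g\<^sup>2 + 2 * sin T * g * G - cos T * G\<^sup>2) = - sin T * (T * g - G)\<^sup>2 - G\<^sup>2 * D\<^sub>1 T"
    by (simp add: D\<^sub>1_def algebra_simps power2_eq_square)
  then have "T * D\<^sub>1 T * S\<^sub>1 T g G = - sin T * (T * g - G)\<^sup>2 - G\<^sup>2 * D\<^sub>1 T"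
    using assms by (simp add: S\<^sub>1_def)
  then show ?thesis using assms by (simp add: field_simps)
qed

lemma tendsto_S1:
  assumes "\<And>T. 0 < T \<Longrightarrow> T < r \<Longrightarrow> \<bar>T * g T - G T\<bar> \<le> C * T\<^sup>2"
    and "\<And>T. 0 < T \<Longrightarrow> T < r \<Longrightarrow> \<bar>G T\<bar> \<le> C * T" and r: "0 < r" "r < vartheta\<^sub>1"
  shows "((\<lambda>T. S\<^sub>1 T (g T) (G T)) \<longlongrightarrow> 0) (at_right 0)"
proof -
  note l = folded_limits(1)
  have "((\<lambda>T. C\<^sup>2 * \<bar>T ^ 3 * sin T / D\<^sub>1 T\<bar> + C\<^sup>2 * T) \<longlongrightarrow> C\<^sup>2 * \<bar>0\<bar> + C\<^sup>2 * 0) (at_right 0)"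
    by (intro tendsto_intros l)
  then have lim: "((\<lambda>T. C\<^sup>2 * \<bar>T ^ 3 * sin T / D\<^sub>1 T\<bar> + C\<^sup>2 * T) \<longlongrightarrow> 0) (at_right 0)" by simp
  have "\<forall>\<^sub>F T in at_right 0. norm (S\<^sub>1 T (g T) (G T)) \<le> C\<^sup>2 * \<bar>T ^ 3 * sin T / D\<^sub>1 T\<bar> + C\<^sup>2 * T"
    using eventually_at_right_less[of 0] eventually_at_right_real[OF r(1)]
  proof eventually_elim
    case (elim T)
    then have T: "0 < T" "T < r" by auto
    then have D: "D\<^sub>1 T < 0" using D1_neg r by auto
    have "(T * g T - G T)\<^sup>2 \<le> (C * T\<^sup>2)\<^sup>2" "(G T)\<^sup>2 \<le> (C * T)\<^sup>2"
      using assms(1,2)[OF T] by (metis abs_ge_zero order_trans power2_abs power_mono)+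
    have "\<bar>S\<^sub>1 T (g T) (G T)\<bar> \<le> \<bar>(sin T / T / D\<^sub>1 T) * (T * g T - G T)\<^sup>2\<bar> + \<bar>(G T)\<^sup>2 / T\<bar>"
    proof -
      have "S\<^sub>1 T (g T) (G T) = - ((sin T / T / D\<^sub>1 T) * (T * g T - G T)\<^sup>2) - (G T)\<^sup>2 / T"
        using T D by (subst S1_decomposition) auto
      then show ?thesis by linarith
    qed
    also have "\<bar>(sin T / T / D\<^sub>1 T) * (T * g T - G T)\<^sup>2\<bar> \<le> \<bar>sin T / T / D\<^sub>1 T\<bar> * (C * T\<^sup>2)\<^sup>2"
      unfolding abs_mult using \<open>(T * g T - G T)\<^sup>2 \<le> _\<close> by (intro mult_left_mono) auto
    also have "\<dots> = \<bar>sin T / T / D\<^sub>1 T * (C * T\<^sup>2)\<^sup>2\<bar>" by (simp add: abs_mult)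
    also have "sin T / T / D\<^sub>1 T * (C * T\<^sup>2)\<^sup>2 = C\<^sup>2 * (T ^ 3 * sin T / D\<^sub>1 T)"
      using T D by (simp add: field_simps power2_eq_square power3_eq_cube)
    also have "\<bar>(G T)\<^sup>2 / T\<bar> \<le> C\<^sup>2 * T"
      using \<open>(G T)\<^sup>2 \<le> _\<close> T by (simp add: divide_le_eq power_mult_distrib power2_eq_square mult_ac)
    finally show ?case by (simp add: abs_mult)
  qed
  then show ?thesis by (rule Lim_null_comparison[OF _ lim])
qed

lemma tendsto_S2:
  assumes "\<And>T. 0 < T \<Longrightarrow> T < r \<Longrightarrow> \<bar>g T\<bar> \<le> C * T"
    and "\<And>T. 0 < T \<Longrightarrow> T < r \<Longrightarrow> \<bar>M T\<bar> \<le> C * T ^ 3" and r: "0 < r"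
  shows "((\<lambda>T. S\<^sub>2 T (g T) (M T)) \<longlongrightarrow> 0) (at_right 0)"
proof -
  note l1 = folded_limits(2) and l2 = folded_limits(3) and l3 = folded_limits(4)
  let ?f = "\<lambda>T. C\<^sup>2 * (\<bar>T\<^sup>2 * (cos T * T ^ 3 / 3 + D\<^sub>1 T) / D\<^sub>2 T\<bar> + 2 * \<bar>T ^ 4 * D\<^sub>1 T / D\<^sub>2 T\<bar> + \<bar>T ^ 6 * sin T / D\<^sub>2 T\<bar>)"
  have "(?f \<longlongrightarrow> C\<^sup>2 * (\<bar>0\<bar> + 2 * \<bar>0\<bar> + \<bar>0\<bar>)) (at_right 0)"
    by (intro tendsto_intros l1 l2 l3)
  then have lim: "(?f \<longlongrightarrow> 0) (at_right 0)" by simp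
  have "\<forall>\<^sub>F T in at_right 0. norm (S\<^sub>2 T (g T) (M T)) \<le> ?f T"
    using eventually_at_right_less[of 0] eventually_at_right_real[OF r(1)]
  proof eventually_elim
    case (elim T)
    then have T: "0 < T" "T < r" by auto
    note b = assms(1,2)[OF T]
    have g2: "(g T)\<^sup>2 \<le> C\<^sup>2 * T\<^sup>2" and M2: "(M T)\<^sup>2 \<le> C\<^sup>2 * T ^ 6"
      using power_mono[OF b(1), of 2] power_mono[OF b(2), of 2]
      by (simp_all add: power_mult_distrib flip: power_mult)
    have gM: "\<bar>g T * M T\<bar> \<le> C\<^sup>2 * T ^ 4"
      using mult_mono[OF b] b by (simp add: abs_mult power2_eq_square power4_eq_xxxx power3_eq_cube mult_ac)
    let ?a = "(cos T * T ^ 3 / 3 + D\<^sub>1 T) / D\<^sub>2 T" and ?b = "D\<^sub>1 T / D\<^sub>2 T" and ?c = "sin T / D\<^sub>2 T"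
    have "S\<^sub>2 T (g T) (M T) = ?a * (g T)\<^sup>2 - 2 * (?b * (g T * M T)) - ?c * (M T)\<^sup>2"
      by (simp add: S\<^sub>2_def diff_divide_distrib add_divide_distrib algebra_simps)
    then have "\<bar>S\<^sub>2 T (g T) (M T)\<bar> \<le> \<bar>?a * (g T)\<^sup>2\<bar> + 2 * \<bar>?b * (g T * M T)\<bar> + \<bar>?c * (M T)\<^sup>2\<bar>"
      by linarith
    also have "\<dots> \<le> \<bar>?a\<bar> * (C\<^sup>2 * T\<^sup>2) + 2 * (\<bar>?b\<bar> * (C\<^sup>2 * T ^ 4)) + \<bar>?c\<bar> * (C\<^sup>2 * T ^ 6)"
      unfolding abs_mult[of ?a] abs_mult[of ?b] abs_mult[of ?c] using g2 gM M2
      by (intro add_mono mult_left_mono) auto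
    also have "\<dots> = C\<^sup>2 * (\<bar>?a\<bar> * T\<^sup>2 + 2 * (\<bar>?b\<bar> * T ^ 4) + \<bar>?c\<bar> * T ^ 6)"
      by (simp only: distrib_left mult_ac)
    also have "\<dots> = ?f T" using T by (simp add: abs_mult mult_ac)
    finally show ?case by simp
  qed
  then show ?thesis by (rule Lim_null_comparison[OF _ lim])
qed

text \<open>Here \<open>xe, xo, ye, uo\<close> are even and odd parts, about the midpoint, of the coordinates \<open>x, y\<close>
  transversal and \<open>u\<close> parallel to the endpoint.  The derivative of the difference of both sides is a sum of
  squares: \<open>S\<^sub>1\<close> and \<open>S\<^sub>2\<close> absorb \<open>xe\<close> and \<open>xo\<close>, the constants \<open>k, l, c\<close> are Lagrange multipliers for the
  moments \<open>W, A\<close> and for \<open>uo\<close>, and \<open>b\<close> is the multiplier for \<open>H r = 0\<close>.\<close>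

lemma folded_energy_bound:
  fixes xe xo ye uo W A G M H :: "real \<Rightarrow> real"
  assumes r: "0 < r" "r < vartheta\<^sub>1" "sin r \<noteq> 0" and S: "finite S"
    and cont: "continuous_on {0..r} xe" "continuous_on {0..r} xo" "continuous_on {0..r} ye"
      "continuous_on {0..r} uo" "continuous_on {0..r} W" "continuous_on {0..r} A"
      "continuous_on {0..r} G" "continuous_on {0..r} M" "continuous_on {0..r} H"
    and deriv: "\<And>T. T \<in> {0<..<r} - S \<Longrightarrow> \<exists>xe' xo' ye' yo' ue' uo'.
      (xe has_real_derivative xe') (at T) \<and> (xo has_real_derivative xo') (at T) \<and>
      (ye has_real_derivative ye') (at T) \<and> (uo has_real_derivative uo') (at T) \<and>
      (W has_real_derivative 2 * (xe T * uo' + xo T * ue')) (at T) \<and>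
      (A has_real_derivative 2 * (xe T * yo' + xo T * ye')) (at T) \<and>
      xe'\<^sup>2 + xo'\<^sup>2 + ye'\<^sup>2 + yo'\<^sup>2 + ue'\<^sup>2 + uo'\<^sup>2 \<le> K"
    and int: "\<And>T. T \<in> {0<..<r} - S \<Longrightarrow> (G has_real_derivative xe T) (at T)"
      "\<And>T. T \<in> {0<..<r} - S \<Longrightarrow> (M has_real_derivative T * xo T) (at T)"
      "\<And>T. T \<in> {0<..<r} - S \<Longrightarrow> (H has_real_derivative ye T) (at T)"
    and init: "xo 0 = 0" "uo 0 = 0" "W 0 = 0" "A 0 = 0" "G 0 = 0" "M 0 = 0" "H 0 = 0"
    and fin: "xe r = p" "xo r = 0" "ye r = 0" "G r = 0" "H r = 0"
    and kl: "k\<^sup>2 + l\<^sup>2 = 1"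
  shows "2 * c * uo r - c\<^sup>2 * r + k * W r + l * A r + 3 / r ^ 3 * (l\<^sup>2 - 1 / (1 + 3 * (ycot r / r\<^sup>2))) * (M r)\<^sup>2
    - p\<^sup>2 * r / ycot r \<le> K * r"
proof -
  have K0: "0 \<le> K"
  proof -
    have "infinite ({0<..<r} - S)" using r S by (simp add: infinite_Ioo)
    then obtain T where "T \<in> {0<..<r} - S" by (metis ex_in_conv finite.emptyI)
    from deriv[OF this] obtain a b c d e f :: real where "a\<^sup>2 + b\<^sup>2 + c\<^sup>2 + d\<^sup>2 + e\<^sup>2 + f\<^sup>2 \<le> K" by blast
    moreover have "0 \<le> a\<^sup>2 + b\<^sup>2 + c\<^sup>2 + d\<^sup>2 + e\<^sup>2 + f\<^sup>2" by (intro add_nonneg_nonneg) auto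
    ultimately show ?thesis by linarith
  qed
  define q where "q = sqrt K"
  have q: "0 \<le> q" "q\<^sup>2 = K" using K0 by (auto simp: q_def)
  have slope: "\<exists>xe' xo'. (xe has_real_derivative xe') (at T) \<and> (xo has_real_derivative xo') (at T) \<and> \<bar>xe'\<bar> \<le> q \<and> \<bar>xo'\<bar> \<le> q"
    if "T \<in> {0<..<r} - S" for T
  proof -
    from deriv[OF that] obtain a b c d e f :: real where
      d: "(xe has_real_derivative a) (at T)" "(xo has_real_derivative b) (at T)"
      and s: "a\<^sup>2 + b\<^sup>2 + c\<^sup>2 + d\<^sup>2 + e\<^sup>2 + f\<^sup>2 \<le> K" by blast
    have "a\<^sup>2 \<le> q\<^sup>2" "b\<^sup>2 \<le> q\<^sup>2"
      using s q(2) by (smt (verit) zero_le_power2)+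
    then have "\<bar>a\<bar> \<le> q" "\<bar>b\<bar> \<le> q" using q(1) by (auto simp: abs_le_square_iff[symmetric])
    with d show ?thesis by blast
  qed
  have sub: "continuous_on {0..T} f" if "continuous_on {0..r} f" "T < r" for f :: "real \<Rightarrow> real" and T
    using that by (meson atLeastatMost_subset_iff continuous_on_subset less_imp_le order_refl)
  have xo_bd: "\<bar>xo T\<bar> \<le> q * T" if "0 < T" "T < r" for T
  proof -
    have "\<bar>xo T - xo 0\<bar> \<le> q * T - q * 0"
    proof (rule increment_bound_finite_exceptions[OF _ S sub[OF cont(2) that(2)]])
      fix x assume "x \<in> {0<..<T} - S"
      then have "x \<in> {0<..<r} - S" using that by auto
      from slope[OF this] obtain b where "(xo has_real_derivative b) (at x)" "\<bar>b\<bar> \<le> q" by blast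
      then show "\<exists>d e. (xo has_real_derivative d) (at x) \<and> ((*) q has_real_derivative e) (at x) \<and> \<bar>d\<bar> \<le> e"
        by (intro exI[of _ b] exI[of _ q]) (auto intro!: derivative_eq_intros)
    qed (use that in \<open>auto intro!: continuous_intros\<close>)
    then show ?thesis by (simp add: init)
  qed
  have xe_bd: "\<bar>xe T\<bar> \<le> \<bar>xe 0\<bar> + q * T" if "0 < T" "T < r" for T
  proof -
    have "\<bar>xe T - xe 0\<bar> \<le> q * T - q * 0"
    proof (rule increment_bound_finite_exceptions[OF _ S sub[OF cont(1) that(2)]])
      fix x assume "x \<in> {0<..<T} - S"
      then have "x \<in> {0<..<r} - S" using that by auto
      from slope[OF this] obtain b where "(xe has_real_derivative b) (at x)" "\<bar>b\<bar> \<le> q" by blast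
      then show "\<exists>d e. (xe has_real_derivative d) (at x) \<and> ((*) q has_real_derivative e) (at x) \<and> \<bar>d\<bar> \<le> e"
        by (intro exI[of _ b] exI[of _ q]) (auto intro!: derivative_eq_intros)
    qed (use that in \<open>auto intro!: continuous_intros\<close>)
    then show ?thesis by linarith
  qed
  define C where "C = \<bar>xe 0\<bar> + q * r + q"
  have C: "q \<le> C" "\<bar>xe 0\<bar> + q * r \<le> C" using q r by (auto simp: C_def)
  have M_bd: "\<bar>M T\<bar> \<le> C * T ^ 3" if "0 < T" "T < r" for T
  proof -
    have "\<bar>M T - M 0\<bar> \<le> q * T ^ 3 - q * 0 ^ 3"
    proof (rule increment_bound_finite_exceptions[OF _ S sub[OF cont(8) that(2)]])
      fix x assume x: "x \<in> {0<..<T} - S"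
      then have "\<bar>x * xo x\<bar> \<le> x * (q * x)" using xo_bd[of x] that by (simp add: abs_mult)
      also have "\<dots> \<le> q * (3 * x\<^sup>2)" using q by (simp add: power2_eq_square mult_left_mono)
      finally show "\<exists>d e. (M has_real_derivative d) (at x) \<and> ((\<lambda>T. q * T ^ 3) has_real_derivative e) (at x) \<and> \<bar>d\<bar> \<le> e"
        using int(2)[of x] x that
        by (intro exI[of _ "x * xo x"] exI[of _ "q * (3 * x\<^sup>2)"]) (auto intro!: derivative_eq_intros)
    qed (use that in \<open>auto intro!: continuous_intros\<close>)
    also have "\<dots> \<le> C * T ^ 3" using C(1) that by (simp add: mult_right_mono)
    finally show ?thesis by (simp add: init)
  qed
  have G_bd: "\<bar>G T\<bar> \<le> C * T" if "0 < T" "T < r" for T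
  proof -
    have "\<bar>G T - G 0\<bar> \<le> C * T - C * 0"
    proof (rule increment_bound_finite_exceptions[OF _ S sub[OF cont(7) that(2)]])
      fix x assume x: "x \<in> {0<..<T} - S"
      then have "\<bar>xe x\<bar> \<le> \<bar>xe 0\<bar> + q * x" using xe_bd[of x] that by simp
      also have "q * x \<le> q * r" using x that q by (intro mult_left_mono) auto
      finally have "\<bar>xe x\<bar> \<le> C" using C(2) by simp
      then show "\<exists>d e. (G has_real_derivative d) (at x) \<and> ((*) C has_real_derivative e) (at x) \<and> \<bar>d\<bar> \<le> e"
        using int(1)[of x] x that
        by (intro exI[of _ "xe x"] exI[of _ C]) (auto intro!: derivative_eq_intros)
    qed (use that in \<open>auto intro!: continuous_intros\<close>)
    then show ?thesis by (simp add: init)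
  qed
  have gG_bd: "\<bar>T * xe T - G T\<bar> \<le> C * T\<^sup>2" if "0 < T" "T < r" for T
  proof -
    have "\<bar>(T * xe T - G T) - (0 * xe 0 - G 0)\<bar> \<le> q * T\<^sup>2 - q * 0\<^sup>2"
    proof (rule increment_bound_finite_exceptions[OF _ S])
      show "continuous_on {0..T} (\<lambda>T. T * xe T - G T)"
        using sub[OF cont(1) that(2)] sub[OF cont(7) that(2)] by (intro continuous_intros)
      fix x assume x: "x \<in> {0<..<T} - S"
      then have "x \<in> {0<..<r} - S" using that by auto
      from slope[OF this] obtain b where b: "(xe has_real_derivative b) (at x)" "\<bar>b\<bar> \<le> q" by blast
      have "\<bar>x * b\<bar> \<le> x * q" using b x by (simp add: abs_mult)
      also have "\<dots> \<le> q * (2 * x)" using x q by simp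
      finally show "\<exists>d e. ((\<lambda>T. T * xe T - G T) has_real_derivative d) (at x) \<and> ((\<lambda>T. q * T\<^sup>2) has_real_derivative e) (at x) \<and> \<bar>d\<bar> \<le> e"
        using int(1)[of x] x that b(1)
        by (intro exI[of _ "x * b"] exI[of _ "q * (2 * x)"]) (auto intro!: derivative_eq_intros)
    qed (use that in \<open>auto intro!: continuous_intros\<close>)
    also have "\<dots> \<le> C * T\<^sup>2" using C(1) that by (simp add: mult_right_mono)
    finally show ?thesis by (simp add: init)
  qed
  \<comment> \<open>This b maximises 2 l^2 b M - l^2 b^2 r^3 / 3, where M is the moment at the final
    time; the maximum is 3 l^2 M^2 / r^3. \<open>e0 * T ^ 3\<close> below is the integral of l^2 b^2
    T^2.\<close>
  define b where "b = 3 * M r / r ^ 3"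
  define e0 where "e0 = l\<^sup>2 * b\<^sup>2 / 3"
  \<comment> \<open>T ye - H is the integral of T ye'. This term and G vanish at r by the end
    conditions, so both multiplier terms disappear from the final value of Q while their derivatives
    supply the cross terms of the squares.\<close>
  define Q where "Q = (\<lambda>T. 2 * c * uo T + k * W T - c\<^sup>2 * T - 2 * c * k * G T + l * A T
    - 2 * l * b * (T * ye T - H T) + 2 * l\<^sup>2 * b * M T - e0 * T ^ 3)"
  define \<Psi> where "\<Psi> = (\<lambda>T. K * T - Q T - S\<^sub>1 T (xe T) (G T) - S\<^sub>2 T (xo T) (M T))"
  have Qcont: "continuous_on {0..r} Q"
    unfolding Q_def using cont by (intro continuous_intros) auto
  \<comment> \<open>Monotonicity is shown from d > 0 only, since the value functions are singular at
    0; the limit d to 0 is taken afterwards.\<close>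
  have "\<Psi> d \<le> \<Psi> r" if d: "0 < d" "d < r" for d
  proof (rule mono_finite_exceptions[where f = \<Psi> and a = d and b = r, OF _ S])
    have D: "D\<^sub>1 x \<noteq> 0" "D\<^sub>2 x \<noteq> 0" if "x \<in> {d..r}" for x
      using D1_neg[of x] D2_neg[of x] that d r by auto
    have s: "continuous_on {d..r} f" if "continuous_on {0..r} f" for f :: "real \<Rightarrow> real"
      using continuous_on_subset[OF that, of "{d..r}"] d by auto
    have DD: "continuous_on {d..r} D\<^sub>1" "continuous_on {d..r} D\<^sub>2"
      unfolding D\<^sub>1_def[abs_def] D\<^sub>2_def[abs_def] by (auto intro!: continuous_intros)
    show "continuous_on {d..r} \<Psi>"
      unfolding \<Psi>_def S\<^sub>1_def S\<^sub>2_def using D DD s[OF Qcont] s[OF cont(1)] s[OF cont(2)] s[OF cont(7)] s[OF cont(8)]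
      by (auto intro!: continuous_intros)
    fix T assume "T \<in> {d<..<r} - S"
    then have T: "T \<in> {0<..<r} - S" and T': "T \<in> {d..r}" using d by auto
    from deriv[OF T] obtain xe' xo' ye' yo' ue' uo' where
      d: "(xe has_real_derivative xe') (at T)" "(xo has_real_derivative xo') (at T)"
      "(ye has_real_derivative ye') (at T)" "(uo has_real_derivative uo') (at T)"
      "(W has_real_derivative 2 * (xe T * uo' + xo T * ue')) (at T)"
      "(A has_real_derivative 2 * (xe T * yo' + xo T * ye')) (at T)"
      and K: "xe'\<^sup>2 + xo'\<^sup>2 + ye'\<^sup>2 + yo'\<^sup>2 + ue'\<^sup>2 + uo'\<^sup>2 \<le> K" by blast
    define q1 where "q1 = xe' + sin T * (xe T * T - G T) / D\<^sub>1 T"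
    define q2 where "q2 = xo' - ((cos T * T ^ 3 / 3 + D\<^sub>1 T) * xo T - D\<^sub>1 T * M T) / D\<^sub>2 T"
    define Q' where "Q' = 2 * c * uo' + k * (2 * (xe T * uo' + xo T * ue')) - c\<^sup>2 - 2 * c * k * xe T
      + l * (2 * (xe T * yo' + xo T * ye')) - 2 * l * b * (T * ye') + 2 * l\<^sup>2 * b * (T * xo T) - l\<^sup>2 * b\<^sup>2 * T\<^sup>2"
    have "(Q has_real_derivative Q') (at T)"
      unfolding Q_def
      by (rule derivative_eq_intros d int(1)[OF T] int(2)[OF T] int(3)[OF T] refl)+
        (simp add: Q'_def e0_def algebra_simps)
    then have "(\<Psi> has_real_derivative K * 1 - Q' - (xe'\<^sup>2 - (xe T)\<^sup>2 - q1\<^sup>2) - (xo'\<^sup>2 - (xo T)\<^sup>2 - q2\<^sup>2)) (at T)"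
      unfolding \<Psi>_def q1_def q2_def using D[OF T']
      by (intro DERIV_diff DERIV_S1 DERIV_S2 d int(1)[OF T] int(2)[OF T] DERIV_cmult DERIV_ident)
    moreover have "0 \<le> K * 1 - Q' - (xe'\<^sup>2 - (xe T)\<^sup>2 - q1\<^sup>2) - (xo'\<^sup>2 - (xo T)\<^sup>2 - q2\<^sup>2)"
    proof -
      \<comment> \<open>The normalisation distributes xe^2 + xo^2, left over from the two value
        functions, among the squares in u (share k^2) and in y (share l^2).\<close>
      have "(k\<^sup>2 + l\<^sup>2) * ((xe T)\<^sup>2 + (xo T)\<^sup>2) = (xe T)\<^sup>2 + (xo T)\<^sup>2" by (simp add: kl)
      then have "K * 1 - Q' - (xe'\<^sup>2 - (xe T)\<^sup>2 - q1\<^sup>2) - (xo'\<^sup>2 - (xo T)\<^sup>2 - q2\<^sup>2)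
        = (K - (xe'\<^sup>2 + xo'\<^sup>2 + ye'\<^sup>2 + yo'\<^sup>2 + ue'\<^sup>2 + uo'\<^sup>2)) + q1\<^sup>2 + q2\<^sup>2
          + (uo' - c - k * xe T)\<^sup>2 + (ue' - k * xo T)\<^sup>2 + (yo' - l * xe T)\<^sup>2 + (ye' - l * (xo T - b * T))\<^sup>2"
        by (simp add: Q'_def algebra_simps power2_eq_square)
      also have "\<dots> \<ge> 0" using K by (intro add_nonneg_nonneg) auto
      finally show ?thesis .
    qed
    ultimately show "\<exists>e\<ge>0. (\<Psi> has_real_derivative e) (at T)" by blast
  qed (use d in auto)
  moreover have "(\<Psi> \<longlongrightarrow> 0) (at_right 0)"
  proof -
    have "(Q \<longlongrightarrow> Q 0) (at_right 0)"
      using Qcont r by (simp add: continuous_on_Icc_at_rightD)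
    then have "(Q \<longlongrightarrow> 0) (at_right 0)" by (simp add: Q_def init)
    moreover have "((\<lambda>T. S\<^sub>1 T (xe T) (G T)) \<longlongrightarrow> 0) (at_right 0)"
      by (rule tendsto_S1[OF gG_bd G_bd r(1,2)])
    moreover have "((\<lambda>T. S\<^sub>2 T (xo T) (M T)) \<longlongrightarrow> 0) (at_right 0)"
    proof (rule tendsto_S2[OF _ M_bd r(1)])
      show "\<bar>xo T\<bar> \<le> C * T" if "0 < T" "T < r" for T
        using xo_bd[OF that] C(1) that by (meson mult_right_mono less_imp_le order_trans)
    qed
    ultimately have "(\<Psi> \<longlongrightarrow> K * 0 - 0 - 0 - 0) (at_right 0)"
      unfolding \<Psi>_def by (intro tendsto_intros)
    then show ?thesis by simp
  qed
  ultimately have "0 \<le> \<Psi> r"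
    using eventually_at_right_real[OF r(1)]
    by (intro tendsto_upperbound[where f=\<Psi> and F="at_right 0"]) (auto elim: eventually_mono)
  moreover have "Q r = 2 * c * uo r + k * W r - c\<^sup>2 * r + l * A r + 3 * l\<^sup>2 * (M r)\<^sup>2 / r ^ 3"
  proof -
    have "e0 * r ^ 3 = l\<^sup>2 * b * M r" "l\<^sup>2 * b * M r = 3 * l\<^sup>2 * (M r)\<^sup>2 / r ^ 3"
      using r by (simp_all add: e0_def b_def power2_eq_square power3_eq_cube mult_ac)
    then show ?thesis by (simp add: Q_def fin)
  qed
  moreover have "S\<^sub>1 r (xe r) (G r) = - p\<^sup>2 * r / ycot r"
    using r by (simp add: S\<^sub>1_def fin ycot_eq D\<^sub>1_def)
  moreover have "S\<^sub>2 r (xo r) (M r) = - (3 / r ^ 3 * (1 / (1 + 3 * (ycot r / r\<^sup>2))) * (M r)\<^sup>2)"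
  proof -
    have D: "D\<^sub>2 r = sin r * (r ^ 3 / 3 + r * ycot r)"
      using r by (simp add: D\<^sub>2_def ycot_eq field_simps power2_eq_square power3_eq_cube)
    have "3 / r ^ 3 * (1 / (1 + 3 * (ycot r / r\<^sup>2))) = 1 / (r ^ 3 / 3 * (1 + 3 * (ycot r / r\<^sup>2)))" by simp
    also have "r ^ 3 / 3 * (1 + 3 * (ycot r / r\<^sup>2)) = r ^ 3 / 3 + r * ycot r"
      using r by (simp add: field_simps power2_eq_square power3_eq_cube)
    finally show ?thesis using r by (simp add: S\<^sub>2_def fin D)
  qed
  ultimately show ?thesis
    by (simp add: \<Psi>_def algebra_simps diff_divide_distrib)
qed

section \<open>Piecewise smooth competitors\<close>

text \<open>Competitors are first replaced by piecewise smooth curves of speed at most one: for these, energy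
  estimates need neither reparametrisation nor measure theory.\<close>

definition unit_reach :: "real \<Rightarrow> n32 \<Rightarrow> bool" where
  "unit_reach l g \<longleftrightarrow> 0 \<le> l \<and> (\<exists>X Y S. finite S \<and> continuous_on {0..l} X \<and> continuous_on {0..l} Y \<and>
     X 0 = 0 \<and> Y 0 = 0 \<and> g = (X l, Y l) \<and>
     (\<forall>s\<in>{0<..<l} - S. \<exists>v. norm v \<le> 1 \<and> (X has_vector_derivative v) (at s) \<and>
        (Y has_vector_derivative - (1/2) *\<^sub>R cross3 (X s) v) (at s)))"

lemma norm_cross3_le: "norm (cross3 x y) \<le> norm x * norm y"
proof (rule power2_le_imp_le)
  show "(norm (cross3 x y))\<^sup>2 \<le> (norm x * norm y)\<^sup>2"
    using norm_cross[of x y] by (simp add: power_mult_distrib)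
qed simp

lemma unit_reach_0: "unit_reach 0 0"
  unfolding unit_reach_def
  by (intro conjI exI[of _ "\<lambda>_. 0"] exI[of _ "{}"]) (auto simp: zero_prod_def)

lemma unit_reach_extend:
  assumes "unit_reach l g" "l \<le> m" "continuous_on {l..m} X'" "continuous_on {l..m} Y'"
    and start: "X' l = fst g" "Y' l = snd g"
    and d: "\<And>s. s \<in> {l<..<m} \<Longrightarrow> \<exists>v. norm v \<le> 1 \<and> (X' has_vector_derivative v) (at s) \<and>
        (Y' has_vector_derivative - (1/2) *\<^sub>R cross3 (X' s) v) (at s)"
  shows "unit_reach m (X' m, Y' m)"
proof -
  obtain X Y S where l: "0 \<le> l" and S: "finite S" and c: "continuous_on {0..l} X" "continuous_on {0..l} Y"
    and init: "X 0 = 0" "Y 0 = 0" and g: "g = (X l, Y l)"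
    and D: "\<And>s. s \<in> {0<..<l} - S \<Longrightarrow> \<exists>v. norm v \<le> 1 \<and> (X has_vector_derivative v) (at s) \<and>
        (Y has_vector_derivative - (1/2) *\<^sub>R cross3 (X s) v) (at s)"
    using assms(1) unfolding unit_reach_def by blast
  define Z :: "real \<Rightarrow> real^3" where "Z s = (if s \<le> l then X s else X' s)" for s
  define V :: "real \<Rightarrow> real^3" where "V s = (if s \<le> l then Y s else Y' s)" for s
  have eq: "{s \<in> {0..m}. s \<le> l} = {0..l}" "{s \<in> {0..m}. l \<le> s} = {l..m}"
    using l assms(2) by auto
  have cont: "continuous_on {0..m} Z" "continuous_on {0..m} V"
    unfolding Z_def V_def
    by (rule continuous_on_cases_le[where h = "\<lambda>s. s"]; use c assms(3,4) eq start g in \<open>simp add: continuous_on_id\<close>)+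
  have "\<exists>v. norm v \<le> 1 \<and> (Z has_vector_derivative v) (at s) \<and>
        (V has_vector_derivative - (1/2) *\<^sub>R cross3 (Z s) v) (at s)"
    if s: "s \<in> {0<..<m} - insert l S" for s
  proof (cases "s < l")
    case True
    with s D[of s] obtain v where v: "norm v \<le> 1" "(X has_vector_derivative v) (at s)"
      "(Y has_vector_derivative - (1/2) *\<^sub>R cross3 (X s) v) (at s)" by auto
    have "(Z has_vector_derivative v) (at s)"
      by (rule has_vector_derivative_transform_within_open[OF v(2), of "{..<l}"]) (use True in \<open>auto simp: Z_def\<close>)
    moreover have "(V has_vector_derivative - (1/2) *\<^sub>R cross3 (X s) v) (at s)"
      by (rule has_vector_derivative_transform_within_open[OF v(3), of "{..<l}"]) (use True in \<open>auto simp: V_def\<close>)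
    ultimately show ?thesis using v(1) True by (intro exI[of _ v]) (simp add: Z_def)
  next
    case False
    with s have "l < s" by auto
    with s d[of s] obtain v where v: "norm v \<le> 1" "(X' has_vector_derivative v) (at s)"
      "(Y' has_vector_derivative - (1/2) *\<^sub>R cross3 (X' s) v) (at s)" by auto
    have "(Z has_vector_derivative v) (at s)"
      by (rule has_vector_derivative_transform_within_open[OF v(2), of "{l<..}"]) (use \<open>l < s\<close> in \<open>auto simp: Z_def\<close>)
    moreover have "(V has_vector_derivative - (1/2) *\<^sub>R cross3 (X' s) v) (at s)"
      by (rule has_vector_derivative_transform_within_open[OF v(3), of "{l<..}"]) (use \<open>l < s\<close> in \<open>auto simp: V_def\<close>)
    ultimately show ?thesis using v(1) \<open>l < s\<close> by (intro exI[of _ v]) (simp add: Z_def)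
  qed
  moreover have "(X' m, Y' m) = (Z m, V m)" "Z 0 = 0" "V 0 = 0"
    using assms(2) l start g init by (auto simp: Z_def V_def)
  ultimately show ?thesis
    unfolding unit_reach_def using S cont l assms(2)
    by (intro conjI exI[of _ Z] exI[of _ V] exI[of _ "insert l S"]) auto
qed

section \<open>Horizontal segments and vertical corrections\<close>

lemma unit_reach_segment:
  assumes "unit_reach l g"
  shows "unit_reach (l + norm v) (n32_mult g (v, 0))"
proof (cases "v = 0")
  case True
  then show ?thesis using assms by (simp add: n32_mult_def)
next
  case False
  define X where "X s = fst g + ((s - l) / norm v) *\<^sub>R v" for s
  define Y where "Y s = snd g - ((s - l) / (2 * norm v)) *\<^sub>R cross3 (fst g) v" for s
  have "unit_reach (l + norm v) (X (l + norm v), Y (l + norm v))"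
  proof (rule unit_reach_extend[OF assms])
    show "continuous_on {l..l + norm v} X" "continuous_on {l..l + norm v} Y"
      using False unfolding X_def Y_def by (auto intro!: continuous_intros)
    fix s
    have "(X has_vector_derivative (1 / norm v) *\<^sub>R v) (at s)"
      using False unfolding X_def by (auto intro!: derivative_eq_intros simp: divide_inverse)
    moreover have "(Y has_vector_derivative - (1/2) *\<^sub>R cross3 (X s) ((1 / norm v) *\<^sub>R v)) (at s)"
      using False unfolding X_def Y_def
      by (auto intro!: derivative_eq_intros simp: cross_add_left cross_mult_left cross_mult_right cross_refl)
    ultimately show "\<exists>w. norm w \<le> 1 \<and> (X has_vector_derivative w) (at s) \<and>
        (Y has_vector_derivative - (1/2) *\<^sub>R cross3 (X s) w) (at s)"
      using False by (intro exI[of _ "(1 / norm v) *\<^sub>R v"]) auto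
  qed (auto simp: X_def Y_def)
  also have "(X (l + norm v), Y (l + norm v)) = n32_mult g (v, 0)"
    using False by (simp add: X_def Y_def n32_mult_def)
  finally show ?thesis .
qed

text \<open>The commutator of two horizontal segments \<open>a, b\<close> is the vertical element \<open>- a \<times> b\<close>.\<close>

lemma unit_reach_vertical:
  assumes "unit_reach l g"
  shows "unit_reach (l + 4 * sqrt (norm \<eta>)) (fst g, snd g + \<eta>)"
proof (cases "\<eta> = 0")
  case True
  then show ?thesis using assms by simp
next
  case False
  obtain f :: "real^3" where f: "f \<noteq> 0" "orthogonal \<eta> f"
    using orthogonal_to_vector_exists[of \<eta>] by auto
  \<comment> \<open>a and b are orthogonal to \<eta> and to each other, both of norm sqrt |\<eta>|;
    traversing a, b, -a, -b costs 4 sqrt |\<eta>|.\<close>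
  define a where "a = (sqrt (norm \<eta>) / norm f) *\<^sub>R f"
  define b where "b = - (1 / norm \<eta>) *\<^sub>R cross3 \<eta> a"
  have a: "norm a = sqrt (norm \<eta>)" using f by (simp add: a_def)
  have orth: "a \<bullet> \<eta> = 0" using f by (simp add: a_def orthogonal_def inner_commute)
  have "(norm (cross3 \<eta> a))\<^sup>2 = (norm \<eta> * norm a)\<^sup>2"
    using norm_cross[of \<eta> a] orth by (simp add: inner_commute power_mult_distrib)
  then have "norm (cross3 \<eta> a) = norm \<eta> * norm a" by (simp add: power2_eq_iff_nonneg)
  then have b: "norm b = sqrt (norm \<eta>)" using False by (simp add: b_def a)
  have "cross3 a (cross3 \<eta> a) = (a \<bullet> a) *\<^sub>R \<eta>"
    using orth by (simp add: Lagrange)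
  also have "a \<bullet> a = norm \<eta>" by (simp add: dot_square_norm a)
  finally have ab: "cross3 a b = - \<eta>" using False by (simp add: b_def cross_mult_right cross_minus_right)
  have "unit_reach (l + norm a + norm b + norm (- a) + norm (- b))
      (n32_mult (n32_mult (n32_mult (n32_mult g (a, 0)) (b, 0)) (- a, 0)) (- b, 0))"
    by (intro unit_reach_segment assms)
  also have "n32_mult (n32_mult (n32_mult (n32_mult g (a, 0)) (b, 0)) (- a, 0)) (- b, 0) = (fst g, snd g + \<eta>)"
    using ab cross_skew[of b a]
    by (simp add: n32_mult_def cross_add_left cross_minus_right cross_refl algebra_simps scaleR_add_left[symmetric])
  finally show ?thesis by (simp add: a b add.commute)
qed

section \<open>Replacing horizontal curves by piecewise smooth ones\<close>

lemma horizontal_velocity: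
  "v $ 1 *\<^sub>R X\<^sub>1 g + v $ 2 *\<^sub>R X\<^sub>2 g + v $ 3 *\<^sub>R X\<^sub>3 g = (v, - (1/2) *\<^sub>R cross3 (fst g) v)"
  by (simp add: X\<^sub>1_def X\<^sub>2_def X\<^sub>3_def Let_def cross3_def axis_def vec_eq_iff forall_3 field_simps)

lemma horizontal_curve_integrals:
  assumes "horizontal_curve \<gamma> a" "s \<in> {0..1}"
  shows "(a has_integral fst (\<gamma> s) - fst (\<gamma> 0)) {0..s}"
    and "((\<lambda>\<sigma>. - (1/2) *\<^sub>R cross3 (fst (\<gamma> \<sigma>)) (a \<sigma>)) has_integral snd (\<gamma> s) - snd (\<gamma> 0)) {0..s}"
proof -
  have h: "((\<lambda>\<sigma>. (a \<sigma>, - (1/2) *\<^sub>R cross3 (fst (\<gamma> \<sigma>)) (a \<sigma>))) has_integral (\<gamma> s - \<gamma> 0)) {0..s}"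
    using assms unfolding horizontal_curve_def horizontal_velocity by auto
  show "(a has_integral fst (\<gamma> s) - fst (\<gamma> 0)) {0..s}"
    using has_integral_linear[OF h bounded_linear_fst] by (simp add: o_def)
  show "((\<lambda>\<sigma>. - (1/2) *\<^sub>R cross3 (fst (\<gamma> \<sigma>)) (a \<sigma>)) has_integral snd (\<gamma> s) - snd (\<gamma> 0)) {0..s}"
    using has_integral_linear[OF h bounded_linear_snd] by (simp add: o_def)
qed

text \<open>An inscribed polygon has the same horizontal endpoint and is not longer; its vertical endpoint is a
  Riemann sum, so the defect can be repaired by a short vertical correction.\<close>

lemma horizontal_curve_unit_reach:
  assumes h: "horizontal_curve \<gamma> a" and \<gamma>: "\<gamma> 0 = 0" "\<gamma> 1 = g" and "0 < \<epsilon>"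
  shows "\<exists>l \<le> horizontal_length a + \<epsilon>. unit_reach l g"
proof -
  define x where "x s = fst (\<gamma> s)" for s
  define t where "t s = snd (\<gamma> s)" for s
  define f where "f s = - (1/2) *\<^sub>R cross3 (x s) (a s)" for s
  define A where "A s = integral {0..s} (\<lambda>s. norm (a s))" for s
  define L where "L = horizontal_length a"
  have ai: "a absolutely_integrable_on {0..1}" using h by (simp add: horizontal_curve_def)
  then have na: "(\<lambda>s. norm (a s)) integrable_on {0..1}" by (simp add: absolutely_integrable_on_def)
  have xI: "(a has_integral x s) {0..s}" and tI: "(f has_integral t s) {0..s}" if "s \<in> {0..1}" for s
    using horizontal_curve_integrals[OF h that] \<gamma> by (simp_all add: x_def t_def f_def[abs_def])
  have sub: "u integrable_on {c..d}" if "u integrable_on {0..1}" "0 \<le> c" "d \<le> 1" for u :: "real \<Rightarrow> 'b::banach" and c d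
    using integrable_on_subinterval[OF that(1), of c d] that by auto
  have aint: "a integrable_on {0..1}" and fint: "f integrable_on {0..1}"
    using xI[of 1] tI[of 1] by auto
  have piece: "integral {c..d} a = x d - x c" "integral {c..d} f = t d - t c"
    "integral {c..d} (\<lambda>s. norm (a s)) = A d - A c"
    if "0 \<le> c" "c \<le> d" "d \<le> 1" for c d
  proof -
    have "integral {0..c} a + integral {c..d} a = integral {0..d} a"
      using that by (intro Henstock_Kurzweil_Integration.integral_combine sub[OF aint]) auto
    then show "integral {c..d} a = x d - x c"
      using integral_unique[OF xI[of c]] integral_unique[OF xI[of d]] that by (simp add: algebra_simps)
    have "integral {0..c} f + integral {c..d} f = integral {0..d} f"
      using that by (intro Henstock_Kurzweil_Integration.integral_combine sub[OF fint]) auto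
    then show "integral {c..d} f = t d - t c"
      using integral_unique[OF tI[of c]] integral_unique[OF tI[of d]] that by (simp add: algebra_simps)
    have "integral {0..c} (\<lambda>s. norm (a s)) + integral {c..d} (\<lambda>s. norm (a s)) = integral {0..d} (\<lambda>s. norm (a s))"
      using that by (intro Henstock_Kurzweil_Integration.integral_combine sub[OF na]) auto
    then show "integral {c..d} (\<lambda>s. norm (a s)) = A d - A c" by (simp add: A_def algebra_simps)
  qed
  have L0: "0 \<le> L" unfolding L_def horizontal_length_def by (intro integral_nonneg na) auto
  \<comment> \<open>The vertical defect of the polygon will be at most \<eta> L / 2 \<le>
    (\<epsilon>/4)^2, whose repair costs at most \<epsilon>. L + 1 keeps the quotient defined when L
    = 0.\<close>
  define \<eta> where "\<eta> = \<epsilon>\<^sup>2 / 8 / (L + 1)"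
  have \<eta>: "0 < \<eta>" using \<open>0 < \<epsilon>\<close> L0 by (simp add: \<eta>_def)
  have "continuous_on {0..1} x"
  proof (rule continuous_on_eq)
    show "continuous_on {0..1} (\<lambda>s. integral {0..s} a)" by (rule indefinite_integral_continuous_1[OF aint])
  qed (use integral_unique[OF xI] in auto)
  then have "uniformly_continuous_on {0..1} x" by (intro compact_uniformly_continuous) auto
  then obtain \<delta> where \<delta>: "0 < \<delta>" "\<And>s s'. s \<in> {0..1} \<Longrightarrow> s' \<in> {0..1} \<Longrightarrow> dist s' s < \<delta> \<Longrightarrow> dist (x s') (x s) < \<eta>"
    using \<eta> unfolding uniformly_continuous_on_def by metis
  obtain N where N: "N > 0" "1 / real N < \<delta>"
    using \<delta>(1) by (metis nat_approx_posE of_nat_Suc zero_less_Suc)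
  \<comment> \<open>The defect is bounded by \<eta>/2 times the length A used so far, so the errors
    of the sides add up independently of N.\<close>
  have "\<exists>l y. unit_reach l (x (real i / real N), y) \<and> l \<le> A (real i / real N)
      \<and> norm (y - t (real i / real N)) \<le> \<eta> / 2 * A (real i / real N)" if "i \<le> N" for i
    using that
  proof (induction i)
    case 0
    have "x 0 = 0" "t 0 = 0" "A 0 = 0" by (simp_all add: x_def t_def A_def \<gamma>)
    then show ?case using unit_reach_0 by (intro exI[of _ 0]) (simp add: zero_prod_def)
  next
    case (Suc i)
    define c where "c = real i / real N"
    define d where "d = real (Suc i) / real N"
    have cd: "0 \<le> c" "c \<le> d" "d \<le> 1" "d - c = 1 / real N"
      using Suc.prems N by (auto simp: c_def d_def field_simps)
    obtain l y where IH: "unit_reach l (x c, y)" "l \<le> A c" "norm (y - t c) \<le> \<eta> / 2 * A c"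
      using Suc unfolding c_def by auto
    have "unit_reach (l + norm (x d - x c)) (n32_mult (x c, y) (x d - x c, 0))"
      by (rule unit_reach_segment[OF IH(1)])
    moreover have "n32_mult (x c, y) (x d - x c, 0) = (x d, y - (1/2) *\<^sub>R cross3 (x c) (x d - x c))"
      by (simp add: n32_mult_def)
    moreover have "norm (x d - x c) \<le> A d - A c"
    proof -
      have "norm (integral {c..d} a) \<le> integral {c..d} (\<lambda>s. norm (a s))"
        using cd by (intro integral_norm_bound_integral sub[OF aint] sub[OF na]) auto
      then show ?thesis using piece[of c d] cd by simp
    qed
    moreover have "norm (y - (1/2) *\<^sub>R cross3 (x c) (x d - x c) - t d) \<le> \<eta> / 2 * A d"
    proof -
      have bl: "bounded_linear (\<lambda>v. - (1/2) *\<^sub>R cross3 (x c) v)"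
      proof (rule bounded_linear_compose[OF bounded_linear_scaleR_right])
        show "bounded_linear (cross3 (x c))"
          using bilinear_cross by (simp add: bilinear_def linear_conv_bounded_linear)
      qed
      have ai': "a integrable_on {c..d}" and fi': "f integrable_on {c..d}" using cd by (auto intro!: sub[OF aint] sub[OF fint])
      have i1: "((\<lambda>s. - (1/2) *\<^sub>R cross3 (x c) (a s)) has_integral - (1/2) *\<^sub>R cross3 (x c) (x d - x c)) {c..d}"
        using has_integral_linear[OF integrable_integral[OF ai'] bl] piece(1)[OF cd(1-3)] by (simp add: o_def)
      have i2: "(f has_integral (t d - t c)) {c..d}"
        using integrable_integral[OF fi'] piece(2)[OF cd(1-3)] by simp
      have i3: "((\<lambda>s. - (1/2) *\<^sub>R cross3 (x c) (a s) - f s) has_integral - (1/2) *\<^sub>R cross3 (x c) (x d - x c) - (t d - t c)) {c..d}"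
        by (rule has_integral_diff[OF i1 i2])
      \<comment> \<open>On one side of the polygon the vertical velocity is compared with the one in
        which x s is frozen at x c.\<close>
      have "norm (integral {c..d} (\<lambda>s. - (1/2) *\<^sub>R cross3 (x c) (a s) - f s)) \<le> integral {c..d} (\<lambda>s. \<eta> / 2 * norm (a s))"
      proof (rule integral_norm_bound_integral)
        show "(\<lambda>s. \<eta> / 2 * norm (a s)) integrable_on {c..d}"
          using cd by (intro integrable_on_mult_right sub[OF na]) auto
        fix s assume s: "s \<in> {c..d}"
        have "- (1/2) *\<^sub>R cross3 (x c) (a s) - f s = (1/2) *\<^sub>R cross3 (x s - x c) (a s)"
          by (simp add: f_def left_diff_distrib cross_minus_left scaleR_diff_right algebra_simps Cross3.left_diff_distrib)
        also have "norm \<dots> \<le> 1/2 * (norm (x s - x c) * norm (a s))"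
          using norm_cross3_le[of "x s - x c" "a s"] by simp
        also have "norm (x s - x c) \<le> \<eta>"
          using \<delta>(2)[of c s] s cd N by (auto simp: dist_norm abs_if less_imp_le)
        finally show "norm (- (1/2) *\<^sub>R cross3 (x c) (a s) - f s) \<le> \<eta> / 2 * norm (a s)"
          by (simp add: mult_right_mono)
      qed (use i3 in auto)
      also have "integral {c..d} (\<lambda>s. \<eta> / 2 * norm (a s)) = \<eta> / 2 * (A d - A c)"
        using piece(3)[OF cd(1-3)] by simp
      finally have "norm (- (1/2) *\<^sub>R cross3 (x c) (x d - x c) - (t d - t c)) \<le> \<eta> / 2 * (A d - A c)"
        using integral_unique[OF i3] by simp
      then have "norm ((y - t c) + (- (1/2) *\<^sub>R cross3 (x c) (x d - x c) - (t d - t c))) \<le> \<eta> / 2 * A c + \<eta> / 2 * (A d - A c)"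
        using IH(3) by (meson norm_triangle_le add_mono)
      then show ?thesis by (simp add: algebra_simps diff_divide_distrib)
    qed
    ultimately show ?case using IH(2) unfolding d_def[symmetric]
      by (intro exI[of _ "l + norm (x d - x c)"] exI[of _ "y - (1/2) *\<^sub>R cross3 (x c) (x d - x c)"]) auto
  qed
  from this[of N] N obtain l y where ly: "unit_reach l (x 1, y)" "l \<le> A 1" "norm (y - t 1) \<le> \<eta> / 2 * A 1" by auto
  have A1: "A 1 = L" by (simp add: A_def L_def horizontal_length_def)
  have "norm (t 1 - y) \<le> \<eta> / 2 * L" using ly(3) A1 by (simp add: norm_minus_commute)
  also have "\<dots> \<le> \<eta> / 2 * (L + 1)" using \<eta> by (intro mult_left_mono) auto
  also have "\<dots> = \<eta> * (L + 1) / 2" by simp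
  also have "\<eta> * (L + 1) = \<epsilon>\<^sup>2 / 8"
    unfolding \<eta>_def using L0 by (intro nonzero_eq_divide_eq[THEN iffD1] refl) auto
  also have "\<epsilon>\<^sup>2 / 8 / 2 = (\<epsilon> / 4)\<^sup>2" by (simp add: power2_eq_square)
  finally have "sqrt (norm (t 1 - y)) \<le> sqrt ((\<epsilon> / 4)\<^sup>2)" by (rule real_sqrt_le_mono)
  then have "4 * sqrt (norm (t 1 - y)) \<le> \<epsilon>" using \<open>0 < \<epsilon>\<close> by simp
  moreover have "unit_reach (l + 4 * sqrt (norm (t 1 - y))) (x 1, t 1)"
    using unit_reach_vertical[OF ly(1), of "t 1 - y"] by simp
  moreover have "(x 1, t 1) = g" by (simp add: x_def t_def \<gamma>)
  ultimately show ?thesis using ly(2) A1 unfolding L_def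
    by (intro exI[of _ "l + 4 * sqrt (norm (t 1 - y))"]) auto
qed

section \<open>The lower bound for endpoints on the cut locus\<close>

text \<open>The second axis is opposite to the component of m orthogonal to f, and the third
  completes the frame. If that component vanishes, any unit vector orthogonal to f serves.\<close>

lemma orthonormal_frame:
  fixes f m :: "real^3"
  assumes f: "norm f = 1"
  obtains f\<^sub>2 f\<^sub>3 where "f \<bullet> f = 1" "f\<^sub>2 \<bullet> f\<^sub>2 = 1" "f\<^sub>3 \<bullet> f\<^sub>3 = 1" "f \<bullet> f\<^sub>2 = 0" "f \<bullet> f\<^sub>3 = 0" "f\<^sub>2 \<bullet> f\<^sub>3 = 0"
    "cross3 f f\<^sub>2 = f\<^sub>3" "cross3 f\<^sub>2 f\<^sub>3 = f" "m \<bullet> f\<^sub>3 = 0" "m \<bullet> f\<^sub>2 \<le> 0"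
proof -
  have ff: "f \<bullet> f = 1" using f by (simp add: dot_square_norm)
  define w where "w = m - (m \<bullet> f) *\<^sub>R f"
  have wf: "f \<bullet> w = 0" by (simp add: w_def inner_diff_right ff inner_commute)
  have "\<exists>(g::real^3) n. norm g = 1 \<and> f \<bullet> g = 0 \<and> n \<le> 0 \<and> w = n *\<^sub>R g"
  proof (cases "w = 0")
    case True
    obtain y :: "real^3" where "y \<noteq> 0" "orthogonal f y" using orthogonal_to_vector_exists[of f] by auto
    then show ?thesis using True
      by (intro exI[of _ "(1 / norm y) *\<^sub>R y"] exI[of _ 0]) (auto simp: orthogonal_def)
  next
    case False
    then show ?thesis using wf
      by (intro exI[of _ "- (1 / norm w) *\<^sub>R w"] exI[of _ "- norm w"]) auto
  qed
  then obtain f\<^sub>2 n where f2: "norm f\<^sub>2 = 1" "f \<bullet> f\<^sub>2 = 0" "n \<le> 0" "w = n *\<^sub>R f\<^sub>2" by blast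
  have f22: "f\<^sub>2 \<bullet> f\<^sub>2 = 1" using f2 by (simp add: dot_square_norm)
  define f\<^sub>3 where "f\<^sub>3 = cross3 f f\<^sub>2"
  have f3: "f \<bullet> f\<^sub>3 = 0" "f\<^sub>2 \<bullet> f\<^sub>3 = 0" by (simp_all add: f\<^sub>3_def dot_cross_self)
  have "(norm f\<^sub>3)\<^sup>2 = 1" unfolding f\<^sub>3_def using norm_cross[of f f\<^sub>2] f f2 by simp
  then have f33: "f\<^sub>3 \<bullet> f\<^sub>3 = 1" by (simp add: dot_square_norm)
  have c: "cross3 f\<^sub>2 f\<^sub>3 = f" unfolding f\<^sub>3_def Lagrange using f22 f2 by (simp add: inner_commute)
  have m: "m = (m \<bullet> f) *\<^sub>R f + n *\<^sub>R f\<^sub>2" using f2(4) unfolding w_def by (metis add.commute diff_add_cancel)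
  have "m \<bullet> f\<^sub>3 = ((m \<bullet> f) *\<^sub>R f + n *\<^sub>R f\<^sub>2) \<bullet> f\<^sub>3" by (rule arg_cong[OF m])
  then have m3: "m \<bullet> f\<^sub>3 = 0" by (simp add: inner_add_left f3)
  have "m \<bullet> f\<^sub>2 = ((m \<bullet> f) *\<^sub>R f + n *\<^sub>R f\<^sub>2) \<bullet> f\<^sub>2" by (rule arg_cong[OF m])
  then have m2: "m \<bullet> f\<^sub>2 \<le> 0" using f2(3) by (simp add: inner_add_left f2(2) f22)
  show thesis
    by (rule that[OF ff f22 f33 f2(2) f3 f\<^sub>3_def[symmetric] c m3 m2])
qed

lemma DERIV_inner_const:
  "(X has_vector_derivative v) (at s) \<Longrightarrow> ((\<lambda>s. X s \<bullet> f) has_real_derivative v \<bullet> f) (at s)"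
  using bounded_linear.has_vector_derivative[OF bounded_linear_inner_left]
  by (simp add: has_real_derivative_iff_has_vector_derivative)

text \<open>The number \<open>p\<close> is the distance of the mean of the curve from the axis \<open>\<real> f\<close>, and the transversal coordinate
  \<open>x\<close> is taken in the direction opposite to that mean.  This alignment leaves only one statistic of the competitor
  in the bound, which is why \<open>\<kappa>, q\<close> may be chosen depending on \<open>p\<close>.\<close>

lemma unit_reach_lower_bound:
  assumes reach: "unit_reach l (\<rho> *\<^sub>R f, \<tau> *\<^sub>R f)" and f: "norm f = 1" and \<rho>: "0 < \<rho>"
  shows "\<exists>p\<ge>0. \<forall>r \<kappa> q. pi < r \<longrightarrow> r < vartheta\<^sub>1 \<longrightarrow> \<kappa>\<^sup>2 + q\<^sup>2 = r\<^sup>2 \<longrightarrow> r\<^sup>2 \<le> q\<^sup>2 * (1 + 3 * (ycot r / r\<^sup>2)) \<longrightarrow>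
    \<rho>\<^sup>2 + 4 * \<kappa> * p * \<rho> + 4 * q * \<tau> - 4 * p\<^sup>2 / (ycot r / r\<^sup>2) \<le> l\<^sup>2"
proof -
  obtain X Y S where l0: "0 \<le> l" and S: "finite S" and c: "continuous_on {0..l} X" "continuous_on {0..l} Y"
    and init: "X 0 = 0" "Y 0 = 0" and fin: "X l = \<rho> *\<^sub>R f" "Y l = \<tau> *\<^sub>R f"
    and D: "\<And>s. s \<in> {0<..<l} - S \<Longrightarrow> \<exists>v. norm v \<le> 1 \<and> (X has_vector_derivative v) (at s) \<and>
        (Y has_vector_derivative - (1/2) *\<^sub>R cross3 (X s) v) (at s)"
    using reach unfolding unit_reach_def by auto
  have "X l \<noteq> X 0" using \<rho> f init fin by auto
  then have l: "0 < l" using l0 by (metis less_le)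
  define m where "m = integral {0..l} X"
  obtain f\<^sub>2 f\<^sub>3 where fr: "f \<bullet> f = 1" "f\<^sub>2 \<bullet> f\<^sub>2 = 1" "f\<^sub>3 \<bullet> f\<^sub>3 = 1" "f \<bullet> f\<^sub>2 = 0" "f \<bullet> f\<^sub>3 = 0" "f\<^sub>2 \<bullet> f\<^sub>3 = 0"
    "cross3 f f\<^sub>2 = f\<^sub>3" "cross3 f\<^sub>2 f\<^sub>3 = f" "m \<bullet> f\<^sub>3 = 0" "m \<bullet> f\<^sub>2 \<le> 0"
    using orthonormal_frame[OF f] by metis
  have cross1: "cross3 a b \<bullet> f = (a \<bullet> f\<^sub>2) * (b \<bullet> f\<^sub>3) - (a \<bullet> f\<^sub>3) * (b \<bullet> f\<^sub>2)" for a b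
    unfolding fr(8)[symmetric] by (simp add: dot_cross)
  have cross3: "cross3 a b \<bullet> f\<^sub>3 = (a \<bullet> f) * (b \<bullet> f\<^sub>2) - (a \<bullet> f\<^sub>2) * (b \<bullet> f)" for a b
    unfolding fr(7)[symmetric] by (simp add: dot_cross)
  have bessel: "(v \<bullet> f)\<^sup>2 + (v \<bullet> f\<^sub>2)\<^sup>2 + (v \<bullet> f\<^sub>3)\<^sup>2 \<le> 1" if "norm v \<le> 1" for v
  proof -
    define a b c where "a = v \<bullet> f" and "b = v \<bullet> f\<^sub>2" and "c = v \<bullet> f\<^sub>3"
    have sym: "f\<^sub>2 \<bullet> f = 0" "f\<^sub>3 \<bullet> f = 0" "f\<^sub>3 \<bullet> f\<^sub>2 = 0" "f \<bullet> v = a" "f\<^sub>2 \<bullet> v = b" "f\<^sub>3 \<bullet> v = c"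
      using fr(4-6) by (simp_all add: a_def b_def c_def inner_commute)
    define w where "w = v - a *\<^sub>R f - b *\<^sub>R f\<^sub>2 - c *\<^sub>R f\<^sub>3"
    have "0 \<le> w \<bullet> w" by simp
    also have "w \<bullet> w = v \<bullet> v - (a\<^sup>2 + b\<^sup>2 + c\<^sup>2)"
      using fr(1-6) sym
      by (simp add: w_def inner_diff_left inner_diff_right power2_eq_square flip: a_def b_def c_def)
    also have "a\<^sup>2 + b\<^sup>2 + c\<^sup>2 = (v \<bullet> f)\<^sup>2 + (v \<bullet> f\<^sub>2)\<^sup>2 + (v \<bullet> f\<^sub>3)\<^sup>2" by (simp add: a_def b_def c_def)
    finally have "(v \<bullet> f)\<^sup>2 + (v \<bullet> f\<^sub>2)\<^sup>2 + (v \<bullet> f\<^sub>3)\<^sup>2 \<le> (norm v)\<^sup>2" by (simp add: dot_square_norm)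
    also have "\<dots> \<le> 1" using that by (simp add: power_le_one)
    finally show ?thesis .
  qed
  \<comment> \<open>Minus the mean of the second coordinate, so that x = z + p has mean zero and
    takes the value p at both ends.\<close>
  define p where "p = - (m \<bullet> f\<^sub>2) / l"
  have p0: "0 \<le> p" unfolding p_def using fr(10) l by (intro divide_nonneg_pos) auto
  define z y u where "z s = X s \<bullet> f\<^sub>2" and "y s = - (X s \<bullet> f\<^sub>3)" and "u s = X s \<bullet> f" for s
  define x where "x s = z s + p" for s
  \<comment> \<open>Adding half the product is an integration by parts: it turns the antisymmetric
    area forms into z dy and z du, and the terms with p turn these into x dy and x du.\<close>
  define Yc where "Yc s = Y s \<bullet> f + (1/2) * (z s * y s) + p * y s" for s
  define Wc where "Wc s = Y s \<bullet> f\<^sub>3 + (1/2) * (z s * u s) + p * u s" for s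
  have cs: "continuous_on {0..l} x" "continuous_on {0..l} y" "continuous_on {0..l} u"
    "continuous_on {0..l} Yc" "continuous_on {0..l} Wc"
    unfolding x_def[abs_def] y_def[abs_def] u_def[abs_def] Yc_def[abs_def] Wc_def[abs_def] z_def[abs_def]
    using c by (auto intro!: continuous_intros)
  have ds: "\<exists>a b d. (x has_real_derivative a) (at s) \<and> (y has_real_derivative b) (at s) \<and> (u has_real_derivative d) (at s) \<and>
      (Yc has_real_derivative x s * b) (at s) \<and> (Wc has_real_derivative x s * d) (at s) \<and> a\<^sup>2 + b\<^sup>2 + d\<^sup>2 \<le> 1"
    if s: "s \<in> {0<..<l} - S" for s
  proof -
    from D[OF s] obtain v where v: "norm v \<le> 1" "(X has_vector_derivative v) (at s)"
      "(Y has_vector_derivative - (1/2) *\<^sub>R cross3 (X s) v) (at s)" by blast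
    have z': "(z has_real_derivative v \<bullet> f\<^sub>2) (at s)" and u': "(u has_real_derivative v \<bullet> f) (at s)"
      and y': "(y has_real_derivative - (v \<bullet> f\<^sub>3)) (at s)"
      unfolding z_def[abs_def] u_def[abs_def] y_def[abs_def]
      by (auto intro!: DERIV_inner_const v DERIV_minus)
    have x': "(x has_real_derivative v \<bullet> f\<^sub>2) (at s)"
      unfolding x_def[abs_def] using z' by (auto intro!: derivative_eq_intros)
    have "(Yc has_real_derivative x s * - (v \<bullet> f\<^sub>3)) (at s)"
      unfolding Yc_def[abs_def]
      by (rule derivative_eq_intros DERIV_inner_const[OF v(3)] z' y' refl)+
        (simp add: cross1 x_def z_def y_def algebra_simps)
    moreover have "(Wc has_real_derivative x s * (v \<bullet> f)) (at s)"
      unfolding Wc_def[abs_def]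
      by (rule derivative_eq_intros DERIV_inner_const[OF v(3)] z' u' refl)+
        (simp add: cross3 x_def z_def u_def algebra_simps)
    moreover have "(v \<bullet> f\<^sub>2)\<^sup>2 + (- (v \<bullet> f\<^sub>3))\<^sup>2 + (v \<bullet> f)\<^sup>2 \<le> 1" using bessel[OF v(1)] by simp
    ultimately show ?thesis using x' y' u' by blast
  qed
  define Zx where "Zx s = integral {0..s} x" for s
  define Zy where "Zy s = integral {0..s} y" for s
  have Xi: "X integrable_on {0..l}" using c by (simp add: integrable_continuous_interval)
  have Zl: "Zx l = 0" "Zy l = 0"
  proof -
    have "((\<lambda>s. X s \<bullet> f\<^sub>2 + p) has_integral m \<bullet> f\<^sub>2 + p * l) {0..l}"
      using has_integral_add[OF has_integral_linear[OF integrable_integral[OF Xi] bounded_linear_inner_left[of f\<^sub>2]]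
        has_integral_const_real[of p 0 l]] l by (simp add: o_def m_def mult.commute)
    then show "Zx l = 0" using l unfolding Zx_def x_def[abs_def] z_def by (simp add: integral_unique p_def)
    have "((\<lambda>s. - (X s \<bullet> f\<^sub>3)) has_integral - (m \<bullet> f\<^sub>3)) {0..l}"
      using has_integral_neg[OF has_integral_linear[OF integrable_integral[OF Xi] bounded_linear_inner_left[of f\<^sub>3]]]
      by (simp add: o_def m_def)
    then have "integral {0..l} (\<lambda>s. - (X s \<bullet> f\<^sub>3)) = - (m \<bullet> f\<^sub>3)" by (rule integral_unique)
    then show "Zy l = 0" using fr(9) unfolding Zy_def y_def[abs_def] by (simp only: minus_zero)
  qed
  have prim: "continuous_on {0..e} (\<lambda>s. integral {0..s} g)"
    "\<And>s. s \<in> {0<..<e} \<Longrightarrow> ((\<lambda>s. integral {0..s} g) has_real_derivative g s) (at s)"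
    if "continuous_on {0..e} g" for g :: "real \<Rightarrow> real" and e
  proof -
    show "continuous_on {0..e} (\<lambda>s. integral {0..s} g)"
      by (rule indefinite_integral_continuous_1) (use that in \<open>simp add: integrable_continuous_interval\<close>)
    fix s assume s: "s \<in> {0<..<e}"
    have "((\<lambda>s. integral {0..s} g) has_real_derivative g s) (at s within {0..e})"
      by (rule integral_has_real_derivative[OF that]) (use s in auto)
    moreover have "at s within {0..e} = at s" using s by (intro at_within_Icc_at) auto
    ultimately show "((\<lambda>s. integral {0..s} g) has_real_derivative g s) (at s)" by simp
  qed
  have bound: "\<rho>\<^sup>2 + 4 * \<kappa> * p * \<rho> + 4 * q * \<tau> - 4 * p\<^sup>2 / (ycot r / r\<^sup>2) \<le> l\<^sup>2"
    if r: "pi < r" "r < vartheta\<^sub>1" and kl: "\<kappa>\<^sup>2 + q\<^sup>2 = r\<^sup>2" "r\<^sup>2 \<le> q\<^sup>2 * (1 + 3 * (ycot r / r\<^sup>2))" for r \<kappa> q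
  proof -
    have r0: "0 < r" "0 < ycot r" "sin r \<noteq> 0"
      using r ycot_pos pi_less_imp_pos sin_neg_below_vartheta1[of r] by auto
    \<comment> \<open>Folds [0, l] at its midpoint onto [0, r]; each half is traversed by T from the
      midpoint outwards, rescaled so that the end corresponds to T = r.\<close>
    define h where "h = l / (2 * r)"
    have h: "0 < h" "h * r = l / 2" using l r0 by (auto simp: h_def)
    define sp sm where "sp T = l / 2 + h * T" and "sm T = l / 2 - h * T" for T
    define S' where "S' = (\<lambda>s. (s - l / 2) / h) ` S \<union> (\<lambda>s. (l / 2 - s) / h) ` S"
    have S': "finite S'" using S by (simp add: S'_def)
    have rng: "sp T \<in> {0..l}" "sm T \<in> {0..l}" if "T \<in> {0..r}" for T
    proof -
      have "0 \<le> h * T" "h * T \<le> h * r" using that h by (auto intro: mult_left_mono)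
      then show "sp T \<in> {0..l}" "sm T \<in> {0..l}" using h l by (auto simp: sp_def sm_def)
    qed
    have rng': "sp T \<in> {0<..<l}" "sm T \<in> {0<..<l}" if "T \<in> {0<..<r}" for T
    proof -
      have "0 < h * T" "h * T < h * r" using that h by auto
      then show "sp T \<in> {0<..<l}" "sm T \<in> {0<..<l}" using h l by (auto simp: sp_def sm_def)
    qed
    have exc: "sp T \<in> {0<..<l} - S" "sm T \<in> {0<..<l} - S" if T: "T \<in> {0<..<r} - S'" for T
    proof -
      have "T = (sp T - l / 2) / h" "T = (l / 2 - sm T) / h" using h by (simp_all add: sp_def sm_def)
      then have "sp T \<notin> S" "sm T \<notin> S" using T unfolding S'_def by auto
      then show "sp T \<in> {0<..<l} - S" "sm T \<in> {0<..<l} - S" using rng'[of T] T by auto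
    qed
    have cf: "continuous_on {0..r} (\<lambda>T. g (sp T))" "continuous_on {0..r} (\<lambda>T. g (sm T))"
      if "continuous_on {0..l} g" for g :: "real \<Rightarrow> real"
      by (rule continuous_on_compose2[OF that]; use rng in \<open>auto simp: sp_def sm_def intro!: continuous_intros\<close>)+
    have df: "((\<lambda>T. g (sp T)) has_real_derivative h * a) (at T)" if "(g has_real_derivative a) (at (sp T))" for g a T
    proof -
      have "(sp has_real_derivative h) (at T)" unfolding sp_def[abs_def] by (auto intro!: derivative_eq_intros)
      from DERIV_chain2[where f = g and g = sp and x = T, OF that this] show ?thesis by (simp add: mult.commute)
    qed
    have dg: "((\<lambda>T. g (sm T)) has_real_derivative - (h * a)) (at T)" if "(g has_real_derivative a) (at (sm T))" for g a T
    proof -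
      have "(sm has_real_derivative - h) (at T)" unfolding sm_def[abs_def] by (auto intro!: derivative_eq_intros)
      from DERIV_chain2[where f = g and g = sm and x = T, OF that this] show ?thesis by (simp add: mult.commute)
    qed
    define ev od where "ev g T = (g (sp T) + g (sm T)) / 2" and "od g T = (g (sp T) - g (sm T)) / 2"
      for g :: "real \<Rightarrow> real" and T
    have cev: "continuous_on {0..r} (ev g)" "continuous_on {0..r} (od g)" if "continuous_on {0..l} g" for g
      unfolding ev_def[abs_def] od_def[abs_def] using cf[OF that] by (auto intro!: continuous_intros)
    have dev: "(ev g has_real_derivative h * (a - b) / 2) (at T)" "(od g has_real_derivative h * (a + b) / 2) (at T)"
      if "(g has_real_derivative a) (at (sp T))" "(g has_real_derivative b) (at (sm T))" for g a b T
      unfolding ev_def[abs_def] od_def[abs_def]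
      using df[OF that(1)] dg[OF that(2)]
      by (auto intro!: derivative_eq_intros simp: field_simps)
    define W A G H M where "W T = 2 * od Wc T" and "A T = 2 * od Yc T" and "G T = od Zx T / h" and "H T = od Zy T / h"
      and "M T = integral {0..T} (\<lambda>T. T * od x T)" for T
    have cM: "continuous_on {0..r} (\<lambda>T. T * od x T)" using cev(2)[OF cs(1)] by (intro continuous_intros)
    \<comment> \<open>The multiplier c = \<rho> / (2 r) maximises 2 c (\<rho>/2) - c^2 r. The pair
      (\<kappa>/r, q/r) is the normalised (k, l), and the squared speed in the folded time is at
      most h^2.\<close>
    have "2 * (\<rho> / (2 * r)) * od u r - (\<rho> / (2 * r))\<^sup>2 * r + \<kappa> / r * W r + q / r * A r
      + 3 / r ^ 3 * ((q / r)\<^sup>2 - 1 / (1 + 3 * (ycot r / r\<^sup>2))) * (M r)\<^sup>2 - p\<^sup>2 * r / ycot r \<le> h\<^sup>2 * r"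
    proof (rule folded_energy_bound[where xe = "ev x" and xo = "od x" and ye = "ev y"
          and uo = "od u" and W = W and A = A and G = G and M = M and H = H and S = S'])
      show "continuous_on {0..r} (ev x)" "continuous_on {0..r} (od x)" "continuous_on {0..r} (ev y)"
        "continuous_on {0..r} (od u)" "continuous_on {0..r} W" "continuous_on {0..r} A"
        using cev cs unfolding W_def[abs_def] A_def[abs_def] by (auto intro!: continuous_intros)
      show "continuous_on {0..r} G" "continuous_on {0..r} H"
        unfolding G_def[abs_def] H_def[abs_def] Zx_def[abs_def] Zy_def[abs_def]
        using h(1) by (auto intro!: continuous_intros cev prim(1)[OF cs(1)] prim(1)[OF cs(2)])
      show "continuous_on {0..r} M" unfolding M_def[abs_def] by (rule prim(1)[OF cM])
      show "(\<kappa> / r)\<^sup>2 + (q / r)\<^sup>2 = 1"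
        using kl(1) r0 by (simp add: power_divide flip: add_divide_distrib)
      show "\<exists>xe' xo' ye' yo' ue' uo'. (ev x has_real_derivative xe') (at T) \<and> (od x has_real_derivative xo') (at T) \<and>
        (ev y has_real_derivative ye') (at T) \<and> (od u has_real_derivative uo') (at T) \<and>
        (W has_real_derivative 2 * (ev x T * uo' + od x T * ue')) (at T) \<and>
        (A has_real_derivative 2 * (ev x T * yo' + od x T * ye')) (at T) \<and>
        xe'\<^sup>2 + xo'\<^sup>2 + ye'\<^sup>2 + yo'\<^sup>2 + ue'\<^sup>2 + uo'\<^sup>2 \<le> h\<^sup>2" if T: "T \<in> {0<..<r} - S'" for T
      proof -
        from ds[OF exc(1)[OF T]] obtain a b d where p: "(x has_real_derivative a) (at (sp T))"
          "(y has_real_derivative b) (at (sp T))" "(u has_real_derivative d) (at (sp T))"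
          "(Yc has_real_derivative x (sp T) * b) (at (sp T))" "(Wc has_real_derivative x (sp T) * d) (at (sp T))"
          and pn: "a\<^sup>2 + b\<^sup>2 + d\<^sup>2 \<le> 1" by blast
        from ds[OF exc(2)[OF T]] obtain a' b' d' where m: "(x has_real_derivative a') (at (sm T))"
          "(y has_real_derivative b') (at (sm T))" "(u has_real_derivative d') (at (sm T))"
          "(Yc has_real_derivative x (sm T) * b') (at (sm T))" "(Wc has_real_derivative x (sm T) * d') (at (sm T))"
          and mn: "a'\<^sup>2 + b'\<^sup>2 + d'\<^sup>2 \<le> 1" by blast
        have "(W has_real_derivative 2 * (h * (x (sp T) * d + x (sm T) * d') / 2)) (at T)"
          unfolding W_def[abs_def] by (intro DERIV_cmult dev(2) p m)
        also have "2 * (h * (x (sp T) * d + x (sm T) * d') / 2)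
          = 2 * (ev x T * (h * (d + d') / 2) + od x T * (h * (d - d') / 2))"
          by (simp add: ev_def od_def field_simps)
        finally have W': "(W has_real_derivative 2 * (ev x T * (h * (d + d') / 2) + od x T * (h * (d - d') / 2))) (at T)" .
        have "(A has_real_derivative 2 * (h * (x (sp T) * b + x (sm T) * b') / 2)) (at T)"
          unfolding A_def[abs_def] by (intro DERIV_cmult dev(2) p m)
        also have "2 * (h * (x (sp T) * b + x (sm T) * b') / 2)
          = 2 * (ev x T * (h * (b + b') / 2) + od x T * (h * (b - b') / 2))"
          by (simp add: ev_def od_def field_simps)
        finally have A': "(A has_real_derivative 2 * (ev x T * (h * (b + b') / 2) + od x T * (h * (b - b') / 2))) (at T)" .
        have "(h * (a - a') / 2)\<^sup>2 + (h * (a + a') / 2)\<^sup>2 + (h * (b - b') / 2)\<^sup>2 + (h * (b + b') / 2)\<^sup>2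
          + (h * (d - d') / 2)\<^sup>2 + (h * (d + d') / 2)\<^sup>2 = h\<^sup>2 * (((a\<^sup>2 + b\<^sup>2 + d\<^sup>2) + (a'\<^sup>2 + b'\<^sup>2 + d'\<^sup>2)) / 2)"
          by (simp add: power2_eq_square field_simps)
        also have "\<dots> \<le> h\<^sup>2 * 1" using pn mn by (intro mult_left_mono) auto
        finally have sq: "(h * (a - a') / 2)\<^sup>2 + (h * (a + a') / 2)\<^sup>2 + (h * (b - b') / 2)\<^sup>2 + (h * (b + b') / 2)\<^sup>2
          + (h * (d - d') / 2)\<^sup>2 + (h * (d + d') / 2)\<^sup>2 \<le> h\<^sup>2" by simp
        show ?thesis
          by (intro exI conjI, rule dev(1)[OF p(1) m(1)], rule dev(2)[OF p(1) m(1)], rule dev(1)[OF p(2) m(2)],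
            rule dev(2)[OF p(3) m(3)], rule W', rule A', rule sq)
      qed
      fix T assume T: "T \<in> {0<..<r} - S'"
      then have "sp T \<in> {0<..<l}" "sm T \<in> {0<..<l}" using rng' by auto
      then have Z: "(Zx has_real_derivative x (sp T)) (at (sp T))" "(Zx has_real_derivative x (sm T)) (at (sm T))"
        "(Zy has_real_derivative y (sp T)) (at (sp T))" "(Zy has_real_derivative y (sm T)) (at (sm T))"
        unfolding Zx_def[abs_def] Zy_def[abs_def] using prim(2)[OF cs(1)] prim(2)[OF cs(2)] by auto
      show "(G has_real_derivative ev x T) (at T)"
        using DERIV_cdivide[OF dev(2)[OF Z(1,2)], of h] h(1) unfolding G_def[abs_def] by (simp add: ev_def)
      show "(H has_real_derivative ev y T) (at T)"
        using DERIV_cdivide[OF dev(2)[OF Z(3,4)], of h] h(1) unfolding H_def[abs_def] by (simp add: ev_def)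
      show "(M has_real_derivative T * od x T) (at T)"
        unfolding M_def[abs_def] using T by (intro prim(2)[OF cM]) auto
    next
      have z: "sp 0 = sm 0" by (simp add: sp_def sm_def)
      show "od x 0 = 0" "od u 0 = 0" "W 0 = 0" "A 0 = 0" "G 0 = 0" "H 0 = 0" "M 0 = 0"
        by (simp_all add: od_def W_def A_def G_def H_def M_def z)
      have e: "sp r = l" "sm r = 0" using h by (simp_all add: sp_def sm_def)
      show "ev x r = p" "od x r = 0" "ev y r = 0"
        using fr(4,5) by (simp_all add: ev_def od_def e x_def y_def z_def init fin)
      show "G r = 0" "H r = 0" by (simp_all add: G_def H_def od_def e Zl) (simp_all add: Zx_def Zy_def)
    qed (use r r0 S' in auto)
    moreover have "od u r = \<rho> / 2" "W r = p * \<rho>" "A r = \<tau>"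
    proof -
      have e: "sp r = l" "sm r = 0" using h by (simp_all add: sp_def sm_def)
      show "od u r = \<rho> / 2" "W r = p * \<rho>" "A r = \<tau>"
        using fr(1,4,5) by (simp_all add: od_def W_def A_def e u_def Wc_def Yc_def z_def y_def init fin)
    qed
    \<comment> \<open>The side condition on q is what permits discarding the unknown moment M of the
      competitor.\<close>
    moreover have "0 \<le> 3 / r ^ 3 * ((q / r)\<^sup>2 - 1 / (1 + 3 * (ycot r / r\<^sup>2))) * (M r)\<^sup>2"
    proof -
      have n: "0 < 1 + 3 * (ycot r / r\<^sup>2)" using r0 by (intro add_pos_pos) auto
      have "1 \<le> q\<^sup>2 * (1 + 3 * (ycot r / r\<^sup>2)) / r\<^sup>2" using kl(2) r0 by (subst pos_le_divide_eq) auto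
      then have "1 \<le> (q / r)\<^sup>2 * (1 + 3 * (ycot r / r\<^sup>2))" by (simp add: power_divide)
      then have "1 / (1 + 3 * (ycot r / r\<^sup>2)) \<le> (q / r)\<^sup>2" using n by (subst pos_divide_le_eq) auto
      then show ?thesis using r0 by (intro mult_nonneg_nonneg) auto
    qed
    ultimately have "2 * (\<rho> / (2 * r)) * (\<rho> / 2) - (\<rho> / (2 * r))\<^sup>2 * r + \<kappa> / r * (p * \<rho>) + q / r * \<tau>
        - p\<^sup>2 * r / ycot r \<le> h\<^sup>2 * r" by simp
    then have "4 * r * (2 * (\<rho> / (2 * r)) * (\<rho> / 2) - (\<rho> / (2 * r))\<^sup>2 * r + \<kappa> / r * (p * \<rho>) + q / r * \<tau>
        - p\<^sup>2 * r / ycot r) \<le> 4 * r * (h\<^sup>2 * r)" using r0 by (intro mult_left_mono) auto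
    moreover have "4 * r * (h\<^sup>2 * r) = l\<^sup>2" using r0 by (simp add: h_def power2_eq_square)
    moreover have "4 * r * (2 * (\<rho> / (2 * r)) * (\<rho> / 2) - (\<rho> / (2 * r))\<^sup>2 * r + \<kappa> / r * (p * \<rho>) + q / r * \<tau>
        - p\<^sup>2 * r / ycot r) = \<rho>\<^sup>2 + 4 * \<kappa> * p * \<rho> + 4 * q * \<tau> - 4 * p\<^sup>2 / (ycot r / r\<^sup>2)"
      using r0 by (simp add: field_simps power2_eq_square)
    ultimately show ?thesis by simp
  qed
  show ?thesis by (intro exI[of _ p] conjI allI impI p0 bound)
qed

section \<open>Geodesics\<close>

text \<open>A normal geodesic from the identity: its control rotates about the axis \<open>w\<close>, and the time parameter is half
  the rotation angle.  The frame \<open>(n\<^sub>2, n\<^sub>1, w)\<close> is right-handed.\<close>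

locale helix =
  fixes P C :: real and n\<^sub>1 n\<^sub>2 w :: "real^3"
  assumes P_pos: "0 < P" and C_nz: "C \<noteq> 0"
    and unit: "n\<^sub>1 \<bullet> n\<^sub>1 = 1" "n\<^sub>2 \<bullet> n\<^sub>2 = 1" "w \<bullet> w = 1"
    and orth: "n\<^sub>1 \<bullet> n\<^sub>2 = 0" "n\<^sub>1 \<bullet> w = 0" "n\<^sub>2 \<bullet> w = 0"
    and cross: "cross3 n\<^sub>2 n\<^sub>1 = w" "cross3 n\<^sub>1 w = n\<^sub>2" "cross3 w n\<^sub>2 = n\<^sub>1"
begin

definition vel :: "real \<Rightarrow> real^3" where
  "vel s = P *\<^sub>R w + (C * ((cos s)\<^sup>2 - (sin s)\<^sup>2)) *\<^sub>R n\<^sub>1 + (2 * C * sin s * cos s) *\<^sub>R n\<^sub>2"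

definition pos :: "real \<Rightarrow> real^3" where
  "pos s = (P * s) *\<^sub>R w + (C * sin s * cos s) *\<^sub>R n\<^sub>1 + (C * sin s * sin s) *\<^sub>R n\<^sub>2"

definition vert :: "real \<Rightarrow> real^3" where
  "vert s = (C\<^sup>2 / 4 * (s - sin s * cos s)) *\<^sub>R w + (- (P * C / 2) * (sin s - s * cos s) * cos s) *\<^sub>R n\<^sub>1
     + (- (P * C / 2) * (sin s - s * cos s) * sin s) *\<^sub>R n\<^sub>2"

definition speed :: real where "speed = sqrt (P\<^sup>2 + C\<^sup>2)"

lemma speed_pos: "0 < speed"
  using P_pos by (simp add: speed_def add_pos_nonneg)

lemma orth': "n\<^sub>2 \<bullet> n\<^sub>1 = 0" "w \<bullet> n\<^sub>1 = 0" "w \<bullet> n\<^sub>2 = 0"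
  using orth by (simp_all add: inner_commute)

lemma norm_combination: "(norm (a *\<^sub>R w + b *\<^sub>R n\<^sub>1 + c *\<^sub>R n\<^sub>2))\<^sup>2 = a\<^sup>2 + b\<^sup>2 + c\<^sup>2"
  unfolding power2_norm_eq_inner
  by (simp add: inner_add_left inner_add_right unit orth orth' power2_eq_square)

lemma cross_combination:
  "cross3 (a *\<^sub>R w + b *\<^sub>R n\<^sub>1 + c *\<^sub>R n\<^sub>2) (a' *\<^sub>R w + b' *\<^sub>R n\<^sub>1 + c' *\<^sub>R n\<^sub>2)
    = (c * b' - b * c') *\<^sub>R w + (a * c' - c * a') *\<^sub>R n\<^sub>1 + (b * a' - a * b') *\<^sub>R n\<^sub>2"
proof -
  have "cross3 n\<^sub>1 n\<^sub>2 = - w" "cross3 w n\<^sub>1 = - n\<^sub>2" "cross3 n\<^sub>2 w = - n\<^sub>1"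
    using cross cross_skew by metis+
  then show ?thesis
    by (simp add: cross_add_left cross_add_right cross_mult_left cross_mult_right cross scaleR_diff_right algebra_simps)
qed

lemma norm_vel: "norm (vel s) = speed"
proof -
  have "(C * (k\<^sup>2 - q\<^sup>2))\<^sup>2 + (2 * C * q * k)\<^sup>2 = C\<^sup>2 * (q\<^sup>2 + k\<^sup>2)\<^sup>2" for q k :: real
    by (simp add: power2_eq_square algebra_simps)
  from this[of "cos s" "sin s"] have "(norm (vel s))\<^sup>2 = P\<^sup>2 + C\<^sup>2 * ((sin s)\<^sup>2 + (cos s)\<^sup>2)\<^sup>2"
    unfolding vel_def norm_combination by (simp only: add.assoc)
  then have "(norm (vel s))\<^sup>2 = P\<^sup>2 + C\<^sup>2" by simp
  then show ?thesis unfolding speed_def by (metis norm_ge_zero real_sqrt_unique)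
qed

lemma has_vector_derivative_combination:
  assumes "(f has_real_derivative f') (at s)" "(g has_real_derivative g') (at s)" "(h has_real_derivative h') (at s)"
  shows "((\<lambda>s. f s *\<^sub>R (a::real^3) + g s *\<^sub>R b + h s *\<^sub>R c) has_vector_derivative f' *\<^sub>R a + g' *\<^sub>R b + h' *\<^sub>R c) (at s)"
proof -
  have *: "((\<lambda>s. f s *\<^sub>R v) has_vector_derivative f' *\<^sub>R v) (at s)"
    if "(f has_real_derivative f') (at s)" for f f' and v :: "real^3"
    using has_vector_derivative_scaleR[OF that has_vector_derivative_const[of v]] by simp
  show ?thesis by (intro has_vector_derivative_add * assms)
qed

lemma pos_deriv: "(pos has_vector_derivative vel s) (at s)"
  unfolding pos_def[abs_def] vel_def
  by (intro has_vector_derivative_combination)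
    (auto intro!: derivative_eq_intros simp: power2_eq_square algebra_simps)

lemma vert_deriv: "(vert has_vector_derivative - (1/2) *\<^sub>R cross3 (pos s) (vel s)) (at s)"
proof -
  define S K where "S = sin s" and "K = cos s"
  have SK: "S * S = 1 - K * K" using sin_cos_squared_add[of s] by (simp add: S_def K_def power2_eq_square)
  have d1: "((\<lambda>s. C\<^sup>2 / 4 * (s - sin s * cos s)) has_real_derivative C\<^sup>2 / 2 * (S * S)) (at s)"
    by (auto intro!: derivative_eq_intros simp: SK simp flip: S_def K_def)
  have d2: "((\<lambda>s. - (P * C / 2) * (sin s - s * cos s) * cos s) has_real_derivative
      - (P * C / 2) * (2 * s * S * K - S * S)) (at s)"
    by (auto intro!: derivative_eq_intros simp flip: S_def K_def) (simp add: field_simps)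
  have d3: "((\<lambda>s. - (P * C / 2) * (sin s - s * cos s) * sin s) has_real_derivative
      - (P * C / 2) * (s * S * S + S * K - s * K * K)) (at s)"
    by (auto intro!: derivative_eq_intros simp flip: S_def K_def) (simp add: field_simps)
  have e: "- (1/2) *\<^sub>R cross3 (pos s) (vel s) = (C\<^sup>2 / 2 * (S * S)) *\<^sub>R w + (- (P * C / 2) * (2 * s * S * K - S * S)) *\<^sub>R n\<^sub>1
      + (- (P * C / 2) * (s * S * S + S * K - s * K * K)) *\<^sub>R n\<^sub>2"
  proof -
    have c: "C * S * S * (C * (K\<^sup>2 - S\<^sup>2)) - C * S * K * (2 * C * S * K) = - 2 * (C\<^sup>2 / 2 * (S * S))"
    proof -
      have "C * S * S * (C * (K\<^sup>2 - S\<^sup>2)) - C * S * K * (2 * C * S * K) = - (C * C * (S * S)) * (K * K + S * S)"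
        by (simp add: power2_eq_square algebra_simps)
      then show ?thesis by (simp add: SK power2_eq_square)
    qed
    show ?thesis
      unfolding pos_def vel_def cross_combination S_def[symmetric] K_def[symmetric] c scaleR_add_right scaleR_scaleR
      by (intro arg_cong2[where f = "(+)"] arg_cong2[where f = scaleR] refl)
        (simp_all add: field_simps power2_eq_square)
  qed
  show ?thesis
    unfolding vert_def[abs_def] e by (rule has_vector_derivative_combination[OF d1 d2 d3])
qed

lemma continuous_on_pos: "continuous_on A pos" and continuous_on_vert: "continuous_on A vert"
  and continuous_on_vel: "continuous_on A vel"
  unfolding pos_def[abs_def] vert_def[abs_def] vel_def[abs_def] by (intro continuous_intros)+

lemma pos_vert_0: "pos 0 = 0" "vert 0 = 0"
  by (simp_all add: pos_def vert_def)

lemma unit_reach_continue: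
  assumes "unit_reach l (pos R, vert R)" "R \<le> R'"
  shows "unit_reach (l + speed * (R' - R)) (pos R', vert R')"
proof -
  define c where "c = speed"
  have c: "0 < c" by (simp add: c_def speed_pos)
  define \<sigma> where "\<sigma> s = (s - l) / c + R" for s
  have \<sigma>': "(\<sigma> has_real_derivative 1 / c) (at s)" for s
    unfolding \<sigma>_def[abs_def] using c by (auto intro!: derivative_eq_intros)
  have \<sigma>v: "(\<sigma> has_vector_derivative 1 / c) (at s)" for s
    using \<sigma>' by (simp add: has_real_derivative_iff_has_vector_derivative)
  have cont\<sigma>: "continuous_on A \<sigma>" for A
    unfolding \<sigma>_def[abs_def] using c by (auto intro!: continuous_intros)
  have "unit_reach (l + c * (R' - R)) ((pos \<circ> \<sigma>) (l + c * (R' - R)), (vert \<circ> \<sigma>) (l + c * (R' - R)))"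
  proof (rule unit_reach_extend[OF assms(1)])
    show "continuous_on {l..l + c * (R' - R)} (pos \<circ> \<sigma>)" "continuous_on {l..l + c * (R' - R)} (vert \<circ> \<sigma>)"
      by (intro continuous_on_compose cont\<sigma> continuous_on_pos continuous_on_vert)+
    fix s
    have "norm ((1 / c) *\<^sub>R vel (\<sigma> s)) \<le> 1" using c by (simp add: norm_vel c_def)
    moreover have "(pos \<circ> \<sigma> has_vector_derivative (1 / c) *\<^sub>R vel (\<sigma> s)) (at s)"
      by (rule vector_diff_chain_at[OF \<sigma>v pos_deriv])
    moreover have "(vert \<circ> \<sigma> has_vector_derivative - (1/2) *\<^sub>R cross3 ((pos \<circ> \<sigma>) s) ((1 / c) *\<^sub>R vel (\<sigma> s))) (at s)"
      using vector_diff_chain_at[OF \<sigma>v vert_deriv, of s] by (simp add: cross_mult_right mult.commute)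
    ultimately show "\<exists>v. norm v \<le> 1 \<and> (pos \<circ> \<sigma> has_vector_derivative v) (at s) \<and>
        (vert \<circ> \<sigma> has_vector_derivative - (1/2) *\<^sub>R cross3 ((pos \<circ> \<sigma>) s) v) (at s)" by blast
  qed (use assms(2) c in \<open>auto simp: \<sigma>_def\<close>)
  moreover have "\<sigma> (l + c * (R' - R)) = R'" using c by (simp add: \<sigma>_def)
  ultimately show ?thesis by (simp add: c_def)
qed

lemma horizontal_curve_helix:
  assumes "0 \<le> R"
  shows "\<exists>\<gamma> a. horizontal_curve \<gamma> a \<and> \<gamma> 0 = 0 \<and> \<gamma> 1 = (pos R, vert R) \<and> horizontal_length a = speed * R"
proof -
  define a where "a s = R *\<^sub>R vel (R * s)" for s
  define \<gamma> where "\<gamma> s = (pos (R * s), vert (R * s))" for s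
  have ca: "continuous_on {0..1} a"
    unfolding a_def[abs_def] by (intro continuous_intros continuous_on_compose2[OF continuous_on_vel[of UNIV]]) auto
  have m: "((\<lambda>s. R * s) has_vector_derivative R) (at s)" for s
    by (auto intro!: derivative_eq_intros)
  have d: "(\<gamma> has_vector_derivative a s $ 1 *\<^sub>R X\<^sub>1 (\<gamma> s) + a s $ 2 *\<^sub>R X\<^sub>2 (\<gamma> s) + a s $ 3 *\<^sub>R X\<^sub>3 (\<gamma> s)) (at s)" for s
  proof -
    have "((pos \<circ> (\<lambda>s. R * s)) has_vector_derivative a s) (at s)"
      unfolding a_def by (rule vector_diff_chain_at[OF m pos_deriv])
    moreover have "((vert \<circ> (\<lambda>s. R * s)) has_vector_derivative - (1/2) *\<^sub>R cross3 (pos (R * s)) (a s)) (at s)"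
      using vector_diff_chain_at[OF m vert_deriv, of s] by (simp add: a_def cross_mult_right mult.commute)
    ultimately show ?thesis
      unfolding horizontal_velocity by (auto simp: \<gamma>_def[abs_def] o_def intro!: has_vector_derivative_Pair)
  qed
  have "horizontal_curve \<gamma> a"
    unfolding horizontal_curve_def
  proof (intro conjI ballI)
    show "a absolutely_integrable_on {0..1}" by (rule absolutely_integrable_continuous_real[OF ca])
    fix s :: real assume "s \<in> {0..1}"
    then show "((\<lambda>\<sigma>. a \<sigma> $ 1 *\<^sub>R X\<^sub>1 (\<gamma> \<sigma>) + a \<sigma> $ 2 *\<^sub>R X\<^sub>2 (\<gamma> \<sigma>) + a \<sigma> $ 3 *\<^sub>R X\<^sub>3 (\<gamma> \<sigma>))
        has_integral (\<gamma> s - \<gamma> 0)) {0..s}"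
      by (intro fundamental_theorem_of_calculus has_vector_derivative_at_within[OF d]) auto
  qed
  moreover have "\<gamma> 0 = 0" "\<gamma> 1 = (pos R, vert R)" by (simp_all add: \<gamma>_def pos_vert_0 zero_prod_def)
  moreover have "horizontal_length a = speed * R"
    using assms by (simp add: horizontal_length_def a_def norm_vel)
  ultimately show ?thesis by blast
qed

text \<open>The sign of this function tells on which side of the cut locus \<open>{t \<parallel> x}\<close> the geodesic is at time \<open>R\<close>.\<close>

definition cut :: "real \<Rightarrow> real" where
  "cut R = 2 * P\<^sup>2 * R * (R * cos R - sin R) - C\<^sup>2 * sin R * (R - sin R * cos R)"

text \<open>At \<pi> the function is -2 P^2 \<pi>^2 < 0; at \<open>vartheta\<^sub>1\<close> its
  first term vanishes and the second is positive because sin < 0. A zero lies between max R \<pi>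
  and \<open>vartheta\<^sub>1\<close>.\<close>

lemma exists_cut_time:
  assumes "0 < R" "R < vartheta\<^sub>1" "R \<le> pi \<or> cut R < 0"
  shows "\<exists>R'. R \<le> R' \<and> pi < R' \<and> R' < vartheta\<^sub>1 \<and> cut R' = 0"
proof -
  define a where "a = max R pi"
  have "cut pi < 0" using P_pos by (simp add: cut_def)
  then have a: "pi \<le> a" "a < vartheta\<^sub>1" "cut a < 0" "R \<le> a"
    using assms vartheta1_gt_pi by (auto simp: a_def max_def)
  have "\<bar>sin vartheta\<^sub>1 * cos vartheta\<^sub>1\<bar> \<le> 1"
    unfolding abs_mult by (intro mult_le_one) auto
  moreover have "3 < vartheta\<^sub>1" using vartheta1_gt_pi pi_gt3 by linarith
  ultimately have "0 < vartheta\<^sub>1 - sin vartheta\<^sub>1 * cos vartheta\<^sub>1" by linarith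
  moreover have "sin vartheta\<^sub>1 < 0" using sin_neg_below_vartheta1 vartheta1_gt_pi by auto
  ultimately have "C\<^sup>2 * sin vartheta\<^sub>1 * (vartheta\<^sub>1 - sin vartheta\<^sub>1 * cos vartheta\<^sub>1) < 0"
    using C_nz by (intro mult_neg_pos mult_pos_neg) auto
  then have "0 < cut vartheta\<^sub>1" unfolding cut_def vartheta1_root by simp
  have "\<exists>R'\<ge>a. R' \<le> vartheta\<^sub>1 \<and> cut R' = 0"
  proof (rule IVT')
    show "continuous_on {a..vartheta\<^sub>1} cut" unfolding cut_def[abs_def] by (intro continuous_intros)
  qed (use a \<open>0 < cut vartheta\<^sub>1\<close> in auto)
  then obtain R' where R': "a \<le> R'" "R' \<le> vartheta\<^sub>1" "cut R' = 0" by blast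
  then have "R' \<noteq> a" "R' \<noteq> vartheta\<^sub>1" using a \<open>0 < cut vartheta\<^sub>1\<close> by auto
  then show ?thesis using R' a by (intro exI[of _ R']) auto
qed

text \<open>The equation cut R = 0 ties P and C together, so after division by \<rho>^2 both the
  endpoint and the squared length depend on R alone: the length term becomes 1 +
  \<open>ycot R\<close> / R^2 * (R^2 + \<open>lamsq R\<close>). This is the quantity dominated by
  the bound with optimal multipliers for the competitor's p.\<close>

lemma length_bound_at_cut_time:
  assumes R: "pi < R" "R < vartheta\<^sub>1" and cut: "cut R = 0" and reach: "unit_reach l (pos R, vert R)"
  shows "speed * R \<le> l"
proof -
  define y S K where "y = ycot R" and "S = sin R" and "K = cos R"
  have y0: "0 < y" and R0: "0 < R" and S0: "S < 0"
    using ycot_pos[OF R] pi_less_imp_pos[OF R(1)] sin_neg_below_vartheta1[of R] R by (auto simp: y_def S_def)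
  have l0: "0 \<le> l" using reach by (simp add: unit_reach_def)
  have Sy: "S * y = R * K - S" using S0 by (simp add: y_def ycot_eq S_def K_def)
  have SK: "S\<^sup>2 + K\<^sup>2 = 1" by (simp add: S_def K_def)
  have Q: "S\<^sup>2 * (R\<^sup>2 + y + y\<^sup>2) = R * (R - S * K)"
    using sin_ycot_identities(1)[of R] S0 by (simp add: y_def S_def K_def)
  have Qpos: "0 < R\<^sup>2 + y + y\<^sup>2" using y0 R0 by (intro add_pos_pos) auto
  then have RSK: "0 < R - S * K" using Q S0 R0 by (metis mult_pos_pos zero_less_mult_pos zero_less_power2 less_irrefl)
  have E: "2 * P\<^sup>2 * R * y = C\<^sup>2 * (R - S * K)"
  proof -
    have "S * (2 * P\<^sup>2 * R * y) = 2 * P\<^sup>2 * R * (S * y)" by simp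
    also have "\<dots> = C\<^sup>2 * S * (R - S * K)"
      unfolding Sy using cut unfolding cut_def S_def[symmetric] K_def[symmetric] by simp
    finally have "S * (2 * P\<^sup>2 * R * y) = S * (C\<^sup>2 * (R - S * K))" by (simp only: mult_ac)
    then show ?thesis using S0 by (simp only: mult_cancel_left) auto
  qed
  define \<rho> where "\<rho> = norm (pos R)"
  have \<rho>2: "\<rho>\<^sup>2 = P\<^sup>2 * R\<^sup>2 + C\<^sup>2 * S\<^sup>2"
  proof -
    have "\<rho>\<^sup>2 = P\<^sup>2 * R\<^sup>2 + C\<^sup>2 * S\<^sup>2 * (S\<^sup>2 + K\<^sup>2)"
      unfolding \<rho>_def pos_def norm_combination S_def[symmetric] K_def[symmetric]
      by (simp only: power2_eq_square) (simp add: algebra_simps)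
    then show ?thesis unfolding SK by simp
  qed
  have "0 < P\<^sup>2 * R\<^sup>2" using P_pos R0 by simp
  then have "0 < \<rho>\<^sup>2" unfolding \<rho>2 by (intro add_pos_nonneg) auto
  then have \<rho>: "0 < \<rho>" by (simp add: \<rho>_def)
  define k where "k = C\<^sup>2 * (R - S * K) / (4 * P * R)"
  have vert: "vert R = k *\<^sub>R pos R"
  proof -
    have kc: "k * (C * S) = - (P * C / 2) * (S - R * K)"
    proof -
      have "k * (C * S) = (2 * P\<^sup>2 * R * y) * C * S / (4 * P * R)" unfolding E k_def by simp
      also have "\<dots> = P * C / 2 * (S * y)" using P_pos R0 by (simp add: power2_eq_square)
      also have "\<dots> = - (P * C / 2) * (S - R * K)" unfolding Sy by (simp add: right_diff_distrib)
      finally show ?thesis .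
    qed
    have kC: "k * (C * S * z) = - (P * C / 2) * (S - R * K) * z" for z
      using arg_cong[OF kc, of "\<lambda>x. x * z"] by (simp only: mult.assoc)
    have kP: "k * (P * R) = C\<^sup>2 / 4 * (R - S * K)" using P_pos R0 by (simp add: k_def)
    show ?thesis
      unfolding vert_def pos_def S_def[symmetric] K_def[symmetric] scaleR_add_right scaleR_scaleR kC kP by (rule refl)
  qed
  define f where "f = (1 / \<rho>) *\<^sub>R pos R"
  have f: "norm f = 1" using \<rho> by (simp add: f_def) (simp add: \<rho>_def)
  have "unit_reach l (\<rho> *\<^sub>R f, (k * \<rho>) *\<^sub>R f)" using reach \<rho> by (simp add: f_def vert)
  from unit_reach_lower_bound[OF this f \<rho>] obtain p where p: "0 \<le> p"
    and bound: "\<And>r \<kappa> q. pi < r \<Longrightarrow> r < vartheta\<^sub>1 \<Longrightarrow> \<kappa>\<^sup>2 + q\<^sup>2 = r\<^sup>2 \<Longrightarrow> r\<^sup>2 \<le> q\<^sup>2 * (1 + 3 * (ycot r / r\<^sup>2)) \<Longrightarrow>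
      \<rho>\<^sup>2 + 4 * \<kappa> * p * \<rho> + 4 * q * (k * \<rho>) - 4 * p\<^sup>2 / (ycot r / r\<^sup>2) \<le> l\<^sup>2" by blast
  \<comment> \<open>This is 2|t| / |x|^2 for the endpoint, as \<open>mk\<close> below confirms with
    |t| = k \<rho>.\<close>
  define m where "m = y / R\<^sup>2 * sqrt (lamsq R)"
  have C2: "C\<^sup>2 * S\<^sup>2 * (R\<^sup>2 + y + y\<^sup>2) = 2 * P\<^sup>2 * R\<^sup>2 * y"
  proof -
    have "C\<^sup>2 * S\<^sup>2 * (R\<^sup>2 + y + y\<^sup>2) = C\<^sup>2 * (S\<^sup>2 * (R\<^sup>2 + y + y\<^sup>2))" by simp
    also have "\<dots> = R * (C\<^sup>2 * (R - S * K))" unfolding Q by simp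
    also have "\<dots> = 2 * P\<^sup>2 * R\<^sup>2 * y" unfolding E[symmetric] by (simp add: power2_eq_square)
    finally show ?thesis .
  qed
  have lam: "lamsq R = (P * R\<^sup>2 / \<rho>)\<^sup>2"
  proof -
    have e: "\<rho>\<^sup>2 * (R\<^sup>2 + y + y\<^sup>2) = P\<^sup>2 * R\<^sup>2 * (R\<^sup>2 + 3 * y + y\<^sup>2)"
      unfolding \<rho>2 distrib_right C2 by (simp add: algebra_simps)
    have "0 < R\<^sup>2 + 3 * y + y\<^sup>2" using y0 R0 by (intro add_pos_pos) auto
    moreover have "R\<^sup>2 * (R\<^sup>2 + y + y\<^sup>2) * \<rho>\<^sup>2 = (P * R\<^sup>2)\<^sup>2 * (R\<^sup>2 + 3 * y + y\<^sup>2)"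
    proof -
      have "R\<^sup>2 * (R\<^sup>2 + y + y\<^sup>2) * \<rho>\<^sup>2 = R\<^sup>2 * (\<rho>\<^sup>2 * (R\<^sup>2 + y + y\<^sup>2))" by (simp only: mult_ac)
      also have "\<dots> = (P * R\<^sup>2)\<^sup>2 * (R\<^sup>2 + 3 * y + y\<^sup>2)"
        unfolding e by (simp only: power_mult_distrib power2_eq_square mult_ac)
      finally show ?thesis .
    qed
    ultimately have "R\<^sup>2 * (R\<^sup>2 + y + y\<^sup>2) / (R\<^sup>2 + 3 * y + y\<^sup>2) = (P * R\<^sup>2)\<^sup>2 / \<rho>\<^sup>2"
      using \<rho> by (intro frac_eq_eq[THEN iffD2]) auto
    then show ?thesis unfolding power_divide by (simp only: lamsq_def y_def)
  qed
  then have sl: "sqrt (lamsq R) = P * R\<^sup>2 / \<rho>" using P_pos \<rho> R0 by simp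
  have mk: "4 * k * \<rho> = 2 * m * \<rho>\<^sup>2"
  proof -
    have "4 * k = 2 * P\<^sup>2 * R * y / (P * R)" unfolding E k_def by simp
    also have "\<dots> = 2 * P * y" using P_pos R0 by (simp add: power2_eq_square)
    finally have "4 * k = 2 * P * y" .
    moreover have "m * \<rho> = P * y" using \<rho> R0 by (simp add: m_def sl)
    ultimately show ?thesis by (simp add: power2_eq_square)
  qed
  \<comment> \<open>The multiplier choice is stated for \<rho> = 1; by dilation the mean distance
    enters as p / \<rho>.\<close>
  obtain r \<kappa> q where r: "pi < r" "r < vartheta\<^sub>1" and kq: "\<kappa>\<^sup>2 + q\<^sup>2 = r\<^sup>2" "r\<^sup>2 \<le> q\<^sup>2 * (1 + 3 * (ycot r / r\<^sup>2))"
    and opt: "y / R\<^sup>2 * (R\<^sup>2 + lamsq R) \<le> 2 * m * q + 4 * \<kappa> * (p / \<rho>) - 4 * (p / \<rho>)\<^sup>2 / (ycot r / r\<^sup>2)"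
    using optimal_multipliers[OF R, of "p / \<rho>"] p \<rho> unfolding y_def[symmetric] m_def by auto
  have "(speed * R)\<^sup>2 = \<rho>\<^sup>2 + \<rho>\<^sup>2 * (y / R\<^sup>2 * (R\<^sup>2 + lamsq R))"
  proof -
    have "\<rho>\<^sup>2 * (y / R\<^sup>2 * (R\<^sup>2 + lamsq R)) = y * (\<rho>\<^sup>2 + P\<^sup>2 * R\<^sup>2)"
      unfolding lam using \<rho> R0 by (simp add: field_simps power2_eq_square)
    also have "\<dots> = R * (2 * P\<^sup>2 * R * y) + C\<^sup>2 * S * (S * y)"
      unfolding \<rho>2 by (simp add: algebra_simps power2_eq_square)
    also have "\<dots> = C\<^sup>2 * (R\<^sup>2 - S\<^sup>2)" unfolding E Sy by (simp add: algebra_simps power2_eq_square)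
    finally have "\<rho>\<^sup>2 * (y / R\<^sup>2 * (R\<^sup>2 + lamsq R)) = C\<^sup>2 * (R\<^sup>2 - S\<^sup>2)" .
    then show ?thesis unfolding \<rho>2 speed_def power_mult_distrib by (simp add: algebra_simps)
  qed
  also have "\<dots> \<le> \<rho>\<^sup>2 + \<rho>\<^sup>2 * (2 * m * q + 4 * \<kappa> * (p / \<rho>) - 4 * (p / \<rho>)\<^sup>2 / (ycot r / r\<^sup>2))"
    using opt by (intro add_left_mono mult_left_mono) auto
  also have "\<dots> = \<rho>\<^sup>2 + q * (2 * m * \<rho>\<^sup>2) + 4 * \<kappa> * p * \<rho> - 4 * p\<^sup>2 / (ycot r / r\<^sup>2)"
  proof -
    have "\<rho>\<^sup>2 * (4 * (p / \<rho>)\<^sup>2 / (ycot r / r\<^sup>2)) = 4 * p\<^sup>2 / (ycot r / r\<^sup>2)" "\<rho>\<^sup>2 * (4 * \<kappa> * (p / \<rho>)) = 4 * \<kappa> * p * \<rho>"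
      using \<rho> by (simp_all add: power_divide power2_eq_square)
    then show ?thesis by (simp add: distrib_left right_diff_distrib)
  qed
  also have "\<dots> = \<rho>\<^sup>2 + 4 * \<kappa> * p * \<rho> + 4 * q * (k * \<rho>) - 4 * p\<^sup>2 / (ycot r / r\<^sup>2)"
    unfolding mk[symmetric] by simp
  also have "\<dots> \<le> l\<^sup>2" by (rule bound[OF r kq])
  finally show ?thesis using l0 by (rule power2_le_imp_le)
qed

text \<open>A competitor that is shorter before the cut time would, continued by the geodesic, be shorter up to the cut time.\<close>

lemma length_bound_before_cut_time:
  assumes "0 < R" "R < vartheta\<^sub>1" "R \<le> pi \<or> cut R < 0" and reach: "unit_reach l (pos R, vert R)"
  shows "speed * R \<le> l"
proof -
  obtain R' where R': "R \<le> R'" "pi < R'" "R' < vartheta\<^sub>1" "cut R' = 0"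
    using exists_cut_time[OF assms(1-3)] by blast
  from length_bound_at_cut_time[OF R'(2-4) unit_reach_continue[OF reach R'(1)]]
  show ?thesis by (simp add: algebra_simps)
qed

text \<open>The helix attains the infimum. The lower bound is available for piecewise smooth curves,
  which reach the same endpoint with length exceeding that of a given horizontal curve by at most
  e.\<close>

lemma cc_dist_helix:
  assumes "0 < R" "R < vartheta\<^sub>1" "R \<le> pi \<or> cut R < 0"
  shows "cc_dist (pos R, vert R) = speed * R"
  unfolding cc_dist_def
proof (rule cInf_eq_minimum)
  show "speed * R \<in> {horizontal_length a |\<gamma> a. horizontal_curve \<gamma> a \<and> \<gamma> 0 = 0 \<and> \<gamma> 1 = (pos R, vert R)}"
    using horizontal_curve_helix[of R] assms(1) by (force intro: less_imp_le)
next
  fix L assume "L \<in> {horizontal_length a |\<gamma> a. horizontal_curve \<gamma> a \<and> \<gamma> 0 = 0 \<and> \<gamma> 1 = (pos R, vert R)}"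
  then obtain \<gamma> a where a: "horizontal_curve \<gamma> a" "\<gamma> 0 = 0" "\<gamma> 1 = (pos R, vert R)" "L = horizontal_length a" by blast
  show "speed * R \<le> L"
  proof (rule field_le_epsilon)
    fix e :: real assume "0 < e"
    then obtain l where "l \<le> L + e" "unit_reach l (pos R, vert R)"
      using horizontal_curve_unit_reach[OF a(1-3)] a(4) by blast
    then show "speed * R \<le> L + e" using length_bound_before_cut_time[OF assms] by fastforce
  qed
qed

end

section \<open>The distance formula\<close>

text \<open>\<open>h_fun\<close> and its first derivative vanish at 0, and the second derivative is
  4 sin z (sin z - z cos z), positive on (0, \<pi>).\<close>

lemma h_fun_pos:
  assumes "0 < r" "r < pi"
  shows "0 < h_fun r"
proof -
  define h' where "h' x = 3 * x - 3 * sin x * cos x - 2 * x * (sin x)\<^sup>2" for x :: real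
  have h': "0 < h' x" if "0 < x" "x < pi" for x
  proof -
    have "h' 0 < h' x"
    proof (rule DERIV_pos_imp_increasing_open[OF that(1)])
      fix z assume z: "0 < z" "z < x"
      have sc: "cos z * cos z = 1 - sin z * sin z" using sin_cos_squared_add[of z] by (simp add: power2_eq_square)
      have "(h' has_real_derivative 4 * sin z * (sin z - z * cos z)) (at z)"
        unfolding h'_def[abs_def] by (auto intro!: derivative_eq_intros) (use sc in algebra)
      moreover have "0 < 4 * sin z * (sin z - z * cos z)"
        using xcos_less_sin[of z] sin_gt_zero[of z] z that vartheta1_gt_pi by simp
      ultimately show "\<exists>d. (h' has_real_derivative d) (at z) \<and> 0 < d" by blast
    qed (auto simp: h'_def[abs_def] intro!: continuous_intros)
    then show ?thesis by (simp add: h'_def)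
  qed
  have "h_fun 0 < h_fun r"
  proof (rule DERIV_pos_imp_increasing_open[OF assms(1)])
    fix x assume x: "0 < x" "x < r"
    have sc: "cos x * cos x = 1 - sin x * sin x" using sin_cos_squared_add[of x] by (simp add: power2_eq_square)
    have "(h_fun has_real_derivative h' x) (at x)"
      unfolding h_fun_def[abs_def] by (auto intro!: derivative_eq_intros) (simp only: h'_def, use sc in algebra)
    then show "\<exists>d. (h_fun has_real_derivative d) (at x) \<and> 0 < d" using h'[of x] x assms by auto
  qed (auto simp: h_fun_def[abs_def] intro!: continuous_intros)
  then show ?thesis by (simp add: h_fun_def)
qed

section \<open>The covector and its geodesic in terms of r and y\<close>

lemma psi_ycot: "r \<noteq> 0 \<Longrightarrow> \<psi> r = - ycot r / r\<^sup>2"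
  by (simp add: \<psi>_def ycot_def)

lemma deriv_psi:
  assumes "r \<noteq> 0" "sin r \<noteq> 0"
  shows "deriv \<psi> r / r = (r\<^sup>2 + 3 * ycot r + (ycot r)\<^sup>2) / r ^ 4"
proof -
  have "(ycot has_real_derivative d) (at r) \<Longrightarrow> ((\<lambda>r. - ycot r / r\<^sup>2) has_real_derivative
      (- d * r\<^sup>2 - - ycot r * (2 * r)) / (r\<^sup>2 * r\<^sup>2)) (at r)" for d
    using assms by (auto intro!: derivative_eq_intros simp: field_simps)
  from this[OF DERIV_ycot[OF assms]] have "((\<lambda>r. - ycot r / r\<^sup>2) has_real_derivative
      (- (- (r\<^sup>2 + ycot r + (ycot r)\<^sup>2) / r) * r\<^sup>2 - - ycot r * (2 * r)) / (r\<^sup>2 * r\<^sup>2)) (at r)" .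
  then have "(\<psi> has_real_derivative
      (- (- (r\<^sup>2 + ycot r + (ycot r)\<^sup>2) / r) * r\<^sup>2 - - ycot r * (2 * r)) / (r\<^sup>2 * r\<^sup>2)) (at r)"
    by (rule has_field_derivative_transform_within_open[where S = "- {0}"]) (use assms psi_ycot in auto)
  then have "deriv \<psi> r = (- (- (r\<^sup>2 + ycot r + (ycot r)\<^sup>2) / r) * r\<^sup>2 - - ycot r * (2 * r)) / (r\<^sup>2 * r\<^sup>2)"
    by (rule DERIV_imp_deriv)
  also have "\<dots> = (r\<^sup>2 + 3 * ycot r + (ycot r)\<^sup>2) / r ^ 3"
    using assms(1) by (simp add: field_simps power2_eq_square power3_eq_cube)
  finally show ?thesis by (simp add: power3_eq_cube power4_eq_xxxx mult.assoc)
qed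

lemma helix_of_covector:
  fixes t1 t2 \<rho> r :: real
  assumes t: "0 < t1" "t2 \<noteq> 0" and r: "0 < r" "r\<^sup>2 = t1\<^sup>2 + t2\<^sup>2" "sin r \<noteq> 0" and \<rho>: "0 < \<rho>"
  defines "w \<equiv> (1 / r) *\<^sub>R (vector [t1, t2, 0] :: real^3)" and "\<nu> \<equiv> (1 / r) *\<^sub>R (vector [- t2, t1, 0] :: real^3)"
    and "b \<equiv> (vector [0, 0, 1] :: real^3)"
  defines "n\<^sub>1 \<equiv> cos r *\<^sub>R \<nu> + sin r *\<^sub>R b" and "n\<^sub>2 \<equiv> sin r *\<^sub>R \<nu> - cos r *\<^sub>R b"
    and "P \<equiv> \<rho> * t1 / r\<^sup>2" and "C \<equiv> - \<rho> * t2 / (r * sin r)"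
  defines "y \<equiv> ycot r"
  shows "helix P C n\<^sub>1 n\<^sub>2 w" (is ?helix)
    and "helix.pos P C n\<^sub>1 n\<^sub>2 w r = \<rho> *\<^sub>R e\<^sub>1" (is ?pos)
    and "helix.vert P C n\<^sub>1 n\<^sub>2 w r = (\<rho>\<^sup>2 / 4) *\<^sub>R vector [t1 * t2\<^sup>2 * (r\<^sup>2 + 3 * y + y\<^sup>2) / r ^ 4,
        t2 * (t2\<^sup>2 * (r\<^sup>2 + 3 * y + y\<^sup>2) / r ^ 4 - 2 * y / r\<^sup>2), 0]" (is ?vert)
    and "(helix.speed P C * r)\<^sup>2 = \<rho>\<^sup>2 * (t1\<^sup>2 / r\<^sup>2 + t2\<^sup>2 / (sin r)\<^sup>2)" (is ?speed)
    and "helix.cut P C r = 2 * \<rho>\<^sup>2 * sin r * (t1\<^sup>2 * y - t2\<^sup>2 * (r\<^sup>2 + y + y\<^sup>2) / 2) / r ^ 3" (is ?cut)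
proof -
  have one: "t1\<^sup>2 / r\<^sup>2 + t2\<^sup>2 / r\<^sup>2 = 1" 
  proof -
    have "t1\<^sup>2 / r\<^sup>2 + t2\<^sup>2 / r\<^sup>2 = r\<^sup>2 / r\<^sup>2" by (simp only: r(2) add_divide_distrib)
    then show ?thesis using r(1) by simp
  qed
  have iw: "w \<bullet> w = 1" "\<nu> \<bullet> \<nu> = 1" "b \<bullet> b = 1" "w \<bullet> \<nu> = 0" "w \<bullet> b = 0" "\<nu> \<bullet> b = 0"
    using one by (simp_all add: w_def \<nu>_def b_def inner_vec_def sum_3 power2_eq_square)
  then have iw': "\<nu> \<bullet> w = 0" "b \<bullet> w = 0" "b \<bullet> \<nu> = 0" by (simp_all add: inner_commute)
  have cr: "cross3 w \<nu> = b" "cross3 \<nu> b = w" "cross3 b w = \<nu>"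
    using one by (simp_all add: w_def \<nu>_def b_def cross3_def vec_eq_iff forall_3 power2_eq_square add.commute)
  then have cr': "cross3 \<nu> w = - b" "cross3 b \<nu> = - w" "cross3 w b = - \<nu>" using cross_skew by metis+
  have SK: "cos r * cos r = 1 - sin r * sin r" using sin_cos_squared_add[of r] by (simp add: power2_eq_square)
  show ?helix
  proof
    show "0 < P" using t(1) r(1) \<rho> by (simp add: P_def)
    show "C \<noteq> 0" using t(2) r(1,3) \<rho> by (simp add: C_def)
    show "n\<^sub>1 \<bullet> n\<^sub>1 = 1" "n\<^sub>2 \<bullet> n\<^sub>2 = 1" "w \<bullet> w = 1" "n\<^sub>1 \<bullet> n\<^sub>2 = 0" "n\<^sub>1 \<bullet> w = 0" "n\<^sub>2 \<bullet> w = 0"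
      by (simp_all add: n\<^sub>1_def n\<^sub>2_def inner_add_left inner_add_right inner_diff_left inner_diff_right iw iw' SK)
    show "cross3 n\<^sub>1 w = n\<^sub>2" "cross3 w n\<^sub>2 = n\<^sub>1"
      by (simp_all add: n\<^sub>1_def n\<^sub>2_def cross_add_left Cross3.right_diff_distrib cross_mult_left cross_mult_right cr cr')
    have "cross3 n\<^sub>2 n\<^sub>1 = ((sin r)\<^sup>2 + (cos r)\<^sup>2) *\<^sub>R w"
      by (simp only: n\<^sub>1_def n\<^sub>2_def cross_add_right Cross3.left_diff_distrib cross_mult_left cross_mult_right cr cr' cross_refl)
        (simp add: power2_eq_square scaleR_add_left del: sin_cos_squared_add sin_cos_squared_add2)
    then show "cross3 n\<^sub>2 n\<^sub>1 = w" by simp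
  qed
  then interpret helix P C n\<^sub>1 n\<^sub>2 w .
  have n: "(a * cos r) *\<^sub>R n\<^sub>1 + (a * sin r) *\<^sub>R n\<^sub>2 = a *\<^sub>R \<nu>" for a
  proof -
    have "(a * cos r) *\<^sub>R n\<^sub>1 + (a * sin r) *\<^sub>R n\<^sub>2 = (a * (cos r * cos r)) *\<^sub>R \<nu> + (a * (sin r * sin r)) *\<^sub>R \<nu>"
      by (simp add: n\<^sub>1_def n\<^sub>2_def algebra_simps)
    also have "\<dots> = (a * (cos r * cos r) + a * (sin r * sin r)) *\<^sub>R \<nu>" by (simp only: scaleR_add_left)
    also have "a * (cos r * cos r) + a * (sin r * sin r) = a" by (simp add: SK algebra_simps)
    finally show ?thesis .
  qed
  have PC: "P * r = \<rho> * t1 / r" "C * sin r = - \<rho> * t2 / r" using r(1,3) by (simp_all add: P_def C_def power2_eq_square)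
  have "pos r = (\<rho> * t1 / r) *\<^sub>R w + (- \<rho> * t2 / r) *\<^sub>R \<nu>"
    unfolding pos_def add.assoc n PC by (rule refl)
  also have "\<dots> = \<rho> *\<^sub>R e\<^sub>1"
  proof -
    have "\<rho> * t1 * t1 / (r * r) + \<rho> * t2 * t2 / (r * r) = \<rho> * (t1\<^sup>2 / r\<^sup>2 + t2\<^sup>2 / r\<^sup>2)"
      by (simp add: distrib_left power2_eq_square)
    then show ?thesis unfolding one
      by (simp add: w_def \<nu>_def vec_eq_iff forall_3 axis_def)
  qed
  finally show ?pos .
  have C2: "C\<^sup>2 * (sin r)\<^sup>2 = \<rho>\<^sup>2 * t2\<^sup>2 / r\<^sup>2"
    using arg_cong[OF PC(2), of "\<lambda>x. x\<^sup>2"] by (simp add: power_mult_distrib power_divide)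
  have Q: "C\<^sup>2 * (r - sin r * cos r) = \<rho>\<^sup>2 * t2\<^sup>2 * (r\<^sup>2 + y + y\<^sup>2) / r ^ 3"
  proof -
    have "r * (C\<^sup>2 * (r - sin r * cos r)) = C\<^sup>2 * (r * (r - sin r * cos r))" by simp
    also have "\<dots> = (C\<^sup>2 * (sin r)\<^sup>2) * (r\<^sup>2 + y + y\<^sup>2)"
      unfolding sin_ycot_identities(1)[OF r(3), symmetric] y_def by simp
    also have "\<dots> = r * (\<rho>\<^sup>2 * t2\<^sup>2 * (r\<^sup>2 + y + y\<^sup>2) / r ^ 3)"
      unfolding C2 using r(1) by (simp add: power2_eq_square power3_eq_cube)
    finally show ?thesis using r(1) by (simp only: mult_cancel_left) auto
  qed
  have Y: "r * cos r - sin r = sin r * y" using r(3) by (simp add: y_def ycot_eq)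
  have PCy: "- (P * C / 2) * (sin r - r * cos r) = - (\<rho>\<^sup>2 * t1 * t2 * y / (2 * r ^ 3))"
  proof -
    have "- (P * C / 2) * (sin r - r * cos r) = P / 2 * (C * (r * cos r - sin r))" by (simp add: right_diff_distrib mult_ac diff_divide_distrib)
    also have "\<dots> = P / 2 * y * (C * sin r)" unfolding Y by simp
    also have "\<dots> = - (\<rho>\<^sup>2 * t1 * t2 * y / (2 * r ^ 3))" unfolding PC P_def
      by (simp add: power2_eq_square power3_eq_cube mult_ac)
    finally show ?thesis .
  qed
  have "vert r = (\<rho>\<^sup>2 * t2\<^sup>2 * (r\<^sup>2 + y + y\<^sup>2) / r ^ 3 / 4) *\<^sub>R w + (- (\<rho>\<^sup>2 * t1 * t2 * y / (2 * r ^ 3))) *\<^sub>R \<nu>"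
    unfolding vert_def add.assoc n PCy using Q by simp
  also have "\<dots> = (\<rho>\<^sup>2 / 4) *\<^sub>R vector [t1 * t2\<^sup>2 * (r\<^sup>2 + 3 * y + y\<^sup>2) / r ^ 4,
        t2 * (t2\<^sup>2 * (r\<^sup>2 + 3 * y + y\<^sup>2) / r ^ 4 - 2 * y / r\<^sup>2), 0]"
  proof -
    have c1: "\<rho>\<^sup>2 * t2\<^sup>2 * (r\<^sup>2 + y + y\<^sup>2) / r ^ 3 / 4 * (t1 / r) - - (\<rho>\<^sup>2 * t1 * t2 * y / (2 * r ^ 3)) * (t2 / r)
      = \<rho>\<^sup>2 / 4 * (t1 * t2\<^sup>2 * (r\<^sup>2 + 3 * y + y\<^sup>2) / r ^ 4)"
      using r(1) by (simp add: field_simps power2_eq_square power3_eq_cube power4_eq_xxxx)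
    have "2 * y / r\<^sup>2 = 2 * y * (t1\<^sup>2 + t2\<^sup>2) / r ^ 4"
      unfolding r(2)[symmetric] using r(1) by (simp add: power2_eq_square power4_eq_xxxx)
    then have c2: "\<rho>\<^sup>2 * t2\<^sup>2 * (r\<^sup>2 + y + y\<^sup>2) / r ^ 3 / 4 * (t2 / r) + - (\<rho>\<^sup>2 * t1 * t2 * y / (2 * r ^ 3)) * (t1 / r)
      = \<rho>\<^sup>2 / 4 * (t2 * (t2\<^sup>2 * (r\<^sup>2 + 3 * y + y\<^sup>2) / r ^ 4 - 2 * y / r\<^sup>2))"
      using r(1) by (simp only:) (simp add: field_simps power2_eq_square power3_eq_cube power4_eq_xxxx)
    have "\<alpha> *\<^sub>R w + \<beta> *\<^sub>R \<nu> = vector [\<alpha> * (t1 / r) - \<beta> * (t2 / r), \<alpha> * (t2 / r) + \<beta> * (t1 / r), 0]" for \<alpha> \<beta>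
      by (simp add: w_def \<nu>_def vec_eq_iff forall_3)
    moreover have "\<alpha> *\<^sub>R vector [x, z, 0] = (vector [\<alpha> * x, \<alpha> * z, 0] :: real^3)" for \<alpha> x z
      by (simp add: vec_eq_iff forall_3)
    ultimately show ?thesis by (simp only: c1 c2)
  qed
  finally show ?vert .
  have "(speed * r)\<^sup>2 = (P * r)\<^sup>2 + C\<^sup>2 * r\<^sup>2"
    by (simp add: speed_def power_mult_distrib algebra_simps)
  also have "\<dots> = \<rho>\<^sup>2 * (t1\<^sup>2 / r\<^sup>2 + t2\<^sup>2 / (sin r)\<^sup>2)"
    unfolding PC using r(1,3) by (simp add: C_def power_divide power_mult_distrib algebra_simps)
  finally show ?speed .
  have "cut r = 2 * P\<^sup>2 * r * (sin r * y) - sin r * (\<rho>\<^sup>2 * t2\<^sup>2 * (r\<^sup>2 + y + y\<^sup>2) / r ^ 3)"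
    unfolding cut_def Y Q[symmetric] by simp
  also have "2 * P\<^sup>2 * r * (sin r * y) = 2 * \<rho>\<^sup>2 * t1\<^sup>2 * sin r * y / r ^ 3"
    unfolding P_def using r(1) by (simp add: power2_eq_square power3_eq_cube mult_ac)
  finally show ?cut by (simp add: right_diff_distrib diff_divide_distrib mult_ac)
qed

text \<open>With y = \<open>ycot r\<close>, r^4 \<open>K\<^sub>3\<close> equals -2 (t1^2 y - t2^2
  (r^2 + y + y^2) / 2). As sin r < 0 on the second domain, negativity of \<open>K\<^sub>3\<close>
  means that the geodesic has not yet reached the cut locus.\<close>

lemma covector_before_cut:
  fixes t1 t2 :: real
  assumes dom: "vector [t1, t2] \<in> \<Omega>_plus_1 \<union> \<Omega>_minus_4"
  defines "r \<equiv> norm (vector [t1, t2] :: real^2)"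
  shows "0 < t1" "t2 \<noteq> 0" "0 < r" "r < vartheta\<^sub>1" "r\<^sup>2 = t1\<^sup>2 + t2\<^sup>2" "sin r \<noteq> 0" "0 < r\<^sup>2 + 3 * ycot r + (ycot r)\<^sup>2"
    and "r \<le> pi \<or> sin r * (t1\<^sup>2 * ycot r - t2\<^sup>2 * (r\<^sup>2 + ycot r + (ycot r)\<^sup>2) / 2) < 0"
proof -
  show r2: "r\<^sup>2 = t1\<^sup>2 + t2\<^sup>2"
    unfolding r_def power2_norm_eq_inner by (simp add: inner_vec_def sum_2 power2_eq_square)
  have "(0 < t1 \<and> 0 < t2 \<and> r < pi) \<or> (pi < t1 \<and> t2 < 0 \<and> pi < r \<and> r < vartheta\<^sub>1 \<and> K\<^sub>3 (vector [t1, t2]) < 0)"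
    using dom by (auto simp: \<Omega>_plus_1_def \<Omega>_minus_4_def r_def)
  then consider "0 < t1" "0 < t2" "r < pi" | "pi < t1" "t2 < 0" "pi < r" "r < vartheta\<^sub>1" "K\<^sub>3 (vector [t1, t2]) < 0"
    by blast
  then have "0 < t1 \<and> t2 \<noteq> 0 \<and> 0 < r \<and> r < vartheta\<^sub>1 \<and> sin r \<noteq> 0 \<and> 0 < r\<^sup>2 + 3 * ycot r + (ycot r)\<^sup>2 \<and>
    (r \<le> pi \<or> sin r * (t1\<^sup>2 * ycot r - t2\<^sup>2 * (r\<^sup>2 + ycot r + (ycot r)\<^sup>2) / 2) < 0)"
  proof cases
    case 1
    have "r \<noteq> 0" using r2 1 by auto
    then have r: "0 < r" by (simp add: r_def)
    then have s: "0 < sin r" using 1 by (intro sin_gt_zero)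
    then have "0 < (sin r)\<^sup>2 * (r\<^sup>2 + 3 * ycot r + (ycot r)\<^sup>2)"
      using h_fun_pos[OF r 1(3)] sin_ycot_identities(3)[of r] by simp
    then have "0 < r\<^sup>2 + 3 * ycot r + (ycot r)\<^sup>2" by (simp add: zero_less_mult_iff)
    then show ?thesis using 1 r s vartheta1_gt_pi by auto
  next
    case 2
    define y where "y = ycot r"
    have r: "0 < r" "0 < y" and s: "sin r < 0"
      using 2 pi_less_imp_pos ycot_pos[of r] sin_neg_below_vartheta1[of r] by (auto simp: y_def)
    have B: "0 < r\<^sup>2 + 3 * y + y\<^sup>2" using r by (intro add_pos_pos) auto
    have "K\<^sub>3 (vector [t1, t2]) = 2 * (- y / r\<^sup>2) + (r\<^sup>2 + 3 * y + y\<^sup>2) / r ^ 4 * t2\<^sup>2"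
    proof -
      have nz: "r \<noteq> 0" "sin r \<noteq> 0" using r s by auto
      show ?thesis
        unfolding K\<^sub>3_def Let_def r_def[symmetric] deriv_psi[OF nz] psi_ycot[OF nz(1)] y_def by simp
    qed
    then have "r ^ 4 * (2 * (- y / r\<^sup>2) + (r\<^sup>2 + 3 * y + y\<^sup>2) / r ^ 4 * t2\<^sup>2) < 0"
      using 2(5) r by (simp only: mult_pos_neg zero_less_power)
    moreover have "r ^ 4 * (2 * (- y / r\<^sup>2) + (r\<^sup>2 + 3 * y + y\<^sup>2) / r ^ 4 * t2\<^sup>2)
        = - 2 * y * r\<^sup>2 + (r\<^sup>2 + 3 * y + y\<^sup>2) * t2\<^sup>2"
      using r(1) by (simp add: right_diff_distrib power2_eq_square power4_eq_xxxx)
    moreover have "y * r\<^sup>2 = y * t1\<^sup>2 + y * t2\<^sup>2" by (simp add: r2 distrib_left)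
    ultimately have "0 < t1\<^sup>2 * y - t2\<^sup>2 * (r\<^sup>2 + y + y\<^sup>2) / 2" by (simp add: algebra_simps)
    then have "sin r * (t1\<^sup>2 * y - t2\<^sup>2 * (r\<^sup>2 + y + y\<^sup>2) / 2) < 0" using s by (intro mult_neg_pos)
    then show ?thesis using 2 r B s pi_less_imp_pos by (auto simp: y_def)
  qed
  then show "0 < t1" "t2 \<noteq> 0" "0 < r" "r < vartheta\<^sub>1" "sin r \<noteq> 0" "0 < r\<^sup>2 + 3 * ycot r + (ycot r)\<^sup>2"
    "r \<le> pi \<or> sin r * (t1\<^sup>2 * ycot r - t2\<^sup>2 * (r\<^sup>2 + ycot r + (ycot r)\<^sup>2) / 2) < 0"
    by auto
qed

section \<open>Reduction of all expressions to one rational form\<close>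

theorem theorem2p2:
  fixes t1 t2 :: real and \<theta> u :: "real^3" and g\<^sub>u :: n32
  assumes "vector [t1, t2] \<in> \<Omega>_plus_1 \<union> \<Omega>_minus_4"
    and "\<theta> = vector [t1, t2, 0]"
    and "u = vector [\<Lambda> (vector [t1, t2]) $ 1, \<Lambda> (vector [t1, t2]) $ 2, 0]"
    and "g\<^sub>u = (e\<^sub>1, (1/4) *\<^sub>R u)"
  shows "(cc_dist g\<^sub>u)^2 = t1^2 / (norm \<theta>)^2 + t2^2 / (sin (norm \<theta>))^2
    \<and> t1^2 / (norm \<theta>)^2 + t2^2 / (sin (norm \<theta>))^2
        = - (t2^2) * \<psi> (norm \<theta>) + u \<bullet> \<theta> + 1
    \<and> - (t2^2) * \<psi> (norm \<theta>) + u \<bullet> \<theta> + 1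
        = \<phi>\<^sub>1 (norm \<theta>) * (u$1 * (t1 / norm \<theta>) + u$2 * (t2 / norm \<theta>)) + 1
    \<and> \<phi>\<^sub>1 (norm \<theta>) * (u$1 * (t1 / norm \<theta>) + u$2 * (t2 / norm \<theta>)) + 1
        = \<phi>\<^sub>2 (norm \<theta>) * u$1 * (norm \<theta> / t1) + 1
    \<and> \<phi>\<^sub>2 (norm \<theta>) * u$1 * (norm \<theta> / t1) + 1
        = \<phi>\<^sub>3 (norm \<theta>) * sqrt (u$1 * (u$1 + u$2 * (t2 / t1))) + 1
    \<and> (cc_dist g\<^sub>u)^2 = \<phi> g\<^sub>u \<theta>
    \<and> (\<forall>x :: real^3. norm x > 0 \<longrightarrow>
         (cc_dist (norm x *\<^sub>R e\<^sub>1, ((norm x)^2 / 4) *\<^sub>R u))^2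
           = \<phi> (norm x *\<^sub>R e\<^sub>1, ((norm x)^2 / 4) *\<^sub>R u) \<theta>)"
proof -
  define r where "r = norm (vector [t1, t2] :: real^2)"
  note c = covector_before_cut[OF assms(1), folded r_def]
  have n\<theta>: "norm \<theta> = r"
    unfolding assms(2) r_def norm_eq_sqrt_inner by (simp add: inner_vec_def sum_2 sum_3)
  define y where "y = ycot r"
  \<comment> \<open>Every expression in the chain is shown to equal t2^2 E / r^2 + 1; Q and B enter
    through the denominators of \<open>\<phi>\<^sub>1\<close> and \<open>\<phi>\<^sub>2\<close> and
    cancel. E \<ge> 0 identifies the square root in the last expression.\<close>
  define B Q E where "B = r\<^sup>2 + 3 * y + y\<^sup>2" and "Q = r\<^sup>2 + y + y\<^sup>2" and "E = r\<^sup>2 + 2 * y + y\<^sup>2"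
  define D where "D = t1\<^sup>2 / r\<^sup>2 + t2\<^sup>2 / (sin r)\<^sup>2"
  have B: "0 < B" using c(7) by (simp add: B_def y_def)
  have s2: "0 < (sin r)\<^sup>2" using c(6) by simp
  have sE: "(sin r)\<^sup>2 * E = r\<^sup>2 - (sin r)\<^sup>2" and sQ: "(sin r)\<^sup>2 * Q = r * (r - sin r * cos r)"
    and sB: "(sin r)\<^sup>2 * B = h_fun r"
    using sin_ycot_identities[OF c(6)] by (simp_all add: E_def Q_def B_def y_def)
  have E: "0 \<le> E"
  proof -
    have "(sin r)\<^sup>2 \<le> r\<^sup>2" using abs_sin_x_le_abs_x[of r] by (simp add: abs_le_square_iff)
    then have "0 \<le> (sin r)\<^sup>2 * E" unfolding sE by simp
    then show ?thesis using s2 by (simp add: zero_le_mult_iff)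
  qed
  have Q: "0 < Q"
  proof (cases "0 < y")
    case True
    then show ?thesis using c(3) unfolding Q_def by (intro add_pos_pos) auto
  next
    case False
    then show ?thesis using B unfolding Q_def B_def by simp
  qed
  have u: "u = vector [t1 * t2\<^sup>2 * B / r ^ 4, t2 * (t2\<^sup>2 * B / r ^ 4 - 2 * y / r\<^sup>2), 0]"
    unfolding assms(3) \<Lambda>_def Let_def r_def[symmetric] using c(3,6)
    by (simp add: deriv_psi psi_ycot B_def y_def mult_ac)
  \<comment> \<open>Proved for all \<rho> at once, with the dilation built into the helix data;
    \<open>g\<^sub>u\<close> is the instance \<rho> = 1.\<close>
  have dist: "(cc_dist (\<rho> *\<^sub>R e\<^sub>1, (\<rho>\<^sup>2 / 4) *\<^sub>R u))\<^sup>2 = \<rho>\<^sup>2 * D" if \<rho>: "0 < \<rho>" for \<rho>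
  proof -
    note h = helix_of_covector[OF c(1-3,5,6) \<rho>]
    interpret helix "\<rho> * t1 / r\<^sup>2" "- \<rho> * t2 / (r * sin r)"
      "cos r *\<^sub>R (1 / r) *\<^sub>R (vector [- t2, t1, 0] :: real^3) + sin r *\<^sub>R vector [0, 0, 1]"
      "sin r *\<^sub>R (1 / r) *\<^sub>R (vector [- t2, t1, 0] :: real^3) - cos r *\<^sub>R vector [0, 0, 1]"
      "(1 / r) *\<^sub>R (vector [t1, t2, 0] :: real^3)"
      by (rule h(1))
    have "r \<le> pi \<or> cut r < 0"
    proof -
      have "cut r = 2 * \<rho>\<^sup>2 / r ^ 3 * (sin r * (t1\<^sup>2 * y - t2\<^sup>2 * (r\<^sup>2 + y + y\<^sup>2) / 2))"
        unfolding h(5) y_def by simp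
      moreover have "0 < 2 * \<rho>\<^sup>2 / r ^ 3" using \<rho> c(3) by simp
      ultimately show ?thesis using c(8) mult_pos_neg unfolding y_def by metis
    qed
    from cc_dist_helix[OF c(3,4) this] have "cc_dist (\<rho> *\<^sub>R e\<^sub>1, (\<rho>\<^sup>2 / 4) *\<^sub>R u) = speed * r"
      unfolding h(2,3) u B_def y_def by simp
    then show ?thesis unfolding D_def using h(4) by simp
  qed
  have one: "t1\<^sup>2 / r\<^sup>2 + t2\<^sup>2 / r\<^sup>2 = 1" using c(3) by (simp add: c(5)[symmetric] flip: add_divide_distrib)
  have D: "D = t2\<^sup>2 * E / r\<^sup>2 + 1"
  proof -
    have "t2\<^sup>2 * E / r\<^sup>2 = t2\<^sup>2 * ((sin r)\<^sup>2 * E) / ((sin r)\<^sup>2 * r\<^sup>2)" using s2 by simp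
    also have "\<dots> = t2\<^sup>2 / (sin r)\<^sup>2 - t2\<^sup>2 / r\<^sup>2"
      unfolding sE using s2 c(3) by (simp add: field_simps)
    finally show ?thesis using one by (simp add: D_def)
  qed
  have u\<theta>: "u \<bullet> \<theta> = t2\<^sup>2 * Q / r\<^sup>2" "u $ 1 * t1 + u $ 2 * t2 = t2\<^sup>2 * Q / r\<^sup>2"
  proof -
    have "u $ 1 * t1 + u $ 2 * t2 = t2\<^sup>2 * (t1\<^sup>2 + t2\<^sup>2) * B / r ^ 4 - 2 * y * t2\<^sup>2 / r\<^sup>2"
      by (simp add: u algebra_simps power2_eq_square add_divide_distrib)
    also have "\<dots> = t2\<^sup>2 * Q / r\<^sup>2"
      unfolding c(5)[symmetric] B_def Q_def using c(3)
      by (simp add: field_simps power2_eq_square power4_eq_xxxx)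
    finally show *: "u $ 1 * t1 + u $ 2 * t2 = t2\<^sup>2 * Q / r\<^sup>2" .
    have "u \<bullet> \<theta> = u $ 1 * t1 + u $ 2 * t2 + u $ 3 * 0"
      unfolding assms(2) by (simp add: inner_vec_def sum_3)
    then show "u \<bullet> \<theta> = t2\<^sup>2 * Q / r\<^sup>2" using * by simp
  qed
  have \<psi>: "\<psi> r = - y / r\<^sup>2" using c(3) by (simp add: psi_ycot y_def)
  have F0: "- (t2\<^sup>2) * \<psi> r + u \<bullet> \<theta> + 1 = t2\<^sup>2 * E / r\<^sup>2 + 1"
    by (simp add: \<psi> u\<theta>(1) Q_def E_def algebra_simps add_divide_distrib)
  have p1: "\<phi>\<^sub>1 r = r * E / Q"
  proof -
    have "\<phi>\<^sub>1 r = r * ((sin r)\<^sup>2 * E) / (r * (r - sin r * cos r))"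
      unfolding \<phi>\<^sub>1_def sE using c(3) by simp
    also have "\<dots> = r * E / Q" unfolding sQ[symmetric] using s2 by simp
    finally show ?thesis .
  qed
  have p2: "\<phi>\<^sub>2 r = r * E / B"
    unfolding \<phi>\<^sub>2_def sE[symmetric] sB[symmetric] using s2 by simp
  have F1: "\<phi>\<^sub>1 r * (u $ 1 * (t1 / r) + u $ 2 * (t2 / r)) = t2\<^sup>2 * E / r\<^sup>2"
  proof -
    have "u $ 1 * (t1 / r) + u $ 2 * (t2 / r) = t2\<^sup>2 * Q / r\<^sup>2 / r"
      unfolding u\<theta>(2)[symmetric] by (simp add: add_divide_distrib)
    then show ?thesis using c(3) Q by (simp add: p1)
  qed
  have F2: "\<phi>\<^sub>2 r * u $ 1 * (r / t1) = t2\<^sup>2 * E / r\<^sup>2"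
    using c(1,3) B by (simp add: p2 u power2_eq_square power4_eq_xxxx)
  have F3: "\<phi>\<^sub>3 r * sqrt (u $ 1 * (u $ 1 + u $ 2 * (t2 / t1))) = t2\<^sup>2 * E / r\<^sup>2"
  proof -
    have "u $ 1 + u $ 2 * (t2 / t1) = t2\<^sup>2 * Q / r\<^sup>2 / t1"
      unfolding u\<theta>(2)[symmetric] using c(1) by (simp add: field_simps)
    then have "u $ 1 * (u $ 1 + u $ 2 * (t2 / t1)) = t1 * t2\<^sup>2 * B / r ^ 4 * (t2\<^sup>2 * Q / r\<^sup>2 / t1)"
      by (simp add: u)
    then have "\<phi>\<^sub>1 r * \<phi>\<^sub>2 r * (u $ 1 * (u $ 1 + u $ 2 * (t2 / t1))) = (t2\<^sup>2 * E / r\<^sup>2)\<^sup>2"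
      using c(1,3) Q B by (simp add: p1 p2 power2_eq_square power4_eq_xxxx mult_ac)
    then have "\<phi>\<^sub>3 r * sqrt (u $ 1 * (u $ 1 + u $ 2 * (t2 / t1))) = sqrt ((t2\<^sup>2 * E / r\<^sup>2)\<^sup>2)"
      unfolding \<phi>\<^sub>3_def real_sqrt_mult[symmetric] by simp
    also have "\<dots> = t2\<^sup>2 * E / r\<^sup>2" using E by (intro real_sqrt_unique) auto
    finally show ?thesis .
  qed
  have \<phi>: "\<phi> (\<rho> *\<^sub>R e\<^sub>1, (\<rho>\<^sup>2 / 4) *\<^sub>R u) \<theta> = \<rho>\<^sup>2 * D" if "0 < \<rho>" for \<rho>
  proof -
    have "\<theta> $ 2 = t2" "\<theta> $ 3 = 0" by (simp_all add: assms(2))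
    then show ?thesis
      unfolding \<phi>_eq[OF that] n\<theta> D F0[symmetric] by (simp add: algebra_simps)
  qed
  have g: "g\<^sub>u = (1 *\<^sub>R e\<^sub>1, (1\<^sup>2 / 4) *\<^sub>R u)" using assms(4) by simp
  have "(cc_dist g\<^sub>u)\<^sup>2 = D" "\<phi> g\<^sub>u \<theta> = D" unfolding g using dist[of 1] \<phi>[of 1] by simp_all
  then show ?thesis
    using dist \<phi> unfolding n\<theta> D_def[symmetric] F0 F1 F2 F3 D[symmetric] by simp
qed

end
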